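(* Let $(S(t))_{t\ge0}$ be a sectorially bounded holomorphic $C_0$-semigroup of angle $\theta\in(0,\pi/2]$ on a complex Banach space $X$, and let $\mu$ be a (Borel) probability measure on $[0,\infty)$. Let $$Tx=\int_0^\infty S(t)x\,\mu(dt),\qquad x\in X.$$ Then $T$ is a Ritt operator of angle $\frac\pi2-\theta$.
   Context: $\Sigma_\theta=\{z\in\mathbb{C}: z\ne0,\ |\arg z|<\theta\}$ for $\theta\in(0,\pi]$ and $\Sigma_0=(0,\infty)$. A $C_0$-semigroup is a sectorially bounded holomorphic semigroup of angle $\theta\in(0,\pi/2]$ if it has a holomorphic extension to $\Sigma_\theta$ which is bounded in norm on $\Sigma_{\theta'}$ for every $\theta'\in(0,\theta)$. An operator $T\in\mathcal{L}(X)$ is a Ritt operator of angle $\phi\in[0,\pi/2)$ if $\sigma(T)\subset\{\lambda\in1-\overline{\Sigma}_\phi:|\lambda|\le1\}$ and for each $\phi'\in(\phi,\pi/2)$ there exists $C_{\phi'}$ such that $$\|(\lambda-T)^{-1}\|\le\frac{C_{\phi'}}{|\lambda-1|}\qquad\text{for all }\lambda\in\mathbb{C}\text{ not in the set }\{\lambda\in1-\overline{\Sigma}_{\phi'}:|\lambda|\le1\}.$$ *)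

theory Defs
  imports "HOL-Probability.Probability"
begin

class complex_normed_vector = real_normed_vector +
  fixes scaleC :: "complex \<Rightarrow> 'a \<Rightarrow> 'a"  (infixr \<open>*\<^sub>C\<close> 75)
  assumes scaleC_add_right: "a *\<^sub>C (x + y) = a *\<^sub>C x + a *\<^sub>C y"
    and scaleC_add_left: "(a + b) *\<^sub>C x = a *\<^sub>C x + b *\<^sub>C x"
    and scaleC_scaleC: "a *\<^sub>C b *\<^sub>C x = (a * b) *\<^sub>C x"
    and scaleC_one: "1 *\<^sub>C x = x"
    and scaleC_of_real: "complex_of_real r *\<^sub>C x = r *\<^sub>R x"
    and norm_scaleC: "norm (a *\<^sub>C x) = cmod a * norm x"

class complex_banach = complex_normed_vector + banach

instantiation complex :: complex_banach
begin

definition scaleC_complex :: "complex \<Rightarrow> complex \<Rightarrow> complex" where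
  "scaleC_complex a x = a * x"

instance
  by standard (simp_all add: scaleC_complex_def algebra_simps norm_mult scaleR_conv_of_real)

end

(* Operators are plain functions; the operator norm is onorm, which is meaningful
   only together with boundedness. *)
definition bounded_clinear ::
  "('a::complex_normed_vector \<Rightarrow> 'b::complex_normed_vector) \<Rightarrow> bool" where
  "bounded_clinear T \<longleftrightarrow> bounded_linear T \<and> (\<forall>c x. T (c *\<^sub>C x) = c *\<^sub>C T x)"

definition resolvent :: "('a::complex_banach \<Rightarrow> 'a) \<Rightarrow> complex \<Rightarrow> 'a \<Rightarrow> 'a" where
  "resolvent T z = inv (\<lambda>x. z *\<^sub>C x - T x)"

definition spectrum :: "('a::complex_banach \<Rightarrow> 'a) \<Rightarrow> complex set" where
  "spectrum T = {z. \<not> (bij (\<lambda>x. z *\<^sub>C x - T x) \<and> bounded_clinear (resolvent T z))}"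

definition sector :: "real \<Rightarrow> complex set" where
  "sector \<theta> = (if \<theta> = 0 then complex_of_real ` {0<..} else {z. z \<noteq> 0 \<and> \<bar>Arg z\<bar> < \<theta>})"

(* Complex differentiability with respect to the operator norm. *)
definition operator_holomorphic_on ::
  "(complex \<Rightarrow> 'a::complex_banach \<Rightarrow> 'a) \<Rightarrow> complex set \<Rightarrow> bool" where
  "operator_holomorphic_on F A \<longleftrightarrow>
     (\<forall>z\<in>A. bounded_clinear (F z)) \<and>
     (\<forall>z\<in>A. \<exists>D. bounded_clinear D \<and>
        ((\<lambda>w. onorm (\<lambda>x. inverse (w - z) *\<^sub>C (F w x - F z x) - D x)) \<longlongrightarrow> 0) (at z within A))"

(* Semigroups are indexed by real; values at negative times are irrelevant. *)
definition C0_semigroup :: "(real \<Rightarrow> 'a::complex_banach \<Rightarrow> 'a) \<Rightarrow> bool" where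
  "C0_semigroup S \<longleftrightarrow>
     (\<forall>t\<ge>0. bounded_clinear (S t)) \<and>
     S 0 = id \<and>
     (\<forall>s\<ge>0. \<forall>t\<ge>0. S (s + t) = S s \<circ> S t) \<and>
     (\<forall>x. ((\<lambda>t. S t x) \<longlongrightarrow> x) (at_right 0))"

definition sectorially_bounded_holomorphic_semigroup ::
  "real \<Rightarrow> (real \<Rightarrow> 'a::complex_banach \<Rightarrow> 'a) \<Rightarrow> bool" where
  "sectorially_bounded_holomorphic_semigroup \<theta> S \<longleftrightarrow>
     0 < \<theta> \<and> \<theta> \<le> pi / 2 \<and>
     C0_semigroup S \<and>
     (\<exists>F. (\<forall>t>0. F (complex_of_real t) = S t) \<and>
          operator_holomorphic_on F (sector \<theta>) \<and>
          (\<forall>\<theta>'. 0 < \<theta>' \<and> \<theta>' < \<theta> \<longrightarrow> (\<exists>M. \<forall>z\<in>sector \<theta>'. onorm (F z) \<le> M)))"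

definition ritt_region :: "real \<Rightarrow> complex set" where
  "ritt_region \<phi> = {z \<in> (\<lambda>w. 1 - w) ` closure (sector \<phi>). cmod z \<le> 1}"

definition ritt_operator :: "real \<Rightarrow> ('a::complex_banach \<Rightarrow> 'a) \<Rightarrow> bool" where
  "ritt_operator \<phi> T \<longleftrightarrow>
     0 \<le> \<phi> \<and> \<phi> < pi / 2 \<and>
     bounded_clinear T \<and>
     spectrum T \<subseteq> ritt_region \<phi> \<and>
     (\<forall>\<phi>'. \<phi> < \<phi>' \<and> \<phi>' < pi / 2 \<longrightarrow>
        (\<exists>C. \<forall>z. z \<notin> ritt_region \<phi>' \<longrightarrow> onorm (resolvent T z) \<le> C / cmod (z - 1)))"

(* The library's Bochner integral is restricted to second-countable spaces. The following is
   has_bochner_integral verbatim without that restriction: since f is Borel measurable and each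
   s i takes finitely many values, the integrands norm (f x - s i x) are measurable, and
   convergence to 0 makes f almost everywhere separably valued. *)
definition has_banach_integral ::
  "'m measure \<Rightarrow> ('m \<Rightarrow> 'b::real_normed_vector) \<Rightarrow> 'b \<Rightarrow> bool" where
  "has_banach_integral M f y \<longleftrightarrow>
     f \<in> borel_measurable M \<and>
     (\<exists>s. (\<forall>i. Bochner_Integration.simple_bochner_integrable M (s i)) \<and>
          (\<lambda>i. \<integral>\<^sup>+x. norm (f x - s i x) \<partial>M) \<longlonglongrightarrow> 0 \<and>
          (\<lambda>i. Bochner_Integration.simple_bochner_integral M (s i)) \<longlonglongrightarrow> y)"

definition banach_integral ::
  "'m measure \<Rightarrow> ('m \<Rightarrow> 'b::real_normed_vector) \<Rightarrow> 'b" where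
  "banach_integral M f =
     (if \<exists>y. has_banach_integral M f y then THE y. has_banach_integral M f y else 0)"

lemma has_banach_integral_iff_has_bochner_integral:
  fixes f :: "'m \<Rightarrow> 'b::{real_normed_vector, second_countable_topology}"
  shows "has_banach_integral M f y \<longleftrightarrow> has_bochner_integral M f y"
  unfolding has_banach_integral_def has_bochner_integral.simps by blast

lemma banach_integral_eq_lebesgue_integral:
  fixes f :: "'m \<Rightarrow> 'b::{banach, second_countable_topology}"
  shows "banach_integral M f = integral\<^sup>L M f"
  unfolding banach_integral_def lebesgue_integral_def
    has_banach_integral_iff_has_bochner_integral by simp

end

theory Submission
  imports Defs "HOL-Complex_Analysis.Complex_Analysis"
begin

text \<open>
  Let \<open>-A\<close> be the generator of \<open>S\<close> and \<open>f\<close> the Laplace transform of \<open>\<mu>\<close>, so that formally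
  \<open>T = f(A)\<close> and \<open>(\<zeta> - T)\<inverse> = g(A)\<close> with \<open>g = 1 / (\<zeta> - f)\<close>. On the rays of a sector of half-angle
  \<open>\<psi> > \<pi>/2 - \<theta>\<close> the function \<open>1 - f\<close> stays in that sector, so \<open>\<bar>\<zeta> - f\<bar>\<close> is bounded below by a multiple of
  \<open>\<bar>1 - \<zeta>\<bar> + B(r)\<close> with \<open>B\<close> increasing and \<open>\<bar>f'\<bar> \<le> const \<cdot> B'\<close>; hence \<open>g\<close> has total variation
  \<open>O(1 / \<bar>1 - \<zeta>\<bar>)\<close> along the rays. The operator \<open>g(A)\<close> is written as an integral of the holomorphic
  semigroup over the two rays \<open>arg w = \<plusminus>\<alpha>\<close> with \<open>\<pi>/2 - \<psi> < \<alpha> < \<theta>\<close>, and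
  integration by parts bounds its norm by the variation of \<open>g\<close>.

  Neither the generator nor operator-valued contour integrals occur: all contour arguments are applied to
  scalar functions \<open>u(F(w)x)\<close> with \<open>u\<close> a bounded functional, and norming functionals exist by the
  Hahn--Banach theorem. The singularities of the integrals at \<open>0\<close> and \<open>\<infinity>\<close> are removed by replacing \<open>\<mu>\<close>
  by discrete measures, \<open>S(t)\<close> by \<open>exp(-\<epsilon>t) S(t)\<close> and the resolvent by its product with \<open>S(\<delta> + h)\<close>. The
  bounds are uniform in these regularizations, and the regularized resolvents commute with \<open>S\<close>, so they
  converge strongly to the resolvent of \<open>T\<close>.
\<close>

section \<open>Norming functionals\<close>

text \<open>The obstacle is a logarithmic divergence. On a time ray the variation of
  \<open>g\<close> only shows that \<open>w * G d w\<close> is bounded by a multiple of 1 / cmod (1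
  - \<zeta>), so pairing \<open>G\<close> with a bounded function leaves dt / t, divergent at both
  ends. The divergence cancels between the two rays: \<open>G\<close> is compared with its value at
  w = - t, where both spectral rays agree; the error is integrable against dt / t, and the common
  remainder meets the difference of the semigroup on the two rays divided by t, the derivative of a
  bounded function. The lower bound is a convexity argument. Each 1 - exp (- s z) lies in the cone,
  hence so does its average 1 - f, while a \<zeta> outside the Ritt region has modulus above 1 or
  puts 1 - \<zeta> outside a wider cone. The variation then reduces to the integral of B' / (cmod (1
  - \<zeta>) + B)^2, which has an explicit primitive. Discrete measures make f entire, so that f'
  exists up to the vertex 0, where the Laplace transform of a general \<mu> need not be
  differentiable.\<close>

definition sublinear :: "('a::real_vector \<Rightarrow> real) \<Rightarrow> bool" where
  "sublinear p \<longleftrightarrow> (\<forall>x y. p (x + y) \<le> p x + p y) \<and> (\<forall>c x. 0 < c \<longrightarrow> p (c *\<^sub>R x) = c * p x)"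

lemma sublinearD:
  assumes "sublinear p"
  shows "p (x + y) \<le> p x + p y" and "c > 0 \<Longrightarrow> p (c *\<^sub>R x) = c * p x" and "p 0 = 0"
    and "- p (- x) \<le> p x"
proof -
  show add: "p (x + y) \<le> p x + p y" for x y
    using assms by (auto simp: sublinear_def)
  show scale: "c > 0 \<Longrightarrow> p (c *\<^sub>R x) = c * p x" for c x
    using assms by (auto simp: sublinear_def)
  show zero: "p 0 = 0"
    using scale[of 2 0] by simp
  show "- p (- x) \<le> p x"
    using add[of x "- x"] zero by simp
qed

text \<open>The inequality for \<open>1/c\<close> at the vector \<open>c *\<^sub>R x\<close> is the
  reverse one; for infima only one direction is immediate.\<close>

lemma sublinearI:
  assumes "\<And>x y. p (x + y) \<le> p x + p y" and le: "\<And>c x. c > 0 \<Longrightarrow> p (c *\<^sub>R x) \<le> c * p x"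
  shows "sublinear p"
  unfolding sublinear_def
proof (intro conjI allI impI assms(1))
  fix c :: real and x assume c: "0 < c"
  from le[of "1/c" "c *\<^sub>R x"] le[OF c, of x] c
  show "p (c *\<^sub>R x) = c * p x" by (simp add: field_simps)
qed

text \<open>A minimal sublinear functional equals its reduction along every ray, which makes it additive.\<close>

definition ray_reduction :: "'a \<Rightarrow> ('a::real_vector \<Rightarrow> real) \<Rightarrow> 'a \<Rightarrow> real" where
  "ray_reduction y p x = (INF t\<in>{0..}. p (x + t *\<^sub>R y) - t * p y)"

text \<open>The bound is free of \<open>t\<close>, so the infimum defining the reduction is
  finite.\<close>

lemma ray_reduction_lower:
  assumes "sublinear p" "t \<ge> 0"
  shows "- p (- x) \<le> p (x + t *\<^sub>R y) - t * p y"
proof -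
  have "t * p y = p (t *\<^sub>R y)"
    using assms sublinearD(2,3)[OF assms(1)] by (cases "t = 0") auto
  also have "\<dots> = p ((x + t *\<^sub>R y) + (- x))" by simp
  also have "\<dots> \<le> p (x + t *\<^sub>R y) + p (- x)" by (rule sublinearD(1)[OF assms(1)])
  finally show ?thesis by simp
qed

lemma ray_reduction_le:
  assumes "sublinear p" "t \<ge> 0"
  shows "ray_reduction y p x \<le> p (x + t *\<^sub>R y) - t * p y"
  unfolding ray_reduction_def
proof (rule cINF_lower)
  show "bdd_below ((\<lambda>t. p (x + t *\<^sub>R y) - t * p y) ` {0..})"
    using ray_reduction_lower[OF assms(1)] by (intro bdd_belowI2[where m = "- p (- x)"]) auto
qed (use assms in auto)

lemma ray_reduction_greatest:
  assumes "\<And>t. t \<ge> 0 \<Longrightarrow> m \<le> p (x + t *\<^sub>R y) - t * p y"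
  shows "m \<le> ray_reduction y p x"
  unfolding ray_reduction_def using assms by (intro cINF_greatest) auto

text \<open>Parameters \<open>s\<close> for \<open>u\<close> and \<open>t\<close> for
  \<open>v\<close> combine to \<open>s + t\<close> for \<open>u + v\<close>; the two infima are then
  taken one after the other. Scaling by \<open>c\<close> substitutes \<open>c * t\<close> for
  \<open>t\<close>.\<close>

lemma sublinear_ray_reduction:
  assumes p: "sublinear p"
  shows "sublinear (ray_reduction y p)"
proof (rule sublinearI)
  fix u v
  have *: "ray_reduction y p (u + v) \<le> (p (u + s *\<^sub>R y) - s * p y) + (p (v + t *\<^sub>R y) - t * p y)"
    if "s \<ge> 0" "t \<ge> 0" for s t
  proof -
    have "ray_reduction y p (u + v) \<le> p ((u + v) + (s + t) *\<^sub>R y) - (s + t) * p y"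
      using that by (intro ray_reduction_le[OF p]) auto
    also have "(u + v) + (s + t) *\<^sub>R y = (u + s *\<^sub>R y) + (v + t *\<^sub>R y)"
      by (simp add: algebra_simps)
    also have "p \<dots> \<le> p (u + s *\<^sub>R y) + p (v + t *\<^sub>R y)" by (rule sublinearD(1)[OF p])
    finally show ?thesis by (simp add: algebra_simps)
  qed
  have "ray_reduction y p (u + v) - (p (v + t *\<^sub>R y) - t * p y) \<le> ray_reduction y p u" if "t \<ge> 0" for t
    using *[OF _ that] by (intro ray_reduction_greatest) (auto simp: algebra_simps)
  then have "ray_reduction y p (u + v) - ray_reduction y p u \<le> ray_reduction y p v"
    by (intro ray_reduction_greatest) (auto simp: algebra_simps)
  then show "ray_reduction y p (u + v) \<le> ray_reduction y p u + ray_reduction y p v" by simp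
next
  fix c :: real and x assume c: "0 < c"
  show "ray_reduction y p (c *\<^sub>R x) \<le> c * ray_reduction y p x"
  proof -
    have "ray_reduction y p (c *\<^sub>R x) / c \<le> ray_reduction y p x"
    proof (rule ray_reduction_greatest)
      fix t :: real assume t: "t \<ge> 0"
      have "ray_reduction y p (c *\<^sub>R x) \<le> p (c *\<^sub>R x + (c * t) *\<^sub>R y) - (c * t) * p y"
        using t c by (intro ray_reduction_le[OF p]) auto
      also have "c *\<^sub>R x + (c * t) *\<^sub>R y = c *\<^sub>R (x + t *\<^sub>R y)" by (simp add: algebra_simps)
      also have "p \<dots> = c * p (x + t *\<^sub>R y)" by (rule sublinearD(2)[OF p c])
      finally show "ray_reduction y p (c *\<^sub>R x) / c \<le> p (x + t *\<^sub>R y) - t * p y"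
        using c by (simp add: field_simps)
    qed
    then show ?thesis using c by (simp add: field_simps)
  qed
qed

lemma ray_reduction_le_self: "sublinear p \<Longrightarrow> ray_reduction y p x \<le> p x"
  using ray_reduction_le[of p 0 y x] by simp

lemma linear_if_minimal_sublinear:
  assumes p: "sublinear p"
    and min: "\<And>q. sublinear q \<Longrightarrow> (\<And>x. q x \<le> p x) \<Longrightarrow> q = p"
  shows "linear p"
proof -
  have eq: "ray_reduction y p = p" for y
    by (rule min) (simp_all add: p sublinear_ray_reduction ray_reduction_le_self)
  \<comment> \<open>The reduction at \<open>t = 1\<close> gives
    \<open>p x \<le> p (x + y) - p y\<close>, the half of additivity that sublinearity does not
    contain.\<close>
  have add: "p (x + y) = p x + p y" for x y
    using ray_reduction_le[OF p, of 1 y x] sublinearD(1)[OF p, of x y] by (simp add: eq)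
  have minus: "p (- x) = - p x" for x
    using add[of x "- x"] sublinearD(3)[OF p] by simp
  have "p (c *\<^sub>R x) = c *\<^sub>R p x" for c x
  proof -
    consider "c = 0" | "c > 0" | "- c > 0" by linarith
    then show ?thesis
      by cases (use sublinearD(2,3)[OF p] sublinearD(2)[OF p, of "- c" x] minus[of "(- c) *\<^sub>R x"] in auto)
  qed
  with add show ?thesis by (intro linearI)
qed

text \<open>Zorn's lemma for the reversed pointwise order. The infimum of a chain is finite because
  \<open>- p0 (- x)\<close> bounds it from below, and subadditive because of two members
  \<open>p\<close>, \<open>q\<close> the smaller one can serve in both summands.\<close>

lemma ex_minimal_sublinear:
  assumes p0: "sublinear (p0 :: 'a::real_vector \<Rightarrow> real)"
  obtains p where "sublinear p" "\<And>x. p x \<le> p0 x" "\<And>q. sublinear q \<Longrightarrow> (\<And>x. q x \<le> p x) \<Longrightarrow> q = p"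
proof -
  define A where "A = {p. sublinear p \<and> p \<le> p0}"
  have "\<exists>m\<in>A. \<forall>a\<in>A. m \<ge> a \<longrightarrow> a = m"
  proof (rule predicate_Zorn)
    show "partial_order_on A (relation_of (\<ge>) A)"
      by (rule partial_order_on_relation_ofI) auto
    fix C assume C: "C \<in> Chains (relation_of (\<ge>) A)"
    show "\<exists>u\<in>A. \<forall>a\<in>C. a \<ge> u"
    proof (cases "C = {}")
      case True
      with p0 show ?thesis by (auto simp: A_def)
    next
      case False
      define u where "u x = (INF p\<in>C. p x)" for x
      have CA: "p \<in> A" if "p \<in> C" for p
        using C that unfolding Chains_def relation_of_def by auto
      have lin: "p \<le> q \<or> q \<le> p" if "p \<in> C" "q \<in> C" for p q
        using C that unfolding Chains_def relation_of_def by auto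
      have low: "- p0 (- x) \<le> p x" if "p \<in> C" for p x
      proof -
        have "sublinear p" "p (- x) \<le> p0 (- x)" using CA[OF that] by (auto simp: A_def le_fun_def)
        with sublinearD(4)[of p x] show ?thesis by linarith
      qed
      have bdd: "bdd_below ((\<lambda>p. p x) ` C)" for x
        using low by (intro bdd_belowI2)
      have ule: "u x \<le> p x" if "p \<in> C" for p x
        unfolding u_def using bdd that by (rule cINF_lower)
      have ugr: "m \<le> u x" if "\<And>p. p \<in> C \<Longrightarrow> m \<le> p x" for m x
        unfolding u_def using False that by (rule cINF_greatest)
      have sub: "p \<in> C \<Longrightarrow> sublinear p" for p using CA by (auto simp: A_def)
      have "sublinear u"
      proof (rule sublinearI)
        fix x y
        have *: "u (x + y) \<le> p x + q y" if "p \<in> C" "q \<in> C" for p q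
          using lin[OF that]
        proof
          assume "p \<le> q"
          then have "p x + p y \<le> p x + q y" by (auto simp: le_fun_def)
          with ule[OF that(1), of "x + y"] sublinearD(1)[OF sub[OF that(1)], of x y] show ?thesis by linarith
        next
          assume "q \<le> p"
          then have "q x + q y \<le> p x + q y" by (auto simp: le_fun_def)
          with ule[OF that(2), of "x + y"] sublinearD(1)[OF sub[OF that(2)], of x y] show ?thesis by linarith
        qed
        have "u (x + y) - q y \<le> u x" if "q \<in> C" for q
          using *[OF _ that] by (intro ugr) (simp add: algebra_simps)
        then have "u (x + y) - u x \<le> u y" by (intro ugr) (simp add: algebra_simps)
        then show "u (x + y) \<le> u x + u y" by simp
      next
        fix c :: real and x assume c: "0 < c"
        show "u (c *\<^sub>R x) \<le> c * u x"
        proof -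
          have "u (c *\<^sub>R x) / c \<le> u x"
          proof (rule ugr)
            fix p assume "p \<in> C"
            with ule[OF this, of "c *\<^sub>R x"] sublinearD(2)[OF sub c, of p x] c
            show "u (c *\<^sub>R x) / c \<le> p x" by (simp add: field_simps)
          qed
          then show ?thesis using c by (simp add: field_simps)
        qed
      qed
      moreover have "u \<le> p0"
      proof -
        from False obtain p where "p \<in> C" by auto
        then have "u x \<le> p0 x" for x
          using ule[of p x] CA[of p] by (auto simp: A_def le_fun_def dest: spec[of _ x] intro: order_trans)
        then show ?thesis by (simp add: le_fun_def)
      qed
      ultimately have "u \<in> A" by (simp add: A_def)
      with ule show ?thesis by (auto simp: le_fun_def)
    qed
  qed
  then obtain m where m: "m \<in> A" "\<And>a. a \<in> A \<Longrightarrow> m \<ge> a \<Longrightarrow> a = m" by blast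
  show thesis
  proof (rule that)
    show "sublinear m" "m x \<le> p0 x" for x using m(1) by (auto simp: A_def le_fun_def)
    fix q :: "'a \<Rightarrow> real" assume q: "sublinear q" "\<And>x. q x \<le> m x"
    then have "q \<le> m" by (simp add: le_fun_def)
    moreover have "q \<in> A" using q(1) \<open>q \<le> m\<close> m(1) by (auto simp: A_def)
    ultimately show "q = m" using m(2) by simp
  qed
qed

text \<open>The minimal functional is taken below the reduction of the norm along \<open>y\<close>
  rather than below the norm itself: at \<open>- y\<close> with \<open>t = 1\<close> the reduction
  is at most \<open>- norm y\<close>, and this forces \<open>p y = norm y\<close>.\<close>

lemma real_norming_functional:
  fixes y :: "'a::real_normed_vector"
  obtains u :: "'a \<Rightarrow> real" where "linear u" "\<And>x. u x \<le> norm x" "u y = norm y"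
proof -
  have n: "sublinear (norm :: 'a \<Rightarrow> real)"
    by (auto simp: sublinear_def norm_triangle_ineq)
  obtain p where p: "sublinear p" "\<And>x. p x \<le> ray_reduction y norm x"
      "\<And>q. sublinear q \<Longrightarrow> (\<And>x. q x \<le> p x) \<Longrightarrow> q = p"
    using ex_minimal_sublinear[OF sublinear_ray_reduction[OF n, of y]] by metis
  have lin: "linear p" by (rule linear_if_minimal_sublinear[OF p(1,3)])
  have le: "p x \<le> norm x" for x
    using p(2)[of x] ray_reduction_le_self[OF n, of y x] by linarith
  have "p (- y) \<le> - norm y"
    using p(2)[of "- y"] ray_reduction_le[OF n, of 1 y "- y"] by simp
  with lin have "norm y \<le> p y" by (simp add: linear_neg)
  with le[of y] have "p y = norm y" by linarith
  with lin le show thesis by (intro that[of p]) auto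
qed

section \<open>Complex scalars and complex-linear norming functionals\<close>

lemma scaleC_zero_left: "0 *\<^sub>C (x :: 'a::complex_normed_vector) = 0"
  using norm_scaleC[of 0 x] by simp

lemma scaleC_minus_left: "(- c) *\<^sub>C (x :: 'a::complex_normed_vector) = - (c *\<^sub>C x)"
  using scaleC_add_left[of c "- c" x] by (simp add: scaleC_zero_left eq_neg_iff_add_eq_0 add.commute)

lemma scaleC_diff_right: "c *\<^sub>C (x - y) = c *\<^sub>C x - c *\<^sub>C (y :: 'a::complex_normed_vector)"
  using scaleC_add_right[of c "x - y" y] by (simp add: eq_diff_eq)

lemma bounded_bilinear_scaleC:
  "bounded_bilinear ((*\<^sub>C) :: complex \<Rightarrow> 'a::complex_normed_vector \<Rightarrow> 'a)"
proof
  show "\<exists>K. \<forall>a b. norm (a *\<^sub>C b :: 'a) \<le> norm a * norm b * K"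
    by (intro exI[of _ 1]) (simp add: norm_scaleC)
  fix r :: real and a :: complex and x :: 'a
  show "(r *\<^sub>R a) *\<^sub>C x = r *\<^sub>R (a *\<^sub>C x)"
    by (metis scaleC_of_real scaleC_scaleC scaleR_conv_of_real)
  show "a *\<^sub>C (r *\<^sub>R x) = r *\<^sub>R (a *\<^sub>C x)"
    by (metis scaleC_of_real scaleC_scaleC mult.commute)
qed (auto simp: scaleC_add_right scaleC_add_left)

text \<open>Standard complexification of a real norming functional \<open>r\<close>. A unimodular
  \<open>c\<close> with \<open>c * u x\<close> equal to \<open>cmod (u x)\<close> turns the modulus
  into a value of \<open>r\<close>, so the bound carries over; \<open>u y\<close> is real because
  its real part already exhausts the bound.\<close>

lemma norming_functional:
  fixes y :: "'a::complex_normed_vector"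
  obtains u :: "'a \<Rightarrow> complex" where "bounded_clinear u" "\<And>x. cmod (u x) \<le> norm x" "u y = norm y"
proof -
  obtain r where r: "linear r" "\<And>x. r x \<le> norm x" "r y = norm (y :: 'a)"
    using real_norming_functional[of y] by metis
  define u where "u x = Complex (r x) (- r (\<i> *\<^sub>C x))" for x
  have ii: "\<i> *\<^sub>C \<i> *\<^sub>C x = - x" for x :: 'a
    using scaleC_minus_left[of 1 x] by (simp add: scaleC_scaleC scaleC_one)
  have ucomm: "a *\<^sub>C (s *\<^sub>R x) = s *\<^sub>R (a *\<^sub>C x)" for a s and x :: 'a
    by (metis scaleC_of_real scaleC_scaleC mult.commute)
  have decomp: "c *\<^sub>C x = Re c *\<^sub>R x + Im c *\<^sub>R (\<i> *\<^sub>C x)" for c and x :: 'a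
  proof -
    have "c *\<^sub>C x = (complex_of_real (Re c) + complex_of_real (Im c) * \<i>) *\<^sub>C x"
      by (metis complex_eq mult.commute)
    then show ?thesis
      by (simp only: scaleC_add_left scaleC_of_real scaleC_scaleC[symmetric])
  qed
  have uscale: "u (c *\<^sub>C x) = c * u x" for c x
  proof (rule complex_eqI)
    show "Re (u (c *\<^sub>C x)) = Re (c * u x)"
      by (simp add: u_def decomp[of c] linear_add[OF r(1)] linear_cmul[OF r(1)])
    have "\<i> *\<^sub>C (c *\<^sub>C x) = Re c *\<^sub>R (\<i> *\<^sub>C x) + Im c *\<^sub>R (- x)"
      by (simp add: decomp[of c] scaleC_add_right ucomm ii)
    then show "Im (u (c *\<^sub>C x)) = Im (c * u x)"
      by (simp add: u_def linear_add[OF r(1)] linear_diff[OF r(1)] linear_neg[OF r(1)] linear_cmul[OF r(1)])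
  qed
  have uadd: "u (x + z) = u x + u z" for x z
    by (simp add: u_def scaleC_add_right linear_add[OF r(1)] complex_eq_iff)
  have bound: "cmod (u x) \<le> norm x" for x
  proof (cases "u x = 0")
    case False
    define c where "c = cnj (u x) / cmod (u x)"
    have cn: "cmod c = 1" using False by (simp add: c_def norm_divide)
    have "complex_of_real (cmod (u x)) = c * u x"
      using False by (simp add: c_def complex_norm_square[unfolded power2_eq_square] field_simps
          flip: of_real_mult)
    then have "complex_of_real (cmod (u x)) = u (c *\<^sub>C x)"
      by (simp add: uscale)
    then have "cmod (u x) = Re (u (c *\<^sub>C x))" by (metis Re_complex_of_real)
    also have "\<dots> = r (c *\<^sub>C x)" by (simp add: u_def)
    also have "\<dots> \<le> norm x" using r(2)[of "c *\<^sub>C x"] by (simp add: norm_scaleC cn)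
    finally show ?thesis .
  qed simp
  have "bounded_clinear u"
    unfolding bounded_clinear_def
  proof (intro conjI allI)
    show "bounded_linear u"
    proof (rule bounded_linear_intro[of _ 1])
      show "u (s *\<^sub>R x) = s *\<^sub>R u x" for s x
        using uscale[of "of_real s" x] by (simp add: scaleC_of_real scaleR_conv_of_real)
    qed (auto simp: uadd bound)
  qed (simp add: uscale scaleC_complex_def)
  moreover have "u y = norm y"
  proof -
    have "Re (u y) = norm y" by (simp add: u_def r(3))
    moreover have "Im (u y) = 0"
    proof -
      have "(cmod (u y))\<^sup>2 \<le> (norm y)\<^sup>2" using bound[of y] by (rule power_mono) simp
      then show ?thesis using calculation cmod_power2[of "u y"] by simp
    qed
    ultimately show ?thesis by (simp add: complex_eq_iff)
  qed
  ultimately show thesis using bound by (intro that[of u]) auto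
qed

section \<open>Integrals over half-lines and rays\<close>

text \<open>Mean value estimate on a half-plane. The factor \<open>exp c\<close> is kept since for
  negative \<open>c\<close> it preserves the decay of both exponentials in their difference.\<close>

lemma norm_exp_diff_le:
  fixes x y :: complex
  assumes "Re x \<le> c" "Re y \<le> c"
  shows "cmod (exp x - exp y) \<le> exp c * cmod (x - y)"
proof (rule field_differentiable_bound[of "{z. Re z \<le> c}" exp exp])
  show "convex {z. Re z \<le> c}" by (rule convex_halfspace_Re_le)
  show "(exp has_field_derivative exp z) (at z within {z. Re z \<le> c})" for z :: complex
    by (intro DERIV_exp has_field_derivative_at_within)
qed (use assms in auto)

lemma set_borel_measurable_continuous:
  fixes f :: "real \<Rightarrow> 'b::{second_countable_topology, real_normed_vector}"
  assumes "continuous_on S f" "S \<in> sets borel"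
  shows "set_borel_measurable lborel S f"
  using borel_measurable_continuous_on_indicator[OF assms(2,1)]
  unfolding set_borel_measurable_def by simp

lemma set_integral_cong_on:
  assumes "A \<in> sets M" "\<And>x. x \<in> A \<Longrightarrow> f x = g x"
  shows "(LINT x:A|M. f x) = (LINT x:A|M. g x)"
  using assms by (intro set_lebesgue_integral_cong) auto

text \<open>The product of \<open>A\<close> and \<open>B\<close> is an integrable majorant on the
  plane. In the applications \<open>r\<close> is the spectral variable, \<open>t\<close> the time
  variable, and \<open>K\<close> an exponential coupling them.\<close>

lemma fubini_dominated:
  fixes A B :: "real \<Rightarrow> complex" and K :: "real \<Rightarrow> real \<Rightarrow> complex"
  assumes A: "set_integrable lborel S A" and B: "set_integrable lborel U B"
    and K: "(\<lambda>p. K (fst p) (snd p)) \<in> borel_measurable borel"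
    and bound: "\<And>r t. r \<in> S \<Longrightarrow> t \<in> U \<Longrightarrow> cmod (K r t) \<le> 1"
  shows "(LINT r:S|lborel. A r * (LINT t:U|lborel. B t * K r t)) =
         (LINT t:U|lborel. B t * (LINT r:S|lborel. A r * K r t))"
    and "set_integrable lborel S (\<lambda>r. A r * (LINT t:U|lborel. B t * K r t))"
    and "set_integrable lborel U (\<lambda>t. B t * (LINT r:S|lborel. A r * K r t))"
proof -
  define a b where "a r = indicator S r *\<^sub>R A r" and "b t = indicator U t *\<^sub>R B t" for r t :: real
  define k where "k p = a (fst p) * b (snd p) * K (fst p) (snd p)" for p :: "real \<times> real"
  have a: "integrable lborel a" and b: "integrable lborel b"
    using A B by (simp_all add: set_integrable_def a_def[abs_def] b_def[abs_def])
  note [measurable] = borel_measurable_integrable[OF a] borel_measurable_integrable[OF b]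
  have K'[measurable]: "(\<lambda>p. K (fst p) (snd p)) \<in> borel_measurable (lborel \<Otimes>\<^sub>M lborel)"
    using K by (simp add: lborel_prod)
  have km[measurable]: "k \<in> borel_measurable (lborel \<Otimes>\<^sub>M lborel)"
    unfolding k_def[abs_def] by measurable
  have kb: "cmod (k (r, t)) \<le> cmod (a r) * cmod (b t)" for r t
  proof (cases "r \<in> S \<and> t \<in> U")
    case True
    then have "cmod (a r) * cmod (b t) * cmod (K r t) \<le> cmod (a r) * cmod (b t) * 1"
      by (intro mult_left_mono bound) auto
    then show ?thesis by (simp add: k_def norm_mult)
  qed (auto simp: k_def a_def b_def)
  have ab: "integrable (lborel \<Otimes>\<^sub>M lborel) (\<lambda>p. cmod (a (fst p)) * cmod (b (snd p)))"
  proof (rule lborel_pair.Fubini_integrable)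
    show "integrable lborel (\<lambda>x. LINT y|lborel. norm (cmod (a (fst (x, y))) * cmod (b (snd (x, y)))))"
      using a by (simp add: abs_mult)
    show "AE x in lborel. integrable lborel (\<lambda>y. cmod (a (fst (x, y))) * cmod (b (snd (x, y))))"
      using b by simp
  qed measurable
  have int: "integrable (lborel \<Otimes>\<^sub>M lborel) (case_prod (\<lambda>r t. k (r, t)))"
    by (rule Bochner_Integration.integrable_bound[OF ab]) (use kb in \<open>auto simp: case_prod_beta\<close>)
  have i1: "(LINT t|lborel. k (r, t)) = indicator S r *\<^sub>R (A r * (LINT t:U|lborel. B t * K r t))" for r
  proof -
    have "(\<lambda>t. k (r, t)) = (\<lambda>t. a r * (indicator U t *\<^sub>R (B t * K r t)))"
      by (auto simp: k_def b_def)
    then have "(LINT t|lborel. k (r, t)) = a r * (LINT t:U|lborel. B t * K r t)"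
      by (simp only: integral_mult_right_zero set_lebesgue_integral_def)
    then show ?thesis by (simp add: a_def)
  qed
  have i2: "(LINT r|lborel. k (r, t)) = indicator U t *\<^sub>R (B t * (LINT r:S|lborel. A r * K r t))" for t
  proof -
    have "(\<lambda>r. k (r, t)) = (\<lambda>r. b t * (indicator S r *\<^sub>R (A r * K r t)))"
      by (auto simp: k_def a_def)
    then have "(LINT r|lborel. k (r, t)) = b t * (LINT r:S|lborel. A r * K r t)"
      by (simp only: integral_mult_right_zero set_lebesgue_integral_def)
    then show ?thesis by (simp add: b_def)
  qed
  show "(LINT r:S|lborel. A r * (LINT t:U|lborel. B t * K r t)) =
         (LINT t:U|lborel. B t * (LINT r:S|lborel. A r * K r t))"
    using lborel_pair.Fubini_integral[OF int] unfolding i1 i2 set_lebesgue_integral_def by simp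
  show "set_integrable lborel S (\<lambda>r. A r * (LINT t:U|lborel. B t * K r t))"
    using lborel_pair.integrable_fst[OF int] unfolding i1 set_integrable_def .
  show "set_integrable lborel U (\<lambda>t. B t * (LINT r:S|lborel. A r * K r t))"
    using lborel_pair.integrable_snd[OF int] unfolding i2 set_integrable_def .
qed

lemma set_integral_FTC_Icc:
  fixes H :: "real \<Rightarrow> 'b::euclidean_space"
  assumes "a \<le> b" "\<And>r. a \<le> r \<Longrightarrow> r \<le> b \<Longrightarrow> (H has_vector_derivative h r) (at r within {a..b})"
    and "set_integrable lborel {a..b} h"
  shows "(LINT r:{a..b}|lborel. h r) = H b - H a"
  using set_borel_integral_eq_integral(2)[OF assms(3)]
    integral_unique[OF fundamental_theorem_of_calculus[OF assms(1), of H h]] assms(2) by simp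

lemma set_integral_FTC_half_line:
  fixes H :: "real \<Rightarrow> complex"
  assumes H: "\<And>r. r \<ge> 0 \<Longrightarrow> (H has_vector_derivative h r) (at r)"
    and h: "set_integrable lborel {0..} h" and lim: "(H \<longlongrightarrow> l) at_top"
  shows "(LINT r:{0..}|lborel. h r) = l - H 0"
proof -
  have "((\<lambda>b. LINT r:{0..b}|lborel. h r) \<longlongrightarrow> (LINT r:{0..}|lborel. h r)) at_top"
    using h by (intro tendsto_set_lebesgue_integral_at_top) auto
  moreover have "\<forall>\<^sub>F b in at_top. (LINT r:{0..b}|lborel. h r) = H b - H 0"
    using eventually_ge_at_top[of "0::real"]
  proof eventually_elim
    case (elim b)
    then show ?case
      by (intro set_integral_FTC_Icc set_integrable_subset[OF h] has_vector_derivative_at_within[OF H]) auto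
  qed
  ultimately have "((\<lambda>b. H b - H 0) \<longlongrightarrow> (LINT r:{0..}|lborel. h r)) at_top"
    by (rule Lim_transform_eventually)
  moreover have "((\<lambda>b. H b - H 0) \<longlongrightarrow> l - H 0) at_top" by (intro tendsto_intros lim)
  ultimately show ?thesis by (rule tendsto_unique[OF trivial_limit_at_top_linorder])
qed

text \<open>Integrability is part of the conclusion: for a nonnegative derivative it follows from
  the existence of the limit of the primitive. The majorant of the derivative of \<open>g\<close> is
  handled this way.\<close>

lemma nonneg_FTC_half_line:
  fixes N m :: "real \<Rightarrow> real"
  assumes N: "\<And>r. r \<ge> 0 \<Longrightarrow> (N has_real_derivative m r) (at r)"
    and nn: "\<And>r. r \<ge> 0 \<Longrightarrow> 0 \<le> m r" and cont: "continuous_on {0..} m"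
    and lim: "(N \<longlongrightarrow> l) at_top"
  shows "set_integrable lborel {0..} m" and "(LINT r:{0..}|lborel. m r) = l - N 0"
proof -
  define m' where "m' = (\<lambda>r. indicat_real {0..} r *\<^sub>R m r)"
  have m'_nonneg: "m' r \<ge> 0" for r
    using nn[of r] by (auto simp: m'_def split: split_indicator)
  have m'[measurable]: "m' \<in> borel_measurable borel"
    unfolding m'_def by (rule borel_measurable_continuous_on_indicator) (use cont in auto)
  have *: "(\<integral>\<^sup>+x. ennreal (m' x) * indicator {0..} x \<partial>lborel) = ennreal (l - N 0)"
  proof (rule nn_integral_FTC_atLeast[OF m' _ _ lim])
    show "DERIV N x :> m' x" if "0 \<le> x" for x
      using N[OF that] that by (simp add: m'_def)
  qed (rule m'_nonneg)
  have nn': "(\<integral>\<^sup>+x. ennreal (m' x) \<partial>lborel) = ennreal (l - N 0)"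
    unfolding *[symmetric] by (intro nn_integral_cong) (auto simp: m'_def split: split_indicator)
  have mono: "N 0 \<le> N r" if "0 \<le> r" for r
    by (rule DERIV_nonneg_imp_nondecreasing[OF that]) (use N nn in blast)
  have ge: "l - N 0 \<ge> 0"
  proof (rule tendsto_lowerbound[OF tendsto_diff[OF lim tendsto_const]])
    show "\<forall>\<^sub>F r in at_top. 0 \<le> N r - N 0"
      using eventually_ge_at_top[of 0] by eventually_elim (use mono in auto)
  qed simp
  have "has_bochner_integral lborel m' (l - N 0)"
    by (rule has_bochner_integral_nn_integral) (use nn' ge m'_nonneg in auto)
  then show "set_integrable lborel {0..} m" "(LINT r:{0..}|lborel. m r) = l - N 0"
    unfolding set_integrable_def set_lebesgue_integral_def m'_def[symmetric] has_bochner_integral_iff by auto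
qed

lemma exp_decay_half_line:
  fixes c :: real
  assumes "c > 0"
  shows "set_integrable lborel {0..} (\<lambda>r. exp (- c * r))" "(LINT r:{0..}|lborel. exp (- c * r)) = 1 / c"
proof -
  have D: "((\<lambda>r. - exp (- c * r) / c) has_real_derivative exp (- c * r)) (at r)" for r
    using assms by (auto intro!: derivative_eq_intros)
  have lim: "((\<lambda>r. - exp (- c * r) / c) \<longlongrightarrow> 0) at_top"
    using assms by real_asymp
  have cont: "continuous_on {0..} (\<lambda>r. exp (- c * r))" by (intro continuous_intros)
  show "set_integrable lborel {0..} (\<lambda>r. exp (- c * r))" "(LINT r:{0..}|lborel. exp (- c * r)) = 1 / c"
    using nonneg_FTC_half_line[OF D exp_ge_zero cont lim] by simp_all
qed

lemma set_integrable_exp_decay: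
  fixes h :: "real \<Rightarrow> complex"
  assumes "continuous_on {0..} h" and b: "\<And>r. r \<ge> 0 \<Longrightarrow> cmod (h r) \<le> C * exp (- c * r)" and "c > 0"
  shows "set_integrable lborel {0..} h"
proof (rule set_integrable_bound)
  show "set_integrable lborel {0..} (\<lambda>r. C * exp (- c * r))"
    using exp_decay_half_line(1)[OF \<open>c > 0\<close>] by simp
  show "set_borel_measurable lborel {0..} h"
    by (rule set_borel_measurable_continuous) (use assms in auto)
  show "AE x in lborel. x \<in> {0..} \<longrightarrow> norm (h x) \<le> norm (C * exp (- c * x))"
    using b order_trans[OF b abs_ge_self] by (intro AE_I2) auto
qed

lemma norm_mult_exp_le:
  assumes "Re (w * d) \<le> 0" "r \<ge> 0"
  shows "cmod (q * exp (w * (of_real r * d))) \<le> cmod q"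
proof -
  have "Re (w * (of_real r * d)) = r * Re (w * d)" by (simp add: algebra_simps)
  also have "\<dots> \<le> 0" using assms by (simp add: mult_nonneg_nonpos)
  finally have "cmod (exp (w * (of_real r * d))) \<le> 1" by simp
  then show ?thesis by (metis mult_left_le norm_ge_zero norm_mult)
qed

lemma set_integrable_mult_exp:
  assumes h: "set_integrable lborel {0..} h" and cont: "continuous_on {0..} h" and w: "Re (w * d) \<le> 0"
  shows "set_integrable lborel {0..} (\<lambda>r. h r * exp (w * (of_real r * d)))"
proof (rule set_integrable_bound[OF h])
  show "set_borel_measurable lborel {0..} (\<lambda>r. h r * exp (w * (of_real r * d)))"
    by (intro set_borel_measurable_continuous continuous_intros cont) simp
  show "AE r in lborel. r \<in> {0..} \<longrightarrow> norm (h r * exp (w * (of_real r * d))) \<le> norm (h r)"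
    using norm_mult_exp_le[OF w] by (intro AE_I2) simp
qed

section \<open>Contour integrals along rays and chords\<close>

lemma contour_integral_linepath_eq:
  assumes cont: "continuous_on (closed_segment p (p + of_real L * a)) \<phi>" and L: "L > 0"
  shows "contour_integral (linepath p (p + of_real L * a)) \<phi> = (LINT t:{0..L}|lborel. \<phi> (p + of_real t * a) * a)"
proof -
  define h where "h t = \<phi> (p + of_real t * a) * a" for t
  have seg: "p + of_real t * a \<in> closed_segment p (p + of_real L * a)" if "t \<in> {0..L}" for t
    unfolding closed_segment_def using that L
    by (auto intro!: exI[of _ "t / L"] simp: scaleR_conv_of_real field_simps)
  have hc: "continuous_on {0..L} h"
    unfolding h_def[abs_def]
    by (intro continuous_intros continuous_on_compose2[OF cont]) (use seg in auto)
  have si: "set_integrable lborel {0..L} h"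
    by (rule borel_integrable_atLeastAtMost'[OF hc])
  have "(h has_integral (LINT t:{0..L}|lborel. h t)) (cbox 0 L)"
    using set_borel_integral_eq_integral[OF si] by (simp add: has_integral_iff)
  from has_integral_affinity'[OF this L, of 0]
  have "((\<lambda>x. h (L * x)) has_integral (LINT t:{0..L}|lborel. h t) /\<^sub>R L) {0..1}"
    using L by simp
  from has_integral_mult_right[OF this, of "of_real L"]
  have "((\<lambda>x. of_real L * h (L * x)) has_integral (LINT t:{0..L}|lborel. h t)) {0..1}"
    using L by (simp add: scaleR_conv_of_real mult.assoc[symmetric])
  moreover have "of_real L * h (L * x) = \<phi> (linepath p (p + of_real L * a) x) * (p + of_real L * a - p)" for x
    by (simp add: h_def linepath_def scaleR_conv_of_real algebra_simps)
  ultimately have "(\<phi> has_contour_integral (LINT t:{0..L}|lborel. h t)) (linepath p (p + of_real L * a))"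
    by (simp add: has_contour_integral_linepath)
  then show ?thesis by (simp add: contour_integral_unique h_def)
qed

lemma contour_integral_ray_tendsto:
  assumes cont: "\<And>t. t \<ge> 0 \<Longrightarrow> continuous_on (closed_segment p (p + of_real t * a)) \<phi>"
    and int: "set_integrable lborel {0..} (\<lambda>t. \<phi> (p + of_real t * a) * a)"
  shows "((\<lambda>L. contour_integral (linepath p (p + of_real L * a)) \<phi>) \<longlongrightarrow>
     (LINT t:{0..}|lborel. \<phi> (p + of_real t * a) * a)) at_top"
proof -
  have "((\<lambda>b. LINT t:{0..b}|lborel. \<phi> (p + of_real t * a) * a) \<longlongrightarrow> (LINT t:{0..}|lborel. \<phi> (p + of_real t * a) * a)) at_top"
    using int by (intro tendsto_set_lebesgue_integral_at_top) auto
  moreover have "\<forall>\<^sub>F L in at_top. contour_integral (linepath p (p + of_real L * a)) \<phi> = (LINT t:{0..L}|lborel. \<phi> (p + of_real t * a) * a)"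
    using eventually_gt_at_top[of "0::real"]
    by eventually_elim (intro contour_integral_linepath_eq cont, auto)
  ultimately show ?thesis
    by (rule Lim_transform_eventually[OF _ eventually_mono]) simp
qed

lemma contour_integral_triangle_sum:
  assumes "\<phi> holomorphic_on S" "convex S" "p \<in> S" "q \<in> S" "r \<in> S"
  shows "contour_integral (linepath p q) \<phi> + contour_integral (linepath q r) \<phi> +
    contour_integral (linepath r p) \<phi> = 0"
proof -
  have cont: "continuous_on (closed_segment x y) \<phi>" if "x \<in> S" "y \<in> S" for x y
    using holomorphic_on_imp_continuous_on[OF assms(1)] closed_segment_subset[OF that assms(2)]
    by (rule continuous_on_subset)
  have "(\<phi> has_contour_integral 0) (linepath p q +++ linepath q r +++ linepath r p)"
    by (intro Cauchy_theorem_convex_simple[OF assms(1,2)] subset_path_image_join)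
      (simp_all add: assms closed_segment_subset)
  then have "contour_integral (linepath p q +++ linepath q r +++ linepath r p) \<phi> = 0"
    by (rule contour_integral_unique)
  moreover have "contour_integral (linepath p q +++ linepath q r +++ linepath r p) \<phi> =
     contour_integral (linepath p q) \<phi> + (contour_integral (linepath q r) \<phi> + contour_integral (linepath r p) \<phi>)"
    using contour_integrable_continuous_linepath[OF cont] assms(3-5)
    by (simp add: contour_integral_join contour_integrable_join)
  ultimately show ?thesis by (simp add: add.assoc)
qed

lemma Re_closed_segment_eq:
  assumes "z \<in> closed_segment p q" "Re p = c" "Re q = c"
  shows "Re z = c"
proof -
  obtain u where "z = (1 - u) *\<^sub>R p + u *\<^sub>R q" using assms(1) by (auto simp: closed_segment_def)
  then have "Re z = (1 - u) * Re p + u * Re q" by simp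
  then show ?thesis by (simp add: assms algebra_simps)
qed

text \<open>Both end points have real part \<open>L * \<rho>\<close>, hence so has the whole chord;
  the integrand is of order \<open>exp (- \<kappa> * \<rho> * L)\<close> while the length grows only
  linearly in \<open>L\<close>.\<close>

lemma chord_integral_tendsto_0:
  assumes Re: "Re e = \<rho>" "Re e' = \<rho>" "\<rho> > 0" and \<kappa>: "\<kappa> > 0"
    and cont: "\<And>L. L \<ge> L0 \<Longrightarrow> continuous_on (closed_segment (of_real L * e) (of_real L * e')) \<phi>"
    and bound: "\<And>L z. L \<ge> L0 \<Longrightarrow> z \<in> closed_segment (of_real L * e) (of_real L * e') \<Longrightarrow>
      cmod (\<phi> z) \<le> C * exp (- \<kappa> * Re z)"
  shows "((\<lambda>L. contour_integral (linepath (of_real L * e) (of_real L * e')) \<phi>) \<longlongrightarrow> 0) at_top"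
proof (rule Lim_null_comparison)
  define D where "D = cmod (e' - e)"
  show "((\<lambda>L. (\<bar>C\<bar> * exp (- (\<kappa> * \<rho>) * L)) * (L * D)) \<longlongrightarrow> 0) at_top"
  proof -
    have "((\<lambda>L. exp (- c * L) * L) \<longlongrightarrow> 0) at_top" if "c > 0" for c :: real
      using that by real_asymp
    then have "((\<lambda>L. exp (- (\<kappa> * \<rho>) * L) * L) \<longlongrightarrow> 0) at_top" using Re \<kappa> by simp
    from tendsto_mult_right[OF this, of "\<bar>C\<bar> * D"] show ?thesis by (simp add: ac_simps)
  qed
  show "\<forall>\<^sub>F L in at_top. norm (contour_integral (linepath (of_real L * e) (of_real L * e')) \<phi>)
     \<le> (\<bar>C\<bar> * exp (- (\<kappa> * \<rho>) * L)) * (L * D)"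
    using eventually_ge_at_top[of "max L0 0"]
  proof eventually_elim
    case (elim L)
    have "norm (contour_integral (linepath (of_real L * e) (of_real L * e')) \<phi>)
       \<le> (\<bar>C\<bar> * exp (- (\<kappa> * \<rho>) * L)) * cmod (of_real L * e' - of_real L * e)"
    proof (rule contour_integral_bound_linepath)
      show "\<phi> contour_integrable_on linepath (of_real L * e) (of_real L * e')"
        by (rule contour_integrable_continuous_linepath[OF cont]) (use elim in auto)
      fix x assume x: "x \<in> closed_segment (of_real L * e) (of_real L * e')"
      have "Re x = L * \<rho>" by (rule Re_closed_segment_eq[OF x]) (simp_all add: Re)
      with bound[OF _ x] elim have "cmod (\<phi> x) \<le> C * exp (- (\<kappa> * \<rho>) * L)"
        by (simp add: ac_simps)
      also have "\<dots> \<le> \<bar>C\<bar> * exp (- (\<kappa> * \<rho>) * L)" by (intro mult_right_mono) auto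
      finally show "cmod (\<phi> x) \<le> \<bar>C\<bar> * exp (- (\<kappa> * \<rho>) * L)" .
    qed auto
    also have "cmod (of_real L * e' - of_real L * e) = L * D"
      using elim unfolding D_def by (simp add: norm_mult flip: right_diff_distrib)
    finally show ?case .
  qed
qed

lemma ray_integral_integrable:
  assumes "continuous_on S \<phi>" "\<And>t. t \<ge> 0 \<Longrightarrow> p + of_real t * e \<in> S"
    and bound: "\<And>z. z \<in> S \<Longrightarrow> cmod (\<phi> z) \<le> C * exp (- \<kappa> * Re z)" and "\<kappa> > 0" "Re e > 0"
  shows "set_integrable lborel {0..} (\<lambda>t. \<phi> (p + of_real t * e) * e)"
proof (rule set_integrable_exp_decay)
  show "continuous_on {0..} (\<lambda>t. \<phi> (p + of_real t * e) * e)"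
    by (intro continuous_intros continuous_on_compose2[OF assms(1)]) (use assms(2) in auto)
  show "\<kappa> * Re e > 0" using assms by simp
  fix t :: real assume "t \<ge> 0"
  have "cmod (\<phi> (p + of_real t * e)) \<le> C * exp (- \<kappa> * Re (p + of_real t * e))"
    by (intro bound assms(2)) fact
  also have "\<dots> = C * exp (- \<kappa> * Re p) * exp (- (\<kappa> * Re e) * t)"
    by (simp add: exp_add[symmetric] algebra_simps)
  finally have "cmod (\<phi> (p + of_real t * e)) * cmod e \<le> C * exp (- \<kappa> * Re p) * exp (- (\<kappa> * Re e) * t) * cmod e"
    by (rule mult_right_mono) simp
  then show "cmod (\<phi> (p + of_real t * e) * e) \<le> (C * exp (- \<kappa> * Re p) * cmod e) * exp (- (\<kappa> * Re e) * t)"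
    by (simp add: norm_mult ac_simps)
qed

text \<open>Common core of Cauchy's theorem (\<open>V = 0\<close>) and Cauchy's formula
  (\<open>V\<close> the residue term) for the infinite triangle between two rays.
  \<open>Lmin\<close> lets the closing chord start beyond a pole.\<close>

lemma triangle_limit:
  assumes Re: "Re e = \<rho>" "Re e' = \<rho>" "\<rho> > 0" and \<kappa>: "\<kappa> > 0"
    and cont: "continuous_on S \<phi>" and S: "\<And>t. t \<ge> 0 \<Longrightarrow> of_real t * e \<in> S" "\<And>t. t \<ge> 0 \<Longrightarrow> of_real t * e' \<in> S"
      "\<And>L. L \<ge> Lmin \<Longrightarrow> closed_segment (of_real L * e') (of_real L * e) \<subseteq> S"
    and bound: "\<And>z. z \<in> S \<Longrightarrow> cmod (\<phi> z) \<le> C * exp (- \<kappa> * Re z)"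
    and V: "\<And>L. L \<ge> Lmin \<Longrightarrow> contour_integral (linepath 0 (of_real L * e')) \<phi> +
      contour_integral (linepath (of_real L * e') (of_real L * e)) \<phi> + contour_integral (linepath (of_real L * e) 0) \<phi> = V"
  shows "(LINT t:{0..}|lborel. \<phi> (of_real t * e') * e') - (LINT t:{0..}|lborel. \<phi> (of_real t * e) * e) = V"
proof -
  have seg: "closed_segment 0 (of_real t * x) \<subseteq> S" if x: "\<And>t. t \<ge> 0 \<Longrightarrow> of_real t * x \<in> S" and t: "t \<ge> 0" for t x
  proof
    fix z assume "z \<in> closed_segment 0 (of_real t * x)"
    then obtain u where "u \<ge> 0" "z = of_real (u * t) * x"
      by (auto simp: closed_segment_def scaleR_conv_of_real)
    with x[of "u * t"] t show "z \<in> S" by simp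
  qed
  have lim: "((\<lambda>L. contour_integral (linepath 0 (of_real L * x)) \<phi>) \<longlongrightarrow> (LINT t:{0..}|lborel. \<phi> (of_real t * x) * x)) at_top"
    if x: "\<And>t. t \<ge> 0 \<Longrightarrow> of_real t * x \<in> S" and "Re x = \<rho>" for x
    using contour_integral_ray_tendsto[of 0 x \<phi>] ray_integral_integrable[OF cont _ bound \<kappa>, of 0 x] that Re
      continuous_on_subset[OF cont seg[OF x]]
    by simp
  have chord: "((\<lambda>L. contour_integral (linepath (of_real L * e') (of_real L * e)) \<phi>) \<longlongrightarrow> 0) at_top"
  proof (rule chord_integral_tendsto_0[OF Re(2,1,3) \<kappa>])
    show "continuous_on (closed_segment (of_real L * e') (of_real L * e)) \<phi>" if "L \<ge> Lmin" for L
      by (rule continuous_on_subset[OF cont S(3)[OF that]])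
    show "cmod (\<phi> z) \<le> C * exp (- \<kappa> * Re z)"
      if "L \<ge> Lmin" "z \<in> closed_segment (of_real L * e') (of_real L * e)" for L z
      using S(3)[OF that(1)] that(2) by (intro bound) auto
  qed
  have "((\<lambda>L. contour_integral (linepath 0 (of_real L * e')) \<phi> +
      contour_integral (linepath (of_real L * e') (of_real L * e)) \<phi> - contour_integral (linepath 0 (of_real L * e)) \<phi>)
     \<longlongrightarrow> (LINT t:{0..}|lborel. \<phi> (of_real t * e') * e') + 0 - (LINT t:{0..}|lborel. \<phi> (of_real t * e) * e)) at_top"
    by (intro tendsto_intros lim S Re chord)
  moreover have "\<forall>\<^sub>F L in at_top. contour_integral (linepath 0 (of_real L * e')) \<phi> +
      contour_integral (linepath (of_real L * e') (of_real L * e)) \<phi> - contour_integral (linepath 0 (of_real L * e)) \<phi> = V"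
    using eventually_ge_at_top[of "max Lmin 0"]
  proof eventually_elim
    case (elim L)
    have "contour_integral (linepath (of_real L * e) 0) \<phi> = - contour_integral (linepath 0 (of_real L * e)) \<phi>"
      by (rule contour_integral_reverse_linepath)
        (use seg[OF S(1)] elim in \<open>auto intro: continuous_on_subset[OF cont] simp: closed_segment_commute\<close>)
    with V[of L] elim show ?case by simp
  qed
  ultimately have "((\<lambda>L::real. V) \<longlongrightarrow> (LINT t:{0..}|lborel. \<phi> (of_real t * e') * e') + 0 - (LINT t:{0..}|lborel. \<phi> (of_real t * e) * e)) at_top"
    by (rule Lim_transform_eventually)
  from tendsto_unique[OF trivial_limit_at_top_linorder this tendsto_const] show ?thesis by simp
qed

lemma ray_integrals_eq:
  assumes Re: "Re e = \<rho>" "Re e' = \<rho>" "\<rho> > 0" and \<kappa>: "\<kappa> > 0"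
    and hol: "\<phi> holomorphic_on S" and S: "convex S" "\<And>t. t \<ge> 0 \<Longrightarrow> of_real t * e \<in> S" "\<And>t. t \<ge> 0 \<Longrightarrow> of_real t * e' \<in> S"
    and bound: "\<And>z. z \<in> S \<Longrightarrow> cmod (\<phi> z) \<le> C * exp (- \<kappa> * Re z)"
  shows "(LINT t:{0..}|lborel. \<phi> (of_real t * e) * e) = (LINT t:{0..}|lborel. \<phi> (of_real t * e') * e')"
proof -
  have "(LINT t:{0..}|lborel. \<phi> (of_real t * e') * e') - (LINT t:{0..}|lborel. \<phi> (of_real t * e) * e) = 0"
  proof (rule triangle_limit[OF Re \<kappa> holomorphic_on_imp_continuous_on[OF hol] S(2,3) _ bound])
    fix L :: real assume L: "L \<ge> 0"
    show "closed_segment (of_real L * e') (of_real L * e) \<subseteq> S"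
      using S L by (intro closed_segment_subset) auto
    show "contour_integral (linepath 0 (of_real L * e')) \<phi> +
      contour_integral (linepath (of_real L * e') (of_real L * e)) \<phi> + contour_integral (linepath (of_real L * e) 0) \<phi> = 0"
      using S(2)[of 0] S L by (intro contour_integral_triangle_sum[OF hol]) auto
  qed
  then show ?thesis by simp
qed

lemma Re_less_imp_interior_triangle:
  assumes "Re a > 0" "Im a > 0" "0 < \<delta>" "\<delta> < L * Re a"
  shows "of_real \<delta> \<in> interior (convex hull {0, of_real L * cnj a, of_real L * a})"
proof -
  define x y where "x = Re a" and "y = Im a"
  \<comment> \<open>Barycentric weights: by symmetry both outer vertices get \<open>u\<close>, and
    comparing real parts gives \<open>2 * u * L * Re a = \<delta>\<close>; the origin gets the
    rest.\<close>
  define u v where "u = \<delta> / (L * x) / 2" and "v = 1 - 2 * u"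
  have xy: "x > 0" "y > 0" "\<delta> < L * x" using assms by (auto simp: x_def y_def)
  then have Lx: "L * x > 0" using assms by linarith
  have u: "0 < u" "0 < v" using assms xy Lx by (auto simp: u_def v_def field_simps)
  have "\<not> collinear {0, of_real L * cnj a, of_real L * a}"
  proof
    assume "collinear {0, of_real L * cnj a, of_real L * a}"
    then have "of_real L * cnj a = 0 \<or> of_real L * a = 0 \<or> (\<exists>c. of_real L * a = c *\<^sub>R (of_real L * cnj a))"
      unfolding collinear_lemma by auto
    then show False
    proof (elim disjE exE)
      fix c assume c: "of_real L * a = c *\<^sub>R (of_real L * cnj a)"
      then have "L * x = c * (L * x)" "L * y = - c * (L * y)"
        by (auto simp: complex_eq_iff x_def y_def)
      moreover have "L \<noteq> 0" using Lx by auto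
      ultimately show False using xy by auto
    qed (use xy Lx in \<open>auto simp: x_def y_def complex_eq_iff\<close>)
  qed
  then have "interior (convex hull {0, of_real L * cnj a, of_real L * a}) =
     {v *\<^sub>R 0 + s *\<^sub>R (of_real L * cnj a) + t *\<^sub>R (of_real L * a) | v s t. 0 < v \<and> 0 < s \<and> 0 < t \<and> v + s + t = 1}"
    by (subst interior_convex_hull_3_minimal) (auto intro!: Collect_cong)
  moreover have "of_real \<delta> = v *\<^sub>R 0 + u *\<^sub>R (of_real L * cnj a) + u *\<^sub>R (of_real L * a)"
    using Lx by (auto simp: complex_eq_iff u_def x_def[symmetric] field_simps)
  moreover have "0 < v \<and> 0 < u \<and> 0 < u \<and> v + u + u = 1" using u by (simp add: v_def)
  ultimately show ?thesis by blast
qed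

lemma ray_integrals_Cauchy_formula:
  assumes a: "Re a > 0" "Im a > 0" and \<kappa>: "\<kappa> > 0" and \<delta>: "\<delta> > 0"
    and hol: "\<phi> holomorphic_on S" and S: "convex S" "\<And>z. \<bar>Im z\<bar> * Re a \<le> Im a * Re z \<Longrightarrow> z \<in> S"
    and bound: "\<And>z. z \<in> S \<Longrightarrow> cmod (\<phi> z) \<le> C * exp (- \<kappa> * Re z)"
  shows "(LINT t:{0..}|lborel. \<phi> (of_real t * cnj a) / (of_real t * cnj a - of_real \<delta>) * cnj a)
       - (LINT t:{0..}|lborel. \<phi> (of_real t * a) / (of_real t * a - of_real \<delta>) * a) = 2 * pi * \<i> * \<phi> (of_real \<delta>)"
proof -
  \<comment> \<open>The first entry serves the chords, which keep distance \<open>\<delta>\<close>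
    from the pole once their real part is at least \<open>2 * \<delta>\<close>; the second is the
    distance of the pole from the rays. On \<open>S'\<close> the Cauchy kernel therefore costs only
    the factor \<open>1 / d\<close>.\<close>
  define d where "d = min \<delta> (\<delta> * Im a / cmod a)"
  have na: "cmod a > 0" using a by auto
  have d: "d > 0" using \<delta> a na by (auto simp: d_def)
  define S' where "S' = {z \<in> S. d \<le> cmod (z - of_real \<delta>)}"
  define L0 where "L0 = 2 * \<delta> / Re a"
  have L0: "L0 > 0" using a \<delta> by (simp add: L0_def)
  have ray: "d \<le> cmod (of_real t * b - of_real \<delta>)" if t: "t \<ge> 0" and b: "b = a \<or> b = cnj a" for t b
  proof -
    have "\<delta> * Im a / cmod a \<le> cmod (of_real t * b - of_real \<delta>)"
    proof -
      \<comment> \<open>Multiplying by \<open>cnj b\<close> rotates the ray onto the real axis, so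
        the imaginary part is the distance to the ray times \<open>cmod a\<close>, independently of
        \<open>t\<close>.\<close>
      have "\<bar>Im ((of_real t * b - of_real \<delta>) * cnj b)\<bar> \<le> cmod ((of_real t * b - of_real \<delta>) * cnj b)"
        by (rule abs_Im_le_cmod)
      also have "\<dots> = cmod (of_real t * b - of_real \<delta>) * cmod a" using b by (auto simp: norm_mult)
      also have "Im ((of_real t * b - of_real \<delta>) * cnj b) = \<delta> * Im b"
        by (simp add: algebra_simps)
      also have "\<bar>\<delta> * Im b\<bar> = \<delta> * Im a" using b a \<delta> by (auto simp: abs_mult)
      finally show ?thesis using na by (simp add: field_simps)
    qed
    then show ?thesis by (simp add: d_def)
  qed
  have Sa: "of_real t * a \<in> S" "of_real t * cnj a \<in> S" if "t \<ge> 0" for t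
    using that a by (auto intro!: S(2) simp: abs_mult)
  have ray': "of_real t * a \<in> S'" "of_real t * cnj a \<in> S'" if "t \<ge> 0" for t
    using ray[OF that, of a] ray[OF that, of "cnj a"] Sa[OF that] by (auto simp: S'_def)
  have chord: "closed_segment (of_real L * cnj a) (of_real L * a) \<subseteq> S'" if "L \<ge> L0" for L
  proof
    fix z assume z: "z \<in> closed_segment (of_real L * cnj a) (of_real L * a)"
    have zS: "z \<in> S"
      using closed_segment_subset[OF Sa(2)[of L] Sa(1)[of L] S(1)] z that L0 by auto
    have "Re z = L * Re a" by (rule Re_closed_segment_eq[OF z]) auto
    moreover have "2 * \<delta> \<le> L * Re a" using that a by (simp add: L0_def field_simps)
    ultimately have "\<delta> \<le> Re (z - of_real \<delta>)" by simp
    also have "\<dots> \<le> cmod (z - of_real \<delta>)" by (rule complex_Re_le_cmod)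
    finally show "z \<in> S'" using zS by (auto simp: S'_def d_def)
  qed
  have S'\<delta>: "z \<noteq> of_real \<delta>" if "z \<in> S'" for z using that d by (auto simp: S'_def)
  show ?thesis
  proof (rule triangle_limit[where S = S' and \<phi> = "\<lambda>z. \<phi> z / (z - of_real \<delta>)" and e' = "cnj a" and e = a
        and \<rho> = "Re a" and Lmin = L0 and \<kappa> = \<kappa> and C = "C / d"])
    show "continuous_on S' (\<lambda>z. \<phi> z / (z - of_real \<delta>))"
      using S'\<delta> by (intro continuous_intros continuous_on_subset[OF holomorphic_on_imp_continuous_on[OF hol]])
        (auto simp: S'_def)
    show "cmod (\<phi> z / (z - of_real \<delta>)) \<le> C / d * exp (- \<kappa> * Re z)" if "z \<in> S'" for z
    proof -
      have "cmod (\<phi> z) / cmod (z - of_real \<delta>) \<le> (C * exp (- \<kappa> * Re z)) / d"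
        using that d bound[of z] by (intro frac_le) (auto simp: S'_def intro: order_trans[OF norm_ge_zero])
      then show ?thesis by (simp add: norm_divide)
    qed
    fix L :: real assume L: "L \<ge> L0"
    have "L * Re a \<ge> 2 * \<delta>" using L a by (simp add: L0_def field_simps)
    with \<delta> have int: "of_real \<delta> \<in> interior (convex hull {0, of_real L * cnj a, of_real L * a})"
      by (intro Re_less_imp_interior_triangle a) auto
    have hull: "convex hull {0, of_real L * cnj a, of_real L * a} \<subseteq> S"
      using Sa[of L] Sa(1)[of 0] L L0 S(1) by (intro hull_minimal) auto
    let ?p = "linepath 0 (of_real L * cnj a) +++ linepath (of_real L * cnj a) (of_real L * a) +++ linepath (of_real L * a) 0"
    have segS: "closed_segment 0 (of_real L * x) \<subseteq> S'" if x: "\<And>t. t \<ge> 0 \<Longrightarrow> of_real t * x \<in> S'" for x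
    proof
      fix z assume "z \<in> closed_segment 0 (of_real L * x)"
      then obtain u where "u \<ge> 0" "z = of_real (u * L) * x"
        by (auto simp: closed_segment_def scaleR_conv_of_real)
      with x[of "u * L"] L L0 show "z \<in> S'" by simp
    qed
    have segs: "closed_segment 0 (of_real L * cnj a) \<subseteq> S'" "closed_segment (of_real L * a) 0 \<subseteq> S'"
      using segS[of "cnj a"] segS[of a] ray' by (auto simp: closed_segment_commute)
    have "((\<lambda>w. \<phi> w / (w - of_real \<delta>)) has_contour_integral (2 * pi * \<i> * winding_number ?p (of_real \<delta>) * \<phi> (of_real \<delta>))) ?p"
    proof (rule Cauchy_integral_formula_convex_simple[OF S(1) hol])
      show "of_real \<delta> \<in> interior S" using int interior_mono[OF hull] by auto
      show "path_image ?p \<subseteq> S - {of_real \<delta>}"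
        using segs chord[OF L] S'\<delta> by (auto simp: path_image_join S'_def subset_iff)
    qed auto
    moreover have "winding_number ?p (of_real \<delta>) = 1"
    proof -
      have "L > 0" using L L0 by simp
      \<comment> \<open>The sign test for the orientation: the boundary runs counterclockwise, so
        the winding number is 1 and not - 1.\<close>
      then have "0 < Im ((of_real L * cnj a - 0) * cnj (of_real L * cnj a - of_real \<delta>))"
        using a \<delta> by (simp add: algebra_simps)
      then show ?thesis using winding_number_triangle[OF int] by (simp only: if_True)
    qed
    ultimately have I: "((\<lambda>w. \<phi> w / (w - of_real \<delta>)) has_contour_integral (2 * pi * \<i> * \<phi> (of_real \<delta>))) ?p"
      by simp
    have ci: "(\<lambda>w. \<phi> w / (w - of_real \<delta>)) contour_integrable_on linepath x y" if "closed_segment x y \<subseteq> S'" for x y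
      by (intro contour_integrable_continuous_linepath continuous_intros
            continuous_on_subset[OF holomorphic_on_imp_continuous_on[OF hol]])
        (use that S'\<delta> in \<open>auto simp: S'_def\<close>)
    note cis = ci[OF segs(1)] ci[OF chord[OF L]] ci[OF segs(2)]
    show "contour_integral (linepath 0 (of_real L * cnj a)) (\<lambda>w. \<phi> w / (w - of_real \<delta>)) +
      contour_integral (linepath (of_real L * cnj a) (of_real L * a)) (\<lambda>w. \<phi> w / (w - of_real \<delta>)) +
      contour_integral (linepath (of_real L * a) 0) (\<lambda>w. \<phi> w / (w - of_real \<delta>)) = 2 * pi * \<i> * \<phi> (of_real \<delta>)"
      using contour_integral_unique[OF I] cis
      by (simp add: contour_integral_join contour_integrable_join add.assoc)
  qed (use a \<kappa> ray' chord in auto)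
qed

text \<open>Put \<open>w = s + t * a\<close>: the left integrand is \<open>exp (- s * z)\<close>
  times \<open>\<phi> w * exp (w * z)\<close>, so the ray from \<open>s\<close> can be moved to the
  parallel ray from 0. The half-strip between the rays contributes the integral over the segment
  from 0 to \<open>s\<close>, and its far side vanishes.\<close>

lemma ray_integral_shift:
  assumes a: "Re a > 0" and \<kappa>: "\<kappa> > 0" and s: "s \<ge> 0" and z: "Re z \<ge> 0" "Re (a * z) \<le> 0"
    and hol: "\<phi> holomorphic_on S" and S: "convex S" "\<And>u t. u \<ge> 0 \<Longrightarrow> t \<ge> 0 \<Longrightarrow> of_real u + of_real t * a \<in> S"
    and bound: "\<And>w. w \<in> S \<Longrightarrow> cmod (\<phi> w) \<le> C * exp (- \<kappa> * Re w)"
  shows "(LINT t:{0..}|lborel. \<phi> (of_real s + of_real t * a) * a * exp (of_real t * a * z)) =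
     exp (- of_real s * z) * ((LINT t:{0..}|lborel. \<phi> (of_real t * a) * a * exp (of_real t * a * z))
       - (LINT u:{0..s}|lborel. \<phi> (of_real u) * exp (of_real u * z)))"
proof (cases "s = 0")
  case True
  have "{0..0::real} = {0}" by auto
  moreover have "(LINT u:{0::real}|lborel. \<phi> (of_real u) * exp (of_real u * z)) = 0"
  proof -
    have "AE u in lborel. u \<noteq> (0::real)" by (rule AE_lborel_singleton)
    then show ?thesis unfolding set_lebesgue_integral_def
      by (intro integral_eq_zero_AE) auto
  qed
  ultimately show ?thesis using True by simp
next
  case False
  with s have s: "s > 0" by simp
  define h where "h w = \<phi> w * exp (w * z)" for w
  have hh: "h holomorphic_on S" unfolding h_def[abs_def] by (intro holomorphic_intros hol)
  \<comment> \<open>The decay estimate is confined to this half-strip, where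
    \<open>exp (w * z)\<close> is at most \<open>exp (s * Re z)\<close>; on all of \<open>S\<close>
    it may grow faster than \<open>\<phi>\<close> decays.\<close>
  define S' where "S' = {of_real u + of_real t * a | u t. 0 \<le> u \<and> u \<le> s \<and> 0 \<le> t}"
  have S'I: "of_real u + of_real t * a \<in> S'" if "0 \<le> u" "u \<le> s" "0 \<le> t" for u t
    using that by (auto simp: S'_def)
  have S'S: "S' \<subseteq> S" using S(2) by (auto simp: S'_def)
  have hc: "continuous_on S h" by (rule holomorphic_on_imp_continuous_on[OF hh])
  have hb: "cmod (h w) \<le> (C * exp (s * Re z)) * exp (- \<kappa> * Re w)" if wS: "w \<in> S'" for w
  proof -
    obtain u t where w: "w = of_real u + of_real t * a" "0 \<le> u" "u \<le> s" "0 \<le> t"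
      using wS unfolding S'_def by blast
    have "Re (w * z) = u * Re z + t * Re (a * z)" by (simp add: w(1) algebra_simps)
    also have "\<dots> \<le> s * Re z + 0" using w z by (intro add_mono mult_right_mono mult_nonneg_nonpos) auto
    finally have "exp (Re (w * z)) \<le> exp (s * Re z)" by simp
    moreover have "cmod (\<phi> w) \<le> C * exp (- \<kappa> * Re w)" using wS S'S by (intro bound) auto
    ultimately have "cmod (\<phi> w) * exp (Re (w * z)) \<le> (C * exp (- \<kappa> * Re w)) * exp (s * Re z)"
      by (intro mult_mono) (auto intro: order_trans[OF norm_ge_zero])
    then show ?thesis by (simp add: h_def norm_mult ac_simps)
  qed
  have seg: "continuous_on (closed_segment x y) h" if "x \<in> S" "y \<in> S" for x y
    by (rule continuous_on_subset[OF hc closed_segment_subset[OF that S(1)]])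
  have mem: "of_real u \<in> S" "of_real t * a \<in> S" "of_real u + of_real t * a \<in> S" if "u \<ge> 0" "t \<ge> 0" for u t
    using S(2)[of u 0] S(2)[of 0 t] S(2)[of u t] that by auto
  have int: "set_integrable lborel {0..} (\<lambda>t. h (of_real u + of_real t * a) * a)" if "0 \<le> u" "u \<le> s" for u
    by (rule ray_integral_integrable[OF continuous_on_subset[OF hc S'S] _ hb \<kappa> a]) (use that S'I in auto)
  have lim: "((\<lambda>L. contour_integral (linepath (of_real u) (of_real u + of_real L * a)) h) \<longlongrightarrow>
     (LINT t:{0..}|lborel. h (of_real u + of_real t * a) * a)) at_top" if "0 \<le> u" "u \<le> s" for u
    by (rule contour_integral_ray_tendsto[OF seg int]) (use that mem in auto)
  have side: "((\<lambda>L. contour_integral (linepath (of_real s + of_real L * a) (of_real L * a)) h) \<longlongrightarrow> 0) at_top"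
  proof (rule Lim_null_comparison)
    define B where "B = \<bar>C * exp (s * Re z)\<bar>"
    show "((\<lambda>L. (B * exp (- (\<kappa> * Re a) * L)) * s) \<longlongrightarrow> 0) at_top"
    proof -
      have "((\<lambda>L. exp (- c * L)) \<longlongrightarrow> 0) at_top" if "c > 0" for c :: real
        using that by real_asymp
      then have "((\<lambda>L. exp (- (\<kappa> * Re a) * L)) \<longlongrightarrow> 0) at_top" using a \<kappa> by simp
      from tendsto_mult_right[OF this, of "B * s"] show ?thesis by (simp add: ac_simps)
    qed
    show "\<forall>\<^sub>F L in at_top. norm (contour_integral (linepath (of_real s + of_real L * a) (of_real L * a)) h)
         \<le> (B * exp (- (\<kappa> * Re a) * L)) * s"
      using eventually_ge_at_top[of "0::real"]
    proof eventually_elim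
      case (elim L)
      have "norm (contour_integral (linepath (of_real s + of_real L * a) (of_real L * a)) h)
         \<le> (B * exp (- (\<kappa> * Re a) * L)) * cmod (of_real L * a - (of_real s + of_real L * a))"
      proof (rule contour_integral_bound_linepath)
        show "h contour_integrable_on linepath (of_real s + of_real L * a) (of_real L * a)"
          by (rule contour_integrable_continuous_linepath[OF seg]) (use mem s elim in auto)
        fix x assume "x \<in> closed_segment (of_real s + of_real L * a) (of_real L * a)"
        then obtain v where v: "0 \<le> v" "v \<le> 1" "x = (1 - v) *\<^sub>R (of_real s + of_real L * a) + v *\<^sub>R (of_real L * a)"
          by (auto simp: closed_segment_def)
        then have x: "x = of_real ((1 - v) * s) + of_real L * a"
          by (simp add: scaleR_conv_of_real algebra_simps)
        have "(1 - v) * s \<le> 1 * s" "0 \<le> (1 - v) * s" using v s by (auto intro: mult_right_mono)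
        then have "x \<in> S'" unfolding x using elim by (intro S'I) auto
        then have "cmod (h x) \<le> (C * exp (s * Re z)) * exp (- \<kappa> * Re x)" by (rule hb)
        also have "\<dots> \<le> B * exp (- \<kappa> * Re x)" unfolding B_def by (intro mult_right_mono) auto
        also have "\<dots> \<le> B * exp (- (\<kappa> * Re a) * L)"
          using \<kappa> \<open>0 \<le> (1 - v) * s\<close> by (intro mult_left_mono) (auto simp: x B_def algebra_simps)
        finally show "cmod (h x) \<le> B * exp (- (\<kappa> * Re a) * L)" .
      qed (auto simp: B_def)
      then show ?case using s by simp
    qed
  qed
  have "\<forall>\<^sub>F L in at_top. contour_integral (linepath 0 (of_real s)) h
      + contour_integral (linepath (of_real s) (of_real s + of_real L * a)) h
      + contour_integral (linepath (of_real s + of_real L * a) (of_real L * a)) h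
      - contour_integral (linepath 0 (of_real L * a)) h = 0"
    using eventually_ge_at_top[of "0::real"]
  proof eventually_elim
    case (elim L)
    have m: "0 \<in> S" "of_real s \<in> S" "of_real s + of_real L * a \<in> S" "of_real L * a \<in> S"
      using mem[of 0 0] mem[of s L] elim s by auto
    \<comment> \<open>The parallelogram 0, s, s + L a, L a is cut along its diagonal into two
      triangles; the diagonal cancels.\<close>
    have "contour_integral (linepath 0 (of_real s)) h + contour_integral (linepath (of_real s) (of_real s + of_real L * a)) h
       + contour_integral (linepath (of_real s + of_real L * a) 0) h = 0"
      by (rule contour_integral_triangle_sum[OF hh S(1)]) (use m in auto)
    moreover have "contour_integral (linepath 0 (of_real s + of_real L * a)) h + contour_integral (linepath (of_real s + of_real L * a) (of_real L * a)) h
       + contour_integral (linepath (of_real L * a) 0) h = 0"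
      by (rule contour_integral_triangle_sum[OF hh S(1)]) (use m in auto)
    moreover have "contour_integral (linepath x 0) h = - contour_integral (linepath 0 x) h" if "x \<in> S" for x
      by (rule contour_integral_reverse_linepath[OF seg]) (use m that in auto)
    ultimately show ?case using m(3,4) by (simp add: algebra_simps)
  qed
  moreover have "((\<lambda>L. contour_integral (linepath 0 (of_real s)) h
      + contour_integral (linepath (of_real s) (of_real s + of_real L * a)) h
      + contour_integral (linepath (of_real s + of_real L * a) (of_real L * a)) h
      - contour_integral (linepath 0 (of_real L * a)) h) \<longlongrightarrow>
      contour_integral (linepath 0 (of_real s)) h + (LINT t:{0..}|lborel. h (of_real s + of_real t * a) * a) + 0
      - (LINT t:{0..}|lborel. h (of_real 0 + of_real t * a) * a)) at_top"
    using lim[of 0] lim[of s] s by (intro tendsto_intros side) auto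
  ultimately have "((\<lambda>L::real. 0) \<longlongrightarrow> contour_integral (linepath 0 (of_real s)) h + (LINT t:{0..}|lborel. h (of_real s + of_real t * a) * a) + 0
      - (LINT t:{0..}|lborel. h (of_real 0 + of_real t * a) * a)) at_top"
    by (rule Lim_transform_eventually[rotated])
  from tendsto_unique[OF trivial_limit_at_top_linorder this tendsto_const]
  have eq: "contour_integral (linepath 0 (of_real s)) h + (LINT t:{0..}|lborel. h (of_real s + of_real t * a) * a)
      = (LINT t:{0..}|lborel. h (of_real t * a) * a)" by simp
  have "contour_integral (linepath 0 (of_real s)) h = (LINT u:{0..s}|lborel. h (of_real u))"
    using contour_integral_linepath_eq[of 0 s 1 h] seg[of 0 "of_real s"] mem[of 0 0] mem[of s 0] s by simp
  moreover have "(LINT t:{0..}|lborel. h (of_real s + of_real t * a) * a) =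
     exp (of_real s * z) * (LINT t:{0..}|lborel. \<phi> (of_real s + of_real t * a) * a * exp (of_real t * a * z))"
    unfolding set_integral_mult_right[symmetric]
    by (intro set_lebesgue_integral_cong) (auto simp: h_def exp_add algebra_simps)
  moreover have "(LINT t:{0..}|lborel. h (of_real t * a) * a) = (LINT t:{0..}|lborel. \<phi> (of_real t * a) * a * exp (of_real t * a * z))"
    by (intro set_lebesgue_integral_cong) (auto simp: h_def)
  moreover have "(LINT u:{0..s}|lborel. h (of_real u)) = (LINT u:{0..s}|lborel. \<phi> (of_real u) * exp (of_real u * z))"
    by (simp add: h_def)
  moreover have "J = exp (- of_real s * z) * (K - I)" if "I + exp (of_real s * z) * J = K" for I J K :: complex
    using that by (auto simp: exp_minus field_simps)
  ultimately show ?thesis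
    using eq by (simp only:)
qed

section \<open>Functional calculus for resolvents of Dirichlet polynomials\<close>

text \<open>For \<open>Re b, Im b > 0\<close> the closed convex cone between the rays through
  \<open>b\<close> and \<open>cnj b\<close>, vertex included. The form as a linear inequality in
  \<open>\<bar>Im z\<bar>\<close> and \<open>Re z\<close> makes stability under sums
  immediate.\<close>

definition wedge :: "complex \<Rightarrow> complex set" where
  "wedge b = {z. \<bar>Im z\<bar> * Re b \<le> Im b * Re z}"

lemma wedge_add: "\<lbrakk>Re b > 0; z \<in> wedge b; w \<in> wedge b\<rbrakk> \<Longrightarrow> z + w \<in> wedge b"
proof -
  assume *: "Re b > 0" "z \<in> wedge b" "w \<in> wedge b"
  have "\<bar>Im z + Im w\<bar> * Re b \<le> (\<bar>Im z\<bar> + \<bar>Im w\<bar>) * Re b"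
    using * by (intro mult_right_mono) auto
  with * show ?thesis by (simp add: wedge_def algebra_simps)
qed

lemma wedge_scale: "\<lbrakk>z \<in> wedge b; u \<ge> 0\<rbrakk> \<Longrightarrow> of_real u * z \<in> wedge b"
  using mult_left_mono[of "\<bar>Im z\<bar> * Re b" "Im b * Re z" u] by (simp add: wedge_def abs_mult ac_simps)

lemma convex_wedge: "Re b > 0 \<Longrightarrow> convex (wedge b)"
  unfolding convex_def scaleR_conv_of_real by (auto intro: wedge_add wedge_scale)

lemma wedge_of_real: "\<lbrakk>Im b > 0; u \<ge> 0\<rbrakk> \<Longrightarrow> of_real u \<in> wedge b"
  by (simp add: wedge_def)

lemma wedge_ray:
  assumes "Re b > 0" "Im b > 0" "d = b \<or> d = cnj b" "u \<ge> 0"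
  shows "of_real u * d \<in> wedge b"
  using assms by (intro wedge_scale) (auto simp: wedge_def)

lemma wedge_Re_nonneg: "\<lbrakk>Re b > 0; Im b > 0; z \<in> wedge b\<rbrakk> \<Longrightarrow> Re z \<ge> 0"
proof -
  assume *: "Re b > 0" "Im b > 0" "z \<in> wedge b"
  have "0 \<le> \<bar>Im z\<bar> * Re b" using * by simp
  also have "\<dots> \<le> Im b * Re z" using * by (simp add: wedge_def)
  finally have "0 \<le> Im b * Re z" .
  with * show ?thesis by (simp add: zero_le_mult_iff)
qed

lemma set_integral_sum:
  fixes f :: "'k \<Rightarrow> real \<Rightarrow> complex"
  assumes "\<And>k. k \<in> K \<Longrightarrow> set_integrable M A (f k)"
  shows "(LINT x:A|M. (\<Sum>k\<in>K. f k x)) = (\<Sum>k\<in>K. LINT x:A|M. f k x)"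
    and "set_integrable M A (\<lambda>x. \<Sum>k\<in>K. f k x)"
  using assms unfolding set_lebesgue_integral_def set_integrable_def scaleR_sum_right
  by (auto intro!: Bochner_Integration.integral_sum Bochner_Integration.integrable_sum)

text \<open>
  \<open>a\<close> and \<open>e\<close> span the rays of integration in the time variable and in the spectral variable; the
  measure is \<open>\<Sum>k\<in>K. p k \<cdot> (Dirac measure at s k)\<close>. The factor \<open>exp (- \<delta> z)\<close> in \<open>g\<close> below makes all integrals
  over the spectral rays absolutely convergent.
\<close>

locale dirichlet_resolvent =
  fixes a e \<zeta> :: complex and \<delta> C0 :: real and K :: "'k set" and p s :: "'k \<Rightarrow> real"
  assumes Re_a: "Re a > 0" and Im_a: "Im a > 0" and norm_a: "cmod a = 1"
    and Re_e: "Re e > 0" and Im_e: "Im e > 0" and norm_e: "cmod e = 1"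
    and Re_ae: "Re (a * e) < 0" and \<delta>: "\<delta> > 0"
    and p: "\<And>k. k \<in> K \<Longrightarrow> p k \<ge> 0" and sum_p: "sum p K = 1"
    and s: "\<And>k. k \<in> K \<Longrightarrow> s k \<ge> 0" and \<zeta>: "\<zeta> \<noteq> 1" and C0: "C0 > 0"
    and lower: "\<And>z. z \<in> wedge e \<Longrightarrow>
      cmod (1 - \<zeta>) + (\<Sum>k\<in>K. p k * (1 - exp (- s k * Re z))) \<le> C0 * cmod (\<zeta> - (\<Sum>k\<in>K. of_real (p k) * exp (- of_real (s k) * z)))"
begin

definition f :: "complex \<Rightarrow> complex" where "f z = (\<Sum>k\<in>K. of_real (p k) * exp (- of_real (s k) * z))"

definition g :: "complex \<Rightarrow> complex" where "g z = exp (- of_real \<delta> * z) / (\<zeta> - f z)"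

text \<open>The Laplace transform of \<open>g\<close> along the ray of direction \<open>d\<close>,
  at the point \<open>- w\<close>. The exponential stays bounded on that ray when
  \<open>Re (w * d) \<le> 0\<close>; a negative real \<open>w\<close> admits both spectral
  rays.\<close>

definition G :: "complex \<Rightarrow> complex \<Rightarrow> complex" where
  "G d w = (LINT r:{0..}|lborel. g (of_real r * d) * d * exp (w * (of_real r * d)))"

definition ray_pairing :: "complex \<Rightarrow> complex \<Rightarrow> (complex \<Rightarrow> complex) \<Rightarrow> complex" where
  "ray_pairing b d \<phi> = (LINT t:{0..}|lborel. \<phi> (of_real t * b) * b * G d (of_real t * b))"

text \<open>For \<open>\<phi>(w) = exp (- w z)\<close> the pairing is \<open>g z\<close>, so \<open>\<phi>(w) = u(F w x)\<close> gives \<open>u(g(A) x)\<close>.\<close>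

definition pairing where "pairing \<psi> = (ray_pairing a e \<psi> - ray_pairing (cnj a) (cnj e) \<psi>) / (2 * pi * \<i>)"

text \<open>A time ray has to be paired with the spectral ray in the same half-plane:
  \<open>a * e\<close> has negative real part, whereas \<open>a * cnj e\<close> has positive real
  part.\<close>

definition side :: "complex \<Rightarrow> complex \<Rightarrow> bool" where
  "side b d \<longleftrightarrow> (b = a \<and> d = e) \<or> (b = cnj a \<and> d = cnj e)"

lemma side_facts:
  assumes "side b d"
  shows "Re b = Re a" "Re d = Re e" "cmod b = 1" "cmod d = 1" "Re (b * d) = Re (a * e)"
    "\<bar>Im b\<bar> = Im a" "\<bar>Im d\<bar> = Im e" "b = a \<or> b = cnj a" "d = e \<or> d = cnj e"
  using assms norm_a norm_e Im_a Im_e unfolding side_def by auto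

lemma side_wedge: "side b d \<Longrightarrow> t \<ge> 0 \<Longrightarrow> of_real t * b \<in> wedge a" "side b d \<Longrightarrow> t \<ge> 0 \<Longrightarrow> of_real t * d \<in> wedge e"
  using wedge_ray[OF Re_a Im_a, of b t] wedge_ray[OF Re_e Im_e, of d t] side_facts(8,9) by auto

lemma B_nonneg:
  assumes "x \<ge> 0" shows "(\<Sum>k\<in>K. p k * (1 - exp (- s k * x))) \<ge> 0"
  using assms p s by (intro sum_nonneg mult_nonneg_nonneg) auto

lemma lower': "z \<in> wedge e \<Longrightarrow> cmod (1 - \<zeta>) \<le> C0 * cmod (\<zeta> - f z)"
  using lower[of z] B_nonneg[of "Re z"] wedge_Re_nonneg[OF Re_e Im_e, of z] by (simp add: f_def)

lemma denominator_nonzero: "z \<in> wedge e \<Longrightarrow> \<zeta> - f z \<noteq> 0"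
  using lower'[of z] \<zeta> by auto

lemma g_bound: "z \<in> wedge e \<Longrightarrow> cmod (g z) \<le> C0 / cmod (1 - \<zeta>) * exp (- \<delta> * Re z)"
proof -
  assume z: "z \<in> wedge e"
  have "cmod (1 - \<zeta>) > 0" "cmod (\<zeta> - f z) > 0" using \<zeta> denominator_nonzero[OF z] by auto
  then have "1 / cmod (\<zeta> - f z) \<le> C0 / cmod (1 - \<zeta>)"
    using lower'[OF z] by (simp add: field_simps)
  then have "exp (- \<delta> * Re z) * (1 / cmod (\<zeta> - f z)) \<le> exp (- \<delta> * Re z) * (C0 / cmod (1 - \<zeta>))"
    by (intro mult_left_mono) auto
  then show ?thesis by (simp add: g_def norm_divide mult.commute)
qed

lemma f_holomorphic [holomorphic_intros]: "f holomorphic_on A"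
  unfolding f_def[abs_def] by (intro holomorphic_intros)

lemma g_holomorphic: "g holomorphic_on wedge e"
  unfolding g_def[abs_def] using denominator_nonzero by (intro holomorphic_intros) auto

lemma g_ray_integrable: "side b d \<Longrightarrow> set_integrable lborel {0..} (\<lambda>r. g (of_real r * d) * d)"
  using ray_integral_integrable[OF holomorphic_on_imp_continuous_on[OF g_holomorphic] _ g_bound \<delta>, of 0 d]
    side_wedge(2)[of b d] Re_e side_facts(2)[of b d] by simp

lemma g_ray_continuous: "side b d \<Longrightarrow> continuous_on {0..} (\<lambda>r. g (of_real r * d))"
  by (rule continuous_on_compose2[OF holomorphic_on_imp_continuous_on[OF g_holomorphic]])
    (auto intro!: continuous_intros side_wedge(2))

lemma ray_kernel_Re:
  assumes "side b d" "t \<ge> 0"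
  shows "Re (of_real t * b * d) \<le> 0"
proof -
  have "Re (of_real t * b * d) = t * Re (b * d)" by (simp add: algebra_simps)
  then show ?thesis using assms side_facts(5)[OF assms(1)] Re_ae by (simp add: mult_nonneg_nonpos)
qed

lemma kernel_bound:
  assumes "side b d" "r \<ge> 0" "t \<ge> 0"
  shows "cmod (exp (of_real t * b * (of_real r * d))) \<le> 1"
  using norm_mult_exp_le[OF ray_kernel_Re[OF assms(1,3)] assms(2), of 1] by simp

text \<open>For \<open>w = - v\<close> the exponential is bounded on the whole wedge between the two
  spectral rays, not just on one of them, so the contour may be rotated across the real
  axis.\<close>

lemma G_cnj: "v \<ge> 0 \<Longrightarrow> G e (- of_real v) = G (cnj e) (- of_real v)"
proof -
  assume v: "v \<ge> 0"
  have "(LINT r:{0..}|lborel. (g (of_real r * e) * exp (- of_real v * (of_real r * e))) * e) =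
     (LINT r:{0..}|lborel. (g (of_real r * cnj e) * exp (- of_real v * (of_real r * cnj e))) * cnj e)"
  proof (rule ray_integrals_eq[where \<phi> = "\<lambda>z. g z * exp (- of_real v * z)" and S = "wedge e" and \<rho> = "Re e" and \<kappa> = \<delta>])
    show "(\<lambda>z. g z * exp (- of_real v * z)) holomorphic_on wedge e"
      by (intro holomorphic_intros g_holomorphic)
    fix z assume z: "z \<in> wedge e"
    have "exp (- v * Re z) \<le> 1" using v wedge_Re_nonneg[OF Re_e Im_e z] by simp
    then have "cmod (g z) * exp (- v * Re z) \<le> (C0 / cmod (1 - \<zeta>) * exp (- \<delta> * Re z)) * 1"
      using g_bound[OF z] by (intro mult_mono) (auto intro: order_trans[OF norm_ge_zero])
    then show "cmod (g z * exp (- of_real v * z)) \<le> C0 / cmod (1 - \<zeta>) * exp (- \<delta> * Re z)"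
      by (simp add: norm_mult)
  qed (use Re_e Im_e \<delta> convex_wedge[OF Re_e] wedge_ray[OF Re_e Im_e] in auto)
  then show ?thesis by (simp add: G_def ac_simps)
qed

context
  fixes \<phi> :: "complex \<Rightarrow> complex" and \<kappa> M :: real
  assumes \<phi>: "\<phi> holomorphic_on wedge a" and \<kappa>: "\<kappa> > 0"
    and \<phi>_bound: "\<And>w. w \<in> wedge a \<Longrightarrow> cmod (\<phi> w) \<le> M * exp (- \<kappa> * Re w)"
begin

lemma \<phi>_ray_integrable:
  assumes "side b d" "v \<ge> 0"
  shows "set_integrable lborel {0..} (\<lambda>t. \<phi> (of_real v + of_real t * b) * b)"
  by (rule ray_integral_integrable[OF holomorphic_on_imp_continuous_on[OF \<phi>] _ \<phi>_bound \<kappa>])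
    (use assms side_facts(1)[OF assms(1)] Re_a Im_a side_wedge(1) in \<open>auto intro!: wedge_add wedge_of_real\<close>)

text \<open>The time integral at the spectral point \<open>r * d\<close>. After Fubini a pairing
  becomes an integral of \<open>g\<close> against \<open>\<rho>\<close>, where translations of
  \<open>\<phi>\<close> turn into multiplications.\<close>

definition \<rho> :: "complex \<Rightarrow> complex \<Rightarrow> real \<Rightarrow> complex" where
  "\<rho> b d r = (LINT t:{0..}|lborel. \<phi> (of_real t * b) * b * exp (of_real t * b * (of_real r * d)))"

lemma exp_measurable:
  fixes b d :: complex
  shows "(\<lambda>x. exp (of_real (snd x) * b * (of_real (fst x) * d))) \<in> borel_measurable (borel :: (real \<times> real) measure)"
  by (intro borel_measurable_continuous_onI continuous_intros)

text \<open>Fubini followed by \<open>ray_integral_shift\<close> at \<open>z = r * d\<close>: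
  translation by \<open>v\<close> acts on the spectral side as multiplication by
  \<open>exp (- v * z)\<close>, up to the integral over a real segment.\<close>

lemma ray_pairing_shift_eq:
  assumes bd: "side b d" and v: "v \<ge> 0"
  shows "ray_pairing b d (\<lambda>w. \<phi> (of_real v + w)) =
     (LINT r:{0..}|lborel. g (of_real r * d) * d * (exp (- of_real v * (of_real r * d)) *
        (\<rho> b d r - (LINT u:{0..v}|lborel. \<phi> (of_real u) * exp (of_real u * (of_real r * d))))))"
proof -
  have "ray_pairing b d (\<lambda>w. \<phi> (of_real v + w)) =
     (LINT r:{0..}|lborel. g (of_real r * d) * d *
        (LINT t:{0..}|lborel. \<phi> (of_real v + of_real t * b) * b * exp (of_real t * b * (of_real r * d))))"
    unfolding ray_pairing_def G_def
    by (rule fubini_dominated(1)[OF g_ray_integrable[OF bd] \<phi>_ray_integrable[OF bd v] exp_measurable, symmetric])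
      (use kernel_bound[OF bd] in auto)
  also have "\<dots> = (LINT r:{0..}|lborel. g (of_real r * d) * d * (exp (- of_real v * (of_real r * d)) *
        (\<rho> b d r - (LINT u:{0..v}|lborel. \<phi> (of_real u) * exp (of_real u * (of_real r * d))))))"
  proof (rule set_integral_cong_on)
    fix r :: real assume "r \<in> {0..}"
    then have r: "r \<ge> 0" by simp
    have "Re (b * (of_real r * d)) = r * Re (b * d)" by (simp add: algebra_simps)
    also have "\<dots> \<le> 0" using side_facts(5)[OF bd] Re_ae r by (simp add: mult_nonneg_nonpos)
    finally have "Re (b * (of_real r * d)) \<le> 0" .
    then show "g (of_real r * d) * d *
      (LINT t:{0..}|lborel. \<phi> (of_real v + of_real t * b) * b * exp (of_real t * b * (of_real r * d))) =
     g (of_real r * d) * d * (exp (- of_real v * (of_real r * d)) *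
      (\<rho> b d r - (LINT u:{0..v}|lborel. \<phi> (of_real u) * exp (of_real u * (of_real r * d)))))"
      unfolding \<rho>_def using bd v r side_facts[OF bd] Re_a Re_e \<kappa> \<phi> side_wedge(1)
      by (subst ray_integral_shift[OF _ \<kappa> v _ _ \<phi> convex_wedge[OF Re_a] _ \<phi>_bound])
        (auto intro!: wedge_add wedge_of_real Im_a)
  qed simp
  finally show ?thesis .
qed

text \<open>The segment terms are collected into values of \<open>G d\<close> at the nonpositive
  reals \<open>u - v\<close>. By \<open>G_cnj\<close> these are the same for both sides, which is
  what makes them cancel later.\<close>

lemma ray_pairing_shift:
  assumes bd: "side b d" and v: "v \<ge> 0"
  shows "ray_pairing b d (\<lambda>w. \<phi> (of_real v + w)) =
      (LINT r:{0..}|lborel. g (of_real r * d) * d * exp (- of_real v * (of_real r * d)) * \<rho> b d r)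
    - (LINT u:{0..v}|lborel. \<phi> (of_real u) * G d (of_real (u - v)))"
    and "set_integrable lborel {0..} (\<lambda>r. g (of_real r * d) * d * exp (- of_real v * (of_real r * d)) * \<rho> b d r)"
proof -
  have gv: "set_integrable lborel {0..} (\<lambda>r. g (of_real r * d) * d * exp (- of_real v * (of_real r * d)))"
    using v side_facts(2)[OF bd] Re_e
    by (intro set_integrable_mult_exp g_ray_integrable[OF bd] continuous_intros g_ray_continuous[OF bd]) simp
  show i1: "set_integrable lborel {0..} (\<lambda>r. g (of_real r * d) * d * exp (- of_real v * (of_real r * d)) * \<rho> b d r)"
    using fubini_dominated(2)[OF gv _ exp_measurable, of "{0..}" "\<lambda>t. \<phi> (of_real t * b) * b" b d]
      \<phi>_ray_integrable[OF bd, of 0] kernel_bound[OF bd] unfolding \<rho>_def by auto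
  have \<phi>v: "set_integrable lborel {0..v} (\<lambda>u. \<phi> (of_real u))"
    by (rule borel_integrable_atLeastAtMost', rule continuous_on_compose2[OF holomorphic_on_imp_continuous_on[OF \<phi>]])
      (auto intro!: continuous_intros wedge_of_real Im_a)
  have m: "(\<lambda>x. exp (of_real (snd x - v) * (of_real (fst x) * d))) \<in> borel_measurable (borel :: (real \<times> real) measure)"
    by (intro borel_measurable_continuous_onI continuous_intros)
  have k: "cmod (exp (of_real (u - v) * (of_real r * d))) \<le> 1" if "r \<in> {0..}" "u \<in> {0..v}" for r u
  proof -
    have "(u - v) * (r * Re d) \<le> 0"
      using that side_facts(2)[OF bd] Re_e by (intro mult_nonpos_nonneg) auto
    then show ?thesis by simp
  qed
  note fub = fubini_dominated[OF g_ray_integrable[OF bd] \<phi>v m k]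
  have eq: "(LINT u:{0..v}|lborel. \<phi> (of_real u) * exp (of_real (u - v) * (of_real r * d))) =
     exp (- of_real v * (of_real r * d)) * (LINT u:{0..v}|lborel. \<phi> (of_real u) * exp (of_real u * (of_real r * d)))" for r
    unfolding set_integral_mult_right[symmetric]
    by (intro set_lebesgue_integral_cong) (auto simp: algebra_simps exp_add[symmetric])
  have i2: "set_integrable lborel {0..} (\<lambda>r. g (of_real r * d) * d * (LINT u:{0..v}|lborel. \<phi> (of_real u) * exp (of_real (u - v) * (of_real r * d))))"
    by (rule fub(2))
  have "ray_pairing b d (\<lambda>w. \<phi> (of_real v + w)) =
     (LINT r:{0..}|lborel. g (of_real r * d) * d * exp (- of_real v * (of_real r * d)) * \<rho> b d r
       - g (of_real r * d) * d * (LINT u:{0..v}|lborel. \<phi> (of_real u) * exp (of_real (u - v) * (of_real r * d))))"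
    unfolding ray_pairing_shift_eq[OF assms] eq
    by (intro set_lebesgue_integral_cong) (auto simp: algebra_simps)
  also have "\<dots> = (LINT r:{0..}|lborel. g (of_real r * d) * d * exp (- of_real v * (of_real r * d)) * \<rho> b d r)
     - (LINT r:{0..}|lborel. g (of_real r * d) * d * (LINT u:{0..v}|lborel. \<phi> (of_real u) * exp (of_real (u - v) * (of_real r * d))))"
    by (rule set_integral_diff(2)[OF i1 i2])
  also have "(LINT r:{0..}|lborel. g (of_real r * d) * d * (LINT u:{0..v}|lborel. \<phi> (of_real u) * exp (of_real (u - v) * (of_real r * d))))
     = (LINT u:{0..v}|lborel. \<phi> (of_real u) * G d (of_real (u - v)))"
    unfolding G_def by (rule fub(1))
  finally show "ray_pairing b d (\<lambda>w. \<phi> (of_real v + w)) =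
      (LINT r:{0..}|lborel. g (of_real r * d) * d * exp (- of_real v * (of_real r * d)) * \<rho> b d r)
    - (LINT u:{0..v}|lborel. \<phi> (of_real u) * G d (of_real (u - v)))" .
qed

text \<open>Summing over \<open>k\<close> produces the factor \<open>\<zeta> - f\<close>, which
  cancels the denominator of \<open>g\<close> and leaves only the damping
  \<open>exp (- \<delta> z)\<close>. Its spectral integral is elementary and equals a Cauchy kernel
  with pole at \<delta>.\<close>

lemma ray_pairing_resolvent:
  assumes bd: "side b d"
  shows "\<zeta> * ray_pairing b d \<phi> - (\<Sum>k\<in>K. p k * ray_pairing b d (\<lambda>w. \<phi> (of_real (s k) + w))) =
     (\<Sum>k\<in>K. p k * (LINT u:{0..s k}|lborel. \<phi> (of_real u) * G d (of_real (u - s k))))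
     - (LINT t:{0..}|lborel. \<phi> (of_real t * b) / (of_real t * b - of_real \<delta>) * b)"
proof -
  let ?I = "\<lambda>v r. g (of_real r * d) * d * exp (- of_real v * (of_real r * d)) * \<rho> b d r"
  let ?X = "\<lambda>v. LINT u:{0..v}|lborel. \<phi> (of_real u) * G d (of_real (u - v))"
  have X0: "?X 0 = 0"
  proof -
    have "{0..0::real} = {0}" by auto
    moreover have "AE u in lborel. u \<noteq> (0::real)" by (rule AE_lborel_singleton)
    ultimately show ?thesis unfolding set_lebesgue_integral_def
      by (intro integral_eq_zero_AE) auto
  qed
  have sh: "ray_pairing b d (\<lambda>w. \<phi> (of_real (s k) + w)) = (LINT r:{0..}|lborel. ?I (s k) r) - ?X (s k)"
    and si: "set_integrable lborel {0..} (?I (s k))" if "k \<in> K" for k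
    using ray_pairing_shift[OF bd s[OF that]] by auto
  have s0: "ray_pairing b d \<phi> = (LINT r:{0..}|lborel. ?I 0 r)" and si0: "set_integrable lborel {0..} (?I 0)"
    using ray_pairing_shift[OF bd, of 0] X0 by auto
  have "\<zeta> * (LINT r:{0..}|lborel. ?I 0 r) - (\<Sum>k\<in>K. p k * (LINT r:{0..}|lborel. ?I (s k) r)) =
     (LINT r:{0..}|lborel. \<zeta> * ?I 0 r) - (LINT r:{0..}|lborel. (\<Sum>k\<in>K. p k * ?I (s k) r))"
    using si by (subst set_integral_sum) auto
  also have "\<dots> = (LINT r:{0..}|lborel. \<zeta> * ?I 0 r - (\<Sum>k\<in>K. p k * ?I (s k) r))"
    using si si0 by (intro set_integral_diff(2)[symmetric] set_integral_sum(2)) auto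
  also have "\<dots> = (LINT r:{0..}|lborel. exp (- of_real \<delta> * (of_real r * d)) * d * \<rho> b d r)"
  proof (rule set_integral_cong_on)
    fix r :: real assume "r \<in> {0..}"
    then have "\<zeta> - f (of_real r * d) \<noteq> 0"
      using side_wedge(2)[OF bd] by (intro denominator_nonzero) auto
    moreover have "\<zeta> * ?I 0 r - (\<Sum>k\<in>K. p k * ?I (s k) r) = g (of_real r * d) * (\<zeta> - f (of_real r * d)) * d * \<rho> b d r"
      by (simp add: f_def algebra_simps sum_distrib_left sum_distrib_right)
    ultimately show "\<zeta> * ?I 0 r - (\<Sum>k\<in>K. p k * ?I (s k) r) = exp (- of_real \<delta> * (of_real r * d)) * d * \<rho> b d r"
      by (simp add: g_def)
  qed simp
  also have "\<dots> = (LINT t:{0..}|lborel. \<phi> (of_real t * b) * b * (LINT r:{0..}|lborel. exp (- of_real \<delta> * (of_real r * d)) * d * exp (of_real t * b * (of_real r * d))))"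
    unfolding \<rho>_def
  proof (rule fubini_dominated(1)[OF _ _ exp_measurable])
    show "set_integrable lborel {0..} (\<lambda>r. exp (- of_real \<delta> * (of_real r * d)) * d)"
      by (rule set_integrable_exp_decay[where C = 1 and c = "\<delta> * Re e"])
        (use \<delta> Re_e side_facts(2,4)[OF bd] in \<open>auto simp: norm_mult intro!: continuous_intros\<close>)
  qed (use \<phi>_ray_integrable[OF bd, of 0] kernel_bound[OF bd] in auto)
  also have "\<dots> = (LINT t:{0..}|lborel. - (\<phi> (of_real t * b) / (of_real t * b - of_real \<delta>) * b))"
  proof (rule set_integral_cong_on)
    fix t :: real assume "t \<in> {0..}"
    then have t: "t \<ge> 0" by simp
    \<comment> \<open>Damping and coupling merge into one exponent \<open>r * q\<close>. The
      integral is \<open>- d / q\<close>, and the direction \<open>d\<close> divides out.\<close>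
    define q where "q = (of_real t * b - of_real \<delta>) * d"
    have "Re q = t * Re (b * d) - \<delta> * Re d" by (simp add: q_def algebra_simps)
    then have "Re q = t * Re (a * e) - \<delta> * Re e" by (simp only: side_facts(2,5)[OF bd])
    moreover have "t * Re (a * e) \<le> 0" using t Re_ae by (simp add: mult_nonneg_nonpos)
    moreover have "\<delta> * Re e > 0" using \<delta> Re_e by simp
    ultimately have q: "Re q < 0" by linarith
    then have "q \<noteq> 0" by auto
    then have nz: "d \<noteq> 0" "of_real t * b - of_real \<delta> \<noteq> 0" by (auto simp: q_def)
    have "(LINT r:{0..}|lborel. exp (of_real r * q) * d) = 0 - exp (of_real 0 * q) * d / q"
    proof (rule set_integral_FTC_half_line)
      show "((\<lambda>r. exp (of_real r * q) * d / q) has_vector_derivative exp (of_real r * q) * d) (at r)" for r :: real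
        using \<open>q \<noteq> 0\<close> by (auto intro!: derivative_eq_intros has_vector_derivative_real_field)
      show "set_integrable lborel {0..} (\<lambda>r. exp (of_real r * q) * d)"
        by (rule set_integrable_exp_decay[where C = 1 and c = "- Re q"])
          (use q side_facts(4)[OF bd] in \<open>auto simp: norm_mult mult.commute intro!: continuous_intros\<close>)
      have "((\<lambda>r. exp (Re q * r)) \<longlongrightarrow> 0) at_top" using q by real_asymp
      then have "((\<lambda>r. exp (of_real r * q)) \<longlongrightarrow> 0) at_top"
        by (intro tendsto_norm_zero_cancel[where f = "\<lambda>r. exp (of_real r * q)"]) (simp add: mult.commute)
      then show "((\<lambda>r. exp (of_real r * q) * d / q) \<longlongrightarrow> 0) at_top"
        using tendsto_mult_left_zero[of _ _ "d / q"] by simp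
    qed
    moreover have "exp (- of_real \<delta> * (of_real r * d)) * d * exp (of_real t * b * (of_real r * d)) = exp (of_real r * q) * d" for r
      by (simp add: q_def algebra_simps exp_add[symmetric])
    ultimately have "(LINT r:{0..}|lborel. exp (- of_real \<delta> * (of_real r * d)) * d * exp (of_real t * b * (of_real r * d))) = - (d / q)"
      by (simp only:) simp
    also have "\<dots> = - 1 / (of_real t * b - of_real \<delta>)" using nz by (simp add: q_def)
    finally have "(LINT r:{0..}|lborel. exp (- of_real \<delta> * (of_real r * d)) * d * exp (of_real t * b * (of_real r * d))) = - 1 / (of_real t * b - of_real \<delta>)" .
    then show "\<phi> (of_real t * b) * b * (LINT r:{0..}|lborel. exp (- of_real \<delta> * (of_real r * d)) * d * exp (of_real t * b * (of_real r * d)))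
      = - (\<phi> (of_real t * b) / (of_real t * b - of_real \<delta>) * b)"
      by simp
  qed simp
  finally have main: "\<zeta> * (LINT r:{0..}|lborel. ?I 0 r) - (\<Sum>k\<in>K. p k * (LINT r:{0..}|lborel. ?I (s k) r)) =
      - (LINT t:{0..}|lborel. \<phi> (of_real t * b) / (of_real t * b - of_real \<delta>) * b)"
    by (simp add: set_lebesgue_integral_def)
  have "(\<Sum>k\<in>K. p k * ray_pairing b d (\<lambda>w. \<phi> (of_real (s k) + w))) =
     (\<Sum>k\<in>K. p k * (LINT r:{0..}|lborel. ?I (s k) r)) - (\<Sum>k\<in>K. p k * ?X (s k))"
    by (simp add: sh right_diff_distrib sum_subtractf)
  with main s0 show ?thesis by (simp add: algebra_simps)
qed

text \<open>In the difference of the two sides the real-segment terms cancel, and Cauchy's formula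
  evaluates what remains at \<delta>. The damping parameter thus reappears as a time shift.\<close>

lemma pairing_resolvent:
  "\<zeta> * pairing \<phi> - (\<Sum>k\<in>K. p k * pairing (\<lambda>w. \<phi> (of_real (s k) + w))) = \<phi> (of_real \<delta>)"
proof -
  have sides: "side a e" "side (cnj a) (cnj e)" by (auto simp: side_def)
  have X: "(LINT u:{0..s k}|lborel. \<phi> (of_real u) * G (cnj e) (of_real (u - s k))) =
      (LINT u:{0..s k}|lborel. \<phi> (of_real u) * G e (of_real (u - s k)))" for k
  proof (rule set_lebesgue_integral_cong)
    show "\<forall>u. u \<in> {0..s k} \<longrightarrow> \<phi> (of_real u) * G (cnj e) (of_real (u - s k)) = \<phi> (of_real u) * G e (of_real (u - s k))"
      using G_cnj[of "s k - _"] by (auto simp flip: of_real_minus)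
  qed auto
  have "(LINT t:{0..}|lborel. \<phi> (of_real t * cnj a) / (of_real t * cnj a - of_real \<delta>) * cnj a)
       - (LINT t:{0..}|lborel. \<phi> (of_real t * a) / (of_real t * a - of_real \<delta>) * a) = 2 * pi * \<i> * \<phi> (of_real \<delta>)"
    by (rule ray_integrals_Cauchy_formula[OF Re_a Im_a \<kappa> \<delta> \<phi> convex_wedge[OF Re_a] _ \<phi>_bound])
      (auto simp: wedge_def)
  moreover have "A - B = V" if "A = Y - I" "B = Y - J" "J - I = V" for A B Y I J V :: complex
    using that by simp
  ultimately
  have "(\<zeta> * ray_pairing a e \<phi> - (\<Sum>k\<in>K. p k * ray_pairing a e (\<lambda>w. \<phi> (of_real (s k) + w))))
     - (\<zeta> * ray_pairing (cnj a) (cnj e) \<phi> - (\<Sum>k\<in>K. p k * ray_pairing (cnj a) (cnj e) (\<lambda>w. \<phi> (of_real (s k) + w))))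
     = 2 * pi * \<i> * \<phi> (of_real \<delta>)"
    using ray_pairing_resolvent[OF sides(1)] ray_pairing_resolvent[OF sides(2), unfolded X] by blast
  then have "(\<zeta> * (ray_pairing a e \<phi> - ray_pairing (cnj a) (cnj e) \<phi>)
      - (\<Sum>k\<in>K. p k * (ray_pairing a e (\<lambda>w. \<phi> (of_real (s k) + w)) - ray_pairing (cnj a) (cnj e) (\<lambda>w. \<phi> (of_real (s k) + w))))) / (2 * pi * \<i>)
     = \<phi> (of_real \<delta>)"
    by (simp add: algebra_simps sum_subtractf)
  then show ?thesis
    by (simp add: pairing_def diff_divide_distrib sum_divide_distrib right_diff_distrib)
qed

end

end

section \<open>Total variation along the spectral rays and the uniform bound\<close>

lemma ray_vector_derivative: "((\<lambda>t. of_real t * b) has_vector_derivative (b :: complex)) (at t within S)"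
  by (rule has_vector_derivative_real_field[where f = "\<lambda>z. z * b"]) (auto intro!: derivative_eq_intros)

context dirichlet_resolvent
begin

text \<open>
  \<open>N\<close> is an antiderivative of the majorant \<open>m\<close> of \<open>\<bar>g'\<bar>\<close> on the rays; the constant \<open>bound\<close> depends only on
  \<open>a\<close>, \<open>e\<close> and \<open>C0\<close>, which makes the estimates uniform in the approximating measures.
\<close>

definition c where "c = min (Re e) (- Re (a * e))"
definition B where "B r = (\<Sum>k\<in>K. p k * (1 - exp (- (s k * Re e) * r)))"
definition B' where "B' r = (\<Sum>k\<in>K. p k * (s k * Re e) * exp (- (s k * Re e) * r))"
text \<open>The number \<open>- N 0\<close>, a bound for the integral of \<open>m\<close> since
  \<open>N\<close> has a nonpositive limit. The factor \<delta> in the damping term of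
  \<open>m\<close> is used up by the integration, so \<open>V\<close> does not depend on
  \<delta>.\<close>

definition V where "V = (C0 + C0\<^sup>2) / (Re e * cmod (1 - \<zeta>))"
definition bound where "bound = 2 * Im a / Re a * (2 + (C0 + C0\<^sup>2) / Re e * (2 + 1 / c)) + 4 * ((C0 + C0\<^sup>2) / Re e) / c"
definition f' where "f' z = - (\<Sum>k\<in>K. of_real (p k) * of_real (s k) * exp (- of_real (s k) * z))"
definition g' where "g' z = exp (- of_real \<delta> * z) * (f' z - of_real \<delta> * (\<zeta> - f z)) / (\<zeta> - f z)\<^sup>2"
text \<open>The first summand comes from differentiating the damping factor, the second from
  \<open>f' / (\<zeta> - f)\<^sup>2\<close> after inserting the lower bound for the denominator; the
  latter is a multiple of the derivative of \<open>- 1 / (cmod (1 - \<zeta>) + B r)\<close>.\<close>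

definition m where "m r = \<delta> * C0 / cmod (1 - \<zeta>) * exp (- (\<delta> * Re e) * r)
    + C0\<^sup>2 / Re e * (B' r / (cmod (1 - \<zeta>) + B r)\<^sup>2)"
definition N where "N r = - (C0 / (cmod (1 - \<zeta>) * Re e) * exp (- (\<delta> * Re e) * r))
    - C0\<^sup>2 / Re e / (cmod (1 - \<zeta>) + B r)"

lemma c_pos: "c > 0" using Re_e Re_ae by (simp add: c_def)

lemma v_pos: "cmod (1 - \<zeta>) > 0" using \<zeta> by simp

lemma B_ge: "r \<ge> 0 \<Longrightarrow> B r \<ge> 0"
  unfolding B_def using p s Re_e by (intro sum_nonneg mult_nonneg_nonneg) auto

lemma B'_ge: "r \<ge> 0 \<Longrightarrow> B' r \<ge> 0"
  unfolding B'_def using p s Re_e by (intro sum_nonneg mult_nonneg_nonneg) auto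

lemma B_deriv: "(B has_real_derivative B' r) (at r)"
  unfolding B_def[abs_def] B'_def by (auto intro!: derivative_eq_intros sum.cong)

lemma N_deriv: "r \<ge> 0 \<Longrightarrow> (N has_real_derivative m r) (at r)"
proof -
  assume r: "r \<ge> 0"
  have nz: "cmod (1 - \<zeta>) + B r > 0" "Re e > 0" using add_pos_nonneg[OF v_pos B_ge[OF r]] Re_e by auto
  with v_pos show ?thesis
    unfolding N_def[abs_def] m_def
    by (auto intro!: derivative_eq_intros B_deriv simp: power2_eq_square ac_simps)
qed

lemma N_lim: obtains l where "(N \<longlongrightarrow> l) at_top" "l \<le> 0"
proof -
  have 1: "((\<lambda>r. exp (- x * r)) \<longlongrightarrow> (if x = 0 then 1 else 0)) at_top" if "x \<ge> 0" for x :: real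
  proof (cases "x = 0")
    case False
    with that have "x > 0" by simp
    then have "((\<lambda>r. exp (- x * r)) \<longlongrightarrow> 0) at_top" by real_asymp
    with False show ?thesis by simp
  qed simp
  \<comment> \<open>Atoms at time 0 never decay, so the limit of \<open>B\<close> is the mass away
    from 0. Only its sign enters the estimate.\<close>
  define l where "l = (\<Sum>k\<in>K. p k * (1 - (if s k * Re e = 0 then 1 else 0)))"
  have B: "(B \<longlongrightarrow> l) at_top"
    unfolding B_def[abs_def] l_def by (intro tendsto_intros 1) (use s Re_e in auto)
  have l: "l \<ge> 0" unfolding l_def using p by (intro sum_nonneg) auto
  have 2: "((\<lambda>r. exp (- (\<delta> * Re e) * r)) \<longlongrightarrow> 0) at_top"
    using 1[of "\<delta> * Re e"] \<delta> Re_e by simp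
  have "(N \<longlongrightarrow> - (C0 / (cmod (1 - \<zeta>) * Re e) * 0) - C0\<^sup>2 / Re e / (cmod (1 - \<zeta>) + l)) at_top"
    unfolding N_def[abs_def] using add_pos_nonneg[OF v_pos l] by (intro tendsto_intros B 2) simp
  then show thesis by (rule that) (use v_pos l Re_e C0 in auto)
qed

lemma m_nonneg: "r \<ge> 0 \<Longrightarrow> m r \<ge> 0"
  unfolding m_def using B'_ge[of r] \<delta> C0 Re_e by (intro add_nonneg_nonneg mult_nonneg_nonneg divide_nonneg_nonneg) auto

lemma m_integral: "set_integrable lborel {0..} m" "(LINT r:{0..}|lborel. m r) \<le> V"
proof -
  obtain l where l: "(N \<longlongrightarrow> l) at_top" "l \<le> 0" by (rule N_lim)
  have "continuous_on {0..} B" "continuous_on {0..} B'"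
    unfolding B_def[abs_def] B'_def[abs_def] by (intro continuous_intros)+
  then have cont: "continuous_on {0..} m"
    unfolding m_def[abs_def] using B_ge v_pos by (intro continuous_intros) (auto simp: add_nonneg_eq_0_iff)
  show "set_integrable lborel {0..} m"
    by (rule nonneg_FTC_half_line(1)[OF N_deriv m_nonneg cont l(1)])
  have "(LINT r:{0..}|lborel. m r) = l - N 0"
    by (rule nonneg_FTC_half_line(2)[OF N_deriv m_nonneg cont l(1)])
  also have "\<dots> \<le> - N 0" using l by simp
  also have "\<dots> = V" using v_pos Re_e by (simp add: N_def B_def V_def field_simps)
  finally show "(LINT r:{0..}|lborel. m r) \<le> V" .
qed

lemma f_deriv: "(f has_field_derivative f' z) (at z)"
  unfolding f_def[abs_def] f'_def sum_negf[symmetric]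
  by (auto intro!: derivative_eq_intros sum.cong)

lemma g_ray_deriv:
  assumes "side b d" "r \<ge> 0"
  shows "((\<lambda>r. g (of_real r * d)) has_vector_derivative g' (of_real r * d) * d) (at r)"
proof -
  have nz: "\<zeta> - f (of_real r * d) \<noteq> 0"
    by (rule denominator_nonzero) (use assms side_wedge(2) in auto)
  have "(g has_field_derivative g' (of_real r * d)) (at (of_real r * d))"
    unfolding g_def[abs_def] g'_def using nz
    by (auto intro!: derivative_eq_intros f_deriv simp: power2_eq_square algebra_simps)
  from field_vector_diff_chain_at[where f = "\<lambda>r. of_real r * d" and x = r, OF ray_vector_derivative this]
  show ?thesis by (simp add: o_def mult.commute)
qed

text \<open>The lower bound for \<open>\<zeta> - f\<close> enters twice: squared and with
  \<open>B\<close> in the term containing \<open>f'\<close>, and to first order with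
  \<open>B\<close> dropped in the term containing \<delta>. Since \<open>cmod (exp (- s z))\<close>
  depends on \<open>Re z\<close> alone, \<open>f'\<close> is dominated by
  \<open>B' / Re e\<close>.\<close>

lemma g'_bound:
  assumes bd: "side b d" and r: "r \<ge> 0"
  shows "cmod (g' (of_real r * d) * d) \<le> m r"
proof -
  define z where "z = of_real r * d"
  have z: "z \<in> wedge e" unfolding z_def by (rule side_wedge(2)[OF bd r])
  have Rez: "Re z = r * Re e" using side_facts(2)[OF bd] by (simp add: z_def)
  define h where "h = cmod (\<zeta> - f z)"
  have h: "cmod (1 - \<zeta>) + B r \<le> C0 * h"
    using lower[OF z] by (simp add: h_def f_def B_def Rez ac_simps)
  have hpos: "h > 0" using denominator_nonzero[OF z] by (simp add: h_def)
  have vB: "cmod (1 - \<zeta>) + B r > 0" by (rule add_pos_nonneg[OF v_pos B_ge[OF r]])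
  have hinv: "1 / h \<le> C0 / (cmod (1 - \<zeta>) + B r)" using h hpos vB by (simp add: field_simps)
  also have "\<dots> \<le> C0 / cmod (1 - \<zeta>)" using C0 B_ge[OF r] by (intro divide_left_mono mult_pos_pos vB v_pos) auto
  finally have hinv': "1 / h \<le> C0 / cmod (1 - \<zeta>)" .
  have f': "cmod (f' z) \<le> B' r / Re e"
  proof -
    have "cmod (f' z) \<le> (\<Sum>k\<in>K. cmod (of_real (p k) * of_real (s k) * exp (- of_real (s k) * z)))"
      unfolding f'_def norm_minus_cancel by (rule norm_sum)
    also have "\<dots> = (\<Sum>k\<in>K. p k * s k * exp (- (s k * Re e) * r))"
      using p s by (intro sum.cong) (auto simp: norm_mult Rez ac_simps)
    also have "\<dots> = B' r / Re e"
      using Re_e by (simp add: B'_def sum_divide_distrib mult.assoc)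
    finally show ?thesis .
  qed
  have "cmod (g' z) \<le> exp (- \<delta> * Re z) * (cmod (f' z) + \<delta> * h) / h\<^sup>2"
  proof -
    have "cmod (f' z - of_real \<delta> * (\<zeta> - f z)) \<le> cmod (f' z) + \<delta> * h"
      using norm_triangle_ineq4[of "f' z" "of_real \<delta> * (\<zeta> - f z)"] \<delta> by (simp add: norm_mult h_def)
    then have "exp (- \<delta> * Re z) * cmod (f' z - of_real \<delta> * (\<zeta> - f z)) / h\<^sup>2 \<le> exp (- \<delta> * Re z) * (cmod (f' z) + \<delta> * h) / h\<^sup>2"
      by (intro divide_right_mono mult_left_mono) auto
    then show ?thesis by (simp add: g'_def norm_mult norm_divide norm_power h_def)
  qed
  also have "\<dots> = exp (- \<delta> * Re z) * cmod (f' z) * (1 / h)\<^sup>2 + exp (- \<delta> * Re z) * \<delta> * (1 / h)"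
    using hpos by (simp add: field_simps power2_eq_square)
  also have "\<dots> \<le> 1 * (B' r / Re e) * (C0 / (cmod (1 - \<zeta>) + B r))\<^sup>2 + exp (- (\<delta> * Re e) * r) * \<delta> * (C0 / cmod (1 - \<zeta>))"
  proof (intro add_mono mult_mono power_mono)
    show "exp (- \<delta> * Re z) \<le> 1" using \<delta> r Re_e by (simp add: Rez)
  qed (use f' hinv hinv' hpos \<delta> B'_ge[OF r] Re_e in \<open>auto simp: Rez ac_simps\<close>)
  also have "\<dots> = m r" by (simp add: m_def field_simps)
  finally show ?thesis using side_facts(4)[OF bd] by (simp add: norm_mult z_def)
qed

lemma g'_ray_continuous: "side b d \<Longrightarrow> continuous_on {0..} (\<lambda>r. g' (of_real r * d))"
proof -
  assume bd: "side b d"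
  have "f' holomorphic_on A" for A unfolding f'_def[abs_def] by (intro holomorphic_intros)
  then have "g' holomorphic_on wedge e"
    unfolding g'_def[abs_def] using denominator_nonzero by (intro holomorphic_intros) auto
  then show ?thesis
    by (rule continuous_on_compose2[OF holomorphic_on_imp_continuous_on])
      (auto intro!: continuous_intros side_wedge(2)[OF bd])
qed

lemma g'_ray_integrable:
  assumes bd: "side b d"
  shows "set_integrable lborel {0..} (\<lambda>r. g' (of_real r * d) * d)"
proof (rule set_integrable_bound[OF m_integral(1)])
  show "set_borel_measurable lborel {0..} (\<lambda>r. g' (of_real r * d) * d)"
    by (intro set_borel_measurable_continuous continuous_intros g'_ray_continuous[OF bd]) simp
  show "AE x in lborel. x \<in> {0..} \<longrightarrow> norm (g' (of_real x * d) * d) \<le> norm (m x)"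
    using g'_bound[OF bd] m_nonneg by (intro AE_I2) auto
qed

lemma g'_ray_integral_bound:
  assumes bd: "side b d" and h: "set_integrable lborel {0..} (\<lambda>r. g' (of_real r * d) * d * h r)"
    and H: "\<And>r. r \<ge> 0 \<Longrightarrow> cmod (h r) \<le> H"
  shows "cmod (LINT r:{0..}|lborel. g' (of_real r * d) * d * h r) \<le> V * H"
proof -
  have H0: "H \<ge> 0" using H[of 0] norm_ge_zero[of "h 0"] by linarith
  have "cmod (LINT r:{0..}|lborel. g' (of_real r * d) * d * h r) \<le> (LINT r:{0..}|lborel. cmod (g' (of_real r * d) * d * h r))"
    by (rule set_integral_norm_bound[OF h])
  also have "\<dots> \<le> (LINT r:{0..}|lborel. m r * H)"
  proof (rule set_integral_mono)
    show "set_integrable lborel {0..} (\<lambda>r. cmod (g' (of_real r * d) * d * h r))" by (rule set_integrable_norm[OF h])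
    show "set_integrable lborel {0..} (\<lambda>r. m r * H)" using m_integral(1) by simp
    fix r :: real assume "r \<in> {0..}"
    then have r: "r \<ge> 0" by simp
    show "cmod (g' (of_real r * d) * d * h r) \<le> m r * H"
      unfolding norm_mult[of _ "h r"] by (intro mult_mono g'_bound[OF bd r] H r m_nonneg) simp
  qed
  also have "\<dots> = (LINT r:{0..}|lborel. m r) * H" by simp
  also have "\<dots> \<le> V * H" using m_integral(2) H0 by (rule mult_right_mono)
  finally show ?thesis .
qed

lemma exp_times_g'_integrable:
  assumes bd: "side b d" and w: "Re (w * d) \<le> 0"
  shows "set_integrable lborel {0..} (\<lambda>r. g' (of_real r * d) * d * exp (w * (of_real r * d)))"
  by (intro set_integrable_mult_exp g'_ray_integrable[OF bd] continuous_intros g'_ray_continuous[OF bd] w)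

text \<open>The boundary term at infinity is removed by the damping, and at the vertex
  \<open>f 0 = 1\<close> because the weights sum to 1. What remains involves only \<open>g'\<close>,
  so \<open>w * G d w\<close> is bounded uniformly in \<delta>.\<close>

lemma G_by_parts:
  assumes bd: "side b d" and w: "Re (w * d) \<le> 0"
  shows "w * G d w = - (1 / (\<zeta> - 1)) - (LINT r:{0..}|lborel. g' (of_real r * d) * d * exp (w * (of_real r * d)))"
proof -
  have i1: "set_integrable lborel {0..} (\<lambda>r. g' (of_real r * d) * d * exp (w * (of_real r * d)))"
    by (rule exp_times_g'_integrable[OF bd w])
  have i2: "set_integrable lborel {0..} (\<lambda>r. g (of_real r * d) * d * exp (w * (of_real r * d)))"
    by (intro set_integrable_mult_exp g_ray_integrable[OF bd] continuous_intros g_ray_continuous[OF bd] w)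
  define H where "H r = g (of_real r * d) * exp (w * (of_real r * d))" for r
  define h where "h r = g' (of_real r * d) * d * exp (w * (of_real r * d)) + w * (g (of_real r * d) * d * exp (w * (of_real r * d)))" for r
  have "(LINT r:{0..}|lborel. h r) = 0 - H 0"
  proof (rule set_integral_FTC_half_line)
    fix r :: real assume r: "r \<ge> 0"
    have "((\<lambda>r. exp (w * (of_real r * d))) has_vector_derivative w * d * exp (w * (of_real r * d))) (at r)"
      by (rule has_vector_derivative_eq_rhs, rule has_vector_derivative_real_field) (auto intro!: derivative_eq_intros)
    from has_vector_derivative_mult[OF g_ray_deriv[OF bd r] this]
    show "(H has_vector_derivative h r) (at r)"
      by (simp add: H_def[abs_def] h_def ac_simps)
  next
    show "set_integrable lborel {0..} h"
      unfolding h_def[abs_def] using i1 i2 by (intro set_integral_add(1)) auto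
    show "(H \<longlongrightarrow> 0) at_top"
    proof (rule Lim_null_comparison)
      show "\<forall>\<^sub>F r in at_top. norm (H r) \<le> C0 / cmod (1 - \<zeta>) * exp (- (\<delta> * Re e) * r)"
        using eventually_ge_at_top[of "0::real"]
      proof eventually_elim
        case (elim r)
        have "cmod (g (of_real r * d)) \<le> C0 / cmod (1 - \<zeta>) * exp (- (\<delta> * Re e) * r)"
          using g_bound[OF side_wedge(2)[OF bd elim]] side_facts(2)[OF bd] by (simp add: ac_simps)
        then show ?case
          unfolding H_def by (rule order_trans[OF norm_mult_exp_le[OF w elim]])
      qed
      have "((\<lambda>r. exp (- x * r)) \<longlongrightarrow> 0) at_top" if "x > 0" for x :: real using that by real_asymp
      from tendsto_mult_right_zero[OF this, of "\<delta> * Re e" "C0 / cmod (1 - \<zeta>)"]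
      show "((\<lambda>r. C0 / cmod (1 - \<zeta>) * exp (- (\<delta> * Re e) * r)) \<longlongrightarrow> 0) at_top"
        using \<delta> Re_e by simp
    qed
  qed
  moreover have "H 0 = 1 / (\<zeta> - 1)"
    using sum_p by (simp add: H_def g_def f_def flip: of_real_sum)
  moreover have "(LINT r:{0..}|lborel. h r) =
     (LINT r:{0..}|lborel. g' (of_real r * d) * d * exp (w * (of_real r * d))) + w * G d w"
    unfolding h_def[abs_def] G_def using i1 i2 by (subst set_integral_add(2)) auto
  ultimately show ?thesis by (simp add: algebra_simps)
qed

text \<open>
  \<open>- \<kappa> t\<close> is \<open>w G(w)\<close> at \<open>w = - t\<close>, where both choices of the spectral ray give the same value; \<open>Y\<close>
  is the error made when it replaces \<open>- w G(w)\<close> on a time ray, and is integrable against \<open>dt / t\<close>.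
\<close>

definition Y where "Y b d t = (LINT r:{0..}|lborel. g' (of_real r * d) * d *
    (exp (of_real t * b * (of_real r * d)) - exp (- of_real t * (of_real r * d))))"

definition \<kappa> where "\<kappa> t = 1 / (\<zeta> - 1) + (LINT r:{0..}|lborel. g' (of_real r * e) * e * exp (- of_real t * (of_real r * e)))"

text \<open>The constant \<open>c\<close> is the smaller of the two decay rates, along the time ray
  and at \<open>w = - t\<close>, so that one exponential dominates both terms of the kernel of
  \<open>Y\<close>.\<close>

lemma side_Re:
  assumes bd: "side b d" and "t \<ge> 0"
  shows "Re (of_real t * b * d) \<le> - c * t" "Re (- of_real t * d) \<le> - c * t"
proof -
  have "Re (of_real t * b * d) = t * Re (b * d)" by (simp add: algebra_simps)
  also have "\<dots> \<le> t * (- c)"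
    using assms(2) unfolding side_facts(5)[OF bd] by (intro mult_left_mono) (auto simp: c_def)
  also have "t * (- c) = - c * t" by simp
  finally show "Re (of_real t * b * d) \<le> - c * t" .
  have "t * c \<le> t * Re e" using assms(2) by (intro mult_left_mono) (auto simp: c_def)
  then show "Re (- of_real t * d) \<le> - c * t" using side_facts(2)[OF bd] by (simp add: ac_simps)
qed

lemma G_decomposition:
  assumes bd: "side b d" and t: "t > 0"
  shows "b * G d (of_real t * b) = - (\<kappa> t + Y b d t) / of_real t"
proof -
  have se: "side a e" by (simp add: side_def)
  have r1: "Re (of_real t * b * d) \<le> 0" and r2: "Re (- of_real t * d) \<le> 0" and r3: "Re (- of_real t * e) \<le> 0"
    using side_Re[OF bd, of t] side_Re[OF se, of t] t c_pos mult_pos_pos[OF c_pos t] by linarith+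
  \<comment> \<open>\<open>\<kappa>\<close> is defined with the ray \<open>e\<close>; rotating the
    contour at \<open>w = - t\<close> makes it available for \<open>cnj e\<close> as well.\<close>
  have G: "G d (- of_real t) = G e (- of_real t)"
    using G_cnj[of t] t side_facts(9)[OF bd] by auto
  have "- of_real t * G d (- of_real t) = - \<kappa> t"
    unfolding G G_by_parts[OF se r3] \<kappa>_def by simp
  then have "- \<kappa> t = - (1 / (\<zeta> - 1)) - (LINT r:{0..}|lborel. g' (of_real r * d) * d * exp (- of_real t * (of_real r * d)))"
    unfolding G_by_parts[OF bd r2] by (rule sym)
  moreover have "x = y + z" if "- x = - y - z" for x y z :: complex
  proof -
    have "x = - (- y - z)" unfolding that[symmetric] by simp
    then show ?thesis by simp
  qed
  ultimately have k: "\<kappa> t = 1 / (\<zeta> - 1) + (LINT r:{0..}|lborel. g' (of_real r * d) * d * exp (- of_real t * (of_real r * d)))"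
    by blast
  have "Y b d t = (LINT r:{0..}|lborel. g' (of_real r * d) * d * exp (of_real t * b * (of_real r * d)))
      - (LINT r:{0..}|lborel. g' (of_real r * d) * d * exp (- of_real t * (of_real r * d)))"
    unfolding Y_def right_diff_distrib
    by (rule set_integral_diff(2)[OF exp_times_g'_integrable[OF bd r1] exp_times_g'_integrable[OF bd r2]])
  with k G_by_parts[OF bd r1] have "of_real t * b * G d (of_real t * b) = - (\<kappa> t + Y b d t)"
    by simp
  then show ?thesis using t by (simp add: field_simps)
qed

text \<open>By scale invariance of the integral of \<open>r * exp (- c * t * r)\<close> in
  \<open>t\<close> the bound is free of \<open>r\<close> and of both truncation points.\<close>

lemma exp_decay_integral_le:
  assumes "0 < \<eta>" "\<eta> \<le> L" "r \<ge> 0"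
  shows "(LINT t:{\<eta>..L}|lborel. r * exp (- c * t * r)) \<le> 1 / c"
proof -
  have "(LINT t:{\<eta>..L}|lborel. r * exp (- c * t * r)) = - exp (- c * L * r) / c - (- exp (- c * \<eta> * r) / c)"
  proof (rule set_integral_FTC_Icc[OF assms(2)])
    show "((\<lambda>t. - exp (- c * t * r) / c) has_vector_derivative r * exp (- c * t * r)) (at t within {\<eta>..L})" for t
      unfolding has_real_derivative_iff_has_vector_derivative[symmetric]
      using c_pos by (auto intro!: derivative_eq_intros)
    show "set_integrable lborel {\<eta>..L} (\<lambda>t. r * exp (- c * t * r))"
      by (intro borel_integrable_atLeastAtMost' continuous_intros)
  qed
  also have "\<dots> \<le> exp (- c * \<eta> * r) / c" using c_pos by simp
  also have "\<dots> \<le> 1 / c" using c_pos assms by (intro divide_right_mono) auto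
  finally show ?thesis .
qed

context
  fixes \<phi> :: "complex \<Rightarrow> complex" and M :: real and \<eta> L :: real
  assumes \<phi>: "\<phi> holomorphic_on wedge a" and \<phi>_le: "\<And>w. w \<in> wedge a \<Longrightarrow> cmod (\<phi> w) \<le> M"
    and \<eta>: "0 < \<eta>" "\<eta> \<le> L"
begin

lemma M_nonneg: "M \<ge> 0"
  using order_trans[OF norm_ge_zero \<phi>_le[of 0]] by (simp add: wedge_def)

lemma \<phi>_continuous: "side b d \<Longrightarrow> continuous_on {\<eta>..L} (\<lambda>t. \<phi> (of_real t * b))"
  by (rule continuous_on_compose2[OF holomorphic_on_imp_continuous_on[OF \<phi>]])
    (use \<eta> in \<open>auto intro!: continuous_intros side_wedge(1)\<close>)

text \<open>The kernel of \<open>Y\<close> vanishes to first order in \<open>t * r\<close> and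
  decays exponentially in \<open>t * r\<close>. The first property cancels the factor 1 / t, the
  second makes the time integral bounded uniformly in \<open>r\<close>; the variation bound does the
  rest.\<close>

lemma Y_part:
  assumes bd: "side b d"
  shows "cmod (LINT t:{\<eta>..L}|lborel. \<phi> (of_real t * b) / of_real t * Y b d t) \<le> V * (2 * M / c)"
    and "set_integrable lborel {\<eta>..L} (\<lambda>t. \<phi> (of_real t * b) / of_real t * Y b d t)"
proof -
  define k where "k r t = (exp (of_real t * b * (of_real r * d)) - exp (- of_real t * (of_real r * d)))" for r t :: real
  have k: "cmod (k r t) \<le> 2 * (t * r) * exp (- c * t * r)" if "r \<ge> 0" "t \<ge> 0" for r t
  proof -
    have "Re (of_real t * b * (of_real r * d)) = r * Re (of_real t * b * d)" by (simp add: algebra_simps)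
    also have "\<dots> \<le> r * (- c * t)" using side_Re(1)[OF bd that(2)] that by (intro mult_left_mono)
    finally have 1: "Re (of_real t * b * (of_real r * d)) \<le> - c * t * r" by (simp add: ac_simps)
    have "Re (- of_real t * (of_real r * d)) = r * Re (- of_real t * d)" by (simp add: algebra_simps)
    also have "\<dots> \<le> r * (- c * t)" using side_Re(2)[OF bd that(2)] that by (intro mult_left_mono)
    finally have 2: "Re (- of_real t * (of_real r * d)) \<le> - c * t * r" by (simp add: ac_simps)
    have "of_real t * b * (of_real r * d) - - of_real t * (of_real r * d) = of_real (t * r) * (d * (b + 1))"
      by (simp add: algebra_simps)
    then have "cmod (of_real t * b * (of_real r * d) - - of_real t * (of_real r * d)) = t * r * cmod (b + 1)"
      using that side_facts(4)[OF bd] by (simp add: norm_mult)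
    also have "\<dots> \<le> t * r * 2"
      using that norm_triangle_ineq[of b 1] side_facts(3)[OF bd] by (intro mult_left_mono) auto
    finally have "exp (- c * t * r) * cmod (of_real t * b * (of_real r * d) - - of_real t * (of_real r * d)) \<le> exp (- c * t * r) * (t * r * 2)"
      by (intro mult_left_mono) auto
    from order_trans[OF norm_exp_diff_le[OF 1 2] this] show ?thesis
      unfolding k_def by (simp only: ac_simps)
  qed
  \<comment> \<open>The kernel is halved because Fubini is stated for kernels bounded by 1; the
    factor 2 moves to \<phi>.\<close>
  have k2: "cmod (k r t / 2) \<le> 1" if "r \<in> {0..}" "t \<in> {\<eta>..L}" for r t
  proof -
    have "cmod (exp (of_real t * b * (of_real r * d))) \<le> 1" using that \<eta> by (intro kernel_bound[OF bd]) auto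
    moreover have "cmod (exp (- of_real t * (of_real r * d))) \<le> 1"
      using that \<eta> side_facts(2)[OF bd] Re_e by simp
    ultimately have "cmod (k r t) \<le> 2"
      unfolding k_def using norm_triangle_ineq4[of "exp (of_real t * b * (of_real r * d))" "exp (- of_real t * (of_real r * d))"] by linarith
    then show ?thesis by simp
  qed
  have meas: "(\<lambda>x. k (fst x) (snd x) / 2) \<in> borel_measurable (borel :: (real \<times> real) measure)"
    unfolding k_def by (intro borel_measurable_continuous_onI continuous_intros) auto
  have i\<phi>: "set_integrable lborel {\<eta>..L} (\<lambda>t. 2 * (\<phi> (of_real t * b) / of_real t))"
    using \<eta> by (intro borel_integrable_atLeastAtMost' continuous_intros \<phi>_continuous[OF bd]) auto
  note fub = fubini_dominated[OF g'_ray_integrable[OF bd] i\<phi> meas k2]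
  have e1: "(\<lambda>t. 2 * (\<phi> (of_real t * b) / of_real t) * (LINT r:{0..}|lborel. g' (of_real r * d) * d * (k r t / 2)))
       = (\<lambda>t. \<phi> (of_real t * b) / of_real t * Y b d t)"
    by (simp add: Y_def k_def)
  show "set_integrable lborel {\<eta>..L} (\<lambda>t. \<phi> (of_real t * b) / of_real t * Y b d t)"
    using fub(3) unfolding e1 .
  have "(LINT t:{\<eta>..L}|lborel. \<phi> (of_real t * b) / of_real t * Y b d t) =
     (LINT r:{0..}|lborel. g' (of_real r * d) * d * (LINT t:{\<eta>..L}|lborel. 2 * (\<phi> (of_real t * b) / of_real t) * (k r t / 2)))"
    unfolding e1[symmetric] using fub(1) by simp
  also have "cmod \<dots> \<le> V * (2 * M / c)"
  proof (rule g'_ray_integral_bound[OF bd fub(2)])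
    fix r :: real assume r: "r \<ge> 0"
    have kc: "continuous_on {\<eta>..L} (k r)" unfolding k_def[abs_def] by (intro continuous_intros)
    have int: "set_integrable lborel {\<eta>..L} (\<lambda>t. 2 * (\<phi> (of_real t * b) / of_real t) * (k r t / 2))"
      using \<eta> by (intro borel_integrable_atLeastAtMost' continuous_intros \<phi>_continuous[OF bd] kc) auto
    have "cmod (LINT t:{\<eta>..L}|lborel. 2 * (\<phi> (of_real t * b) / of_real t) * (k r t / 2)) \<le>
      (LINT t:{\<eta>..L}|lborel. cmod (2 * (\<phi> (of_real t * b) / of_real t) * (k r t / 2)))"
      by (rule set_integral_norm_bound[OF int])
    also have "\<dots> \<le> (LINT t:{\<eta>..L}|lborel. 2 * M * (r * exp (- c * t * r)))"
    proof (rule set_integral_mono[OF set_integrable_norm[OF int]])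
      show "set_integrable lborel {\<eta>..L} (\<lambda>t. 2 * M * (r * exp (- c * t * r)))"
        by (intro borel_integrable_atLeastAtMost' continuous_intros)
      fix t assume t: "t \<in> {\<eta>..L}"
      then have tp: "t > 0" using \<eta> by auto
      have "cmod (\<phi> (of_real t * b)) * cmod (k r t) \<le> M * (2 * (t * r) * exp (- c * t * r))"
        using tp r by (intro mult_mono \<phi>_le k side_wedge(1)[OF bd] M_nonneg) auto
      then show "cmod (2 * (\<phi> (of_real t * b) / of_real t) * (k r t / 2)) \<le> 2 * M * (r * exp (- c * t * r))"
        using tp by (simp add: norm_mult norm_divide field_simps)
    qed
    also have "\<dots> = 2 * M * (LINT t:{\<eta>..L}|lborel. r * exp (- c * t * r))" by simp
    also have "\<dots> \<le> 2 * M * (1 / c)"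
      using M_nonneg by (intro mult_left_mono exp_decay_integral_le \<eta> r) auto
    finally show "cmod (LINT t:{\<eta>..L}|lborel. 2 * (\<phi> (of_real t * b) / of_real t) * (k r t / 2)) \<le> 2 * M / c" by simp
  qed
  finally show "cmod (LINT t:{\<eta>..L}|lborel. \<phi> (of_real t * b) / of_real t * Y b d t) \<le> V * (2 * M / c)" .
qed

text \<open>
  The difference of \<open>\<phi>\<close> on the two time rays, divided by \<open>t\<close>, is the derivative of a bounded function: the
  integral of \<open>\<phi> w / w\<close> over the chord joining the rays.
\<close>

lemma primitive_difference:
  obtains D where "\<And>t. t > 0 \<Longrightarrow> (D has_vector_derivative (\<phi> (of_real t * a) - \<phi> (of_real t * cnj a)) / of_real t) (at t within {0<..})"
    "\<And>t. t > 0 \<Longrightarrow> cmod (D t) \<le> 2 * M * Im a / Re a"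
proof -
  \<comment> \<open>The half-plane removes the vertex, where \<open>\<phi> w / w\<close> may be
    singular, and keeps the set convex, so that a primitive exists.\<close>
  define S where "S = wedge a \<inter> {w. Re w > 0}"
  have S: "convex S" unfolding S_def by (intro convex_Int convex_wedge Re_a convex_halfspace_Re_gt)
  have hol: "(\<lambda>w. \<phi> w / w) holomorphic_on S"
    by (intro holomorphic_intros holomorphic_on_subset[OF \<phi>]) (auto simp: S_def)
  obtain \<Theta> where \<Theta>: "\<And>x. x \<in> S \<Longrightarrow> (\<Theta> has_field_derivative \<phi> x / x) (at x within S)"
  proof (rule holomorphic_convex_primitive[OF S finite.emptyI holomorphic_on_imp_continuous_on[OF hol]])
    fix x assume "x \<in> interior S - {}"
    then show "(\<lambda>w. \<phi> w / w) field_differentiable at x"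
      using holomorphic_on_subset[OF hol interior_subset]
      by (auto intro: holomorphic_on_imp_differentiable_at[OF _ open_interior])
  qed blast
  have ray: "of_real t * b \<in> S" if "t > 0" "side b d" for t b d
    using side_wedge(1)[OF that(2), of t] that side_facts(1)[OF that(2)] Re_a by (auto simp: S_def)
  have sides: "side a e" "side (cnj a) (cnj e)" by (auto simp: side_def)
  define D where "D t = \<Theta> (of_real t * a) - \<Theta> (of_real t * cnj a)" for t :: real
  have dt: "((\<lambda>t. \<Theta> (of_real t * b)) has_vector_derivative \<phi> (of_real t * b) / of_real t) (at t within {0<..})"
    if t: "t > 0" and bd: "side b d" for t b d
  proof -
    have "(\<Theta> has_field_derivative \<phi> (of_real t * b) / (of_real t * b)) (at (of_real t * b) within (\<lambda>t. of_real t * b) ` {0<..})"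
      using ray[OF _ bd] by (intro has_field_derivative_subset[OF \<Theta>[OF ray[OF t bd]]]) auto
    from field_vector_diff_chain_within[OF ray_vector_derivative this]
    have "((\<Theta> \<circ> (\<lambda>t. of_real t * b)) has_vector_derivative b * (\<phi> (of_real t * b) / (of_real t * b))) (at t within {0<..})" .
    moreover have "b \<noteq> 0" using side_facts(3)[OF bd] by auto
    ultimately show ?thesis using t by (simp add: o_def)
  qed
  show thesis
  proof (rule that[of D])
    fix t :: real assume t: "t > 0"
    show "(D has_vector_derivative (\<phi> (of_real t * a) - \<phi> (of_real t * cnj a)) / of_real t) (at t within {0<..})"
      unfolding D_def[abs_def] diff_divide_distrib
      by (intro has_vector_derivative_diff dt[OF t sides(1)] dt[OF t sides(2)])
    let ?C = "closed_segment (of_real t * a) (of_real t * cnj a)"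
    have CS: "?C \<subseteq> S" by (intro closed_segment_subset S ray[OF t sides(1)] ray[OF t sides(2)])
    \<comment> \<open>On the chord at height \<open>t\<close> the derivative is at most
      \<open>M / (t * Re a)\<close> and the length is \<open>2 * t * Im a\<close>: the factors
      \<open>t\<close> cancel and the bound is uniform.\<close>
    have "cmod (\<Theta> (of_real t * a) - \<Theta> (of_real t * cnj a)) \<le> M / (t * Re a) * cmod (of_real t * a - of_real t * cnj a)"
    proof (rule field_differentiable_bound[of ?C])
      fix z assume z: "z \<in> ?C"
      show "(\<Theta> has_field_derivative \<phi> z / z) (at z within ?C)"
        using z CS by (intro has_field_derivative_subset[OF \<Theta>]) auto
      have "Re z = t * Re a" by (rule Re_closed_segment_eq[OF z]) auto
      then have "t * Re a \<le> cmod z" using complex_Re_le_cmod[of z] by simp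
      moreover have "cmod (\<phi> z) \<le> M" using z CS by (intro \<phi>_le) (auto simp: S_def)
      ultimately show "cmod (\<phi> z / z) \<le> M / (t * Re a)"
        unfolding norm_divide using t Re_a M_nonneg by (intro frac_le) auto
    qed auto
    also have "cmod (of_real t * a - of_real t * cnj a) = t * (2 * Im a)"
    proof -
      have "of_real t * a - of_real t * cnj a = of_real (t * (2 * Im a)) * \<i>"
        by (simp add: complex_eq_iff)
      then show ?thesis using t Im_a by (simp only: norm_mult norm_of_real norm_ii) simp
    qed
    also have "M / (t * Re a) * (t * (2 * Im a)) = 2 * M * Im a / Re a" using t by simp
    finally show "cmod (D t) \<le> 2 * M * Im a / Re a" by (simp add: D_def)
  qed
qed

text \<open>Integrating by parts in \<open>t\<close> with the bounded primitive \<open>D\<close>.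
  The constant part of \<open>\<kappa>\<close> leaves \<open>D L - D \<eta>\<close>, whence the 2
  over \<open>cmod (1 - \<zeta>)\<close>. In the exponential part the boundary terms give the 2
  beside \<open>1 / c\<close>, and the derivative of the exponential gives
  \<open>1 / c\<close>.\<close>

lemma \<kappa>_part:
  shows "cmod (LINT t:{\<eta>..L}|lborel. (\<phi> (of_real t * a) - \<phi> (of_real t * cnj a)) / of_real t * \<kappa> t)
    \<le> 2 * M * Im a / Re a * (2 / cmod (1 - \<zeta>) + V * (2 + 1 / c))"
    and "set_integrable lborel {\<eta>..L} (\<lambda>t. (\<phi> (of_real t * a) - \<phi> (of_real t * cnj a)) / of_real t * \<kappa> t)"
proof -
  obtain D where D: "\<And>t. t > 0 \<Longrightarrow> (D has_vector_derivative (\<phi> (of_real t * a) - \<phi> (of_real t * cnj a)) / of_real t) (at t within {0<..})"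
    and Dle: "\<And>t. t > 0 \<Longrightarrow> cmod (D t) \<le> 2 * M * Im a / Re a" by (rule primitive_difference) blast
  define D' where "D' t = (\<phi> (of_real t * a) - \<phi> (of_real t * cnj a)) / of_real t" for t :: real
  define U where "U = 2 * M * Im a / Re a"
  have U: "U \<ge> 0" using M_nonneg Im_a Re_a by (simp add: U_def)
  have sides: "side a e" "side (cnj a) (cnj e)" by (auto simp: side_def)
  have D'c: "continuous_on {\<eta>..L} D'"
    unfolding D'_def[abs_def] using \<eta> by (intro continuous_intros \<phi>_continuous[OF sides(1)] \<phi>_continuous[OF sides(2)]) auto
  have D'i: "set_integrable lborel {\<eta>..L} D'" by (rule borel_integrable_atLeastAtMost'[OF D'c])
  have DD: "(D has_vector_derivative D' t) (at t within {\<eta>..L})" if "t \<in> {\<eta>..L}" for t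
    unfolding D'_def using that \<eta> by (intro has_vector_derivative_within_subset[OF D]) auto
  have Dc: "continuous_on {\<eta>..L} D"
    using DD has_vector_derivative_continuous continuous_on_eq_continuous_within by blast
  have DU: "cmod (D t) \<le> U" if "t \<ge> \<eta>" for t using Dle[of t] that \<eta> by (simp add: U_def)
  have k: "cmod (exp (- of_real t * (of_real r * e))) \<le> exp (- c * t * r)" if "r \<ge> 0" "t \<ge> 0" for r t
  proof -
    have "Re (- of_real t * (of_real r * e)) = r * Re (- of_real t * e)" by (simp add: algebra_simps)
    also have "\<dots> \<le> r * (- c * t)" using side_Re(2)[OF sides(1) that(2)] that by (intro mult_left_mono)
    finally have "Re (- of_real t * (of_real r * e)) \<le> - c * t * r" by (simp add: ac_simps)
    then show ?thesis by (simp only: norm_exp_eq_Re exp_le_cancel_iff)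
  qed
  have k1: "exp (- c * t * r) \<le> 1" if "r \<ge> 0" "t \<ge> 0" for r t using that c_pos by simp
  have k': "cmod (exp (- of_real t * (of_real r * e))) \<le> 1" if "r \<in> {0..}" "t \<in> {\<eta>..L}" for r t
    using that \<eta> by (intro order_trans[OF k k1]) auto
  have meas: "(\<lambda>x. exp (- of_real (snd x) * (of_real (fst x) * e))) \<in> borel_measurable (borel :: (real \<times> real) measure)"
    by (intro borel_measurable_continuous_onI continuous_intros)
  note fub = fubini_dominated[OF g'_ray_integrable[OF sides(1)] D'i meas k']
  have eq: "D' t * \<kappa> t = 1 / (\<zeta> - 1) * D' t + D' t * (LINT r:{0..}|lborel. g' (of_real r * e) * e * exp (- of_real t * (of_real r * e)))" for t
    by (simp add: \<kappa>_def algebra_simps)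
  have i1: "set_integrable lborel {\<eta>..L} (\<lambda>t. 1 / (\<zeta> - 1) * D' t)" using D'i by simp
  have int: "set_integrable lborel {\<eta>..L} (\<lambda>t. D' t * \<kappa> t)"
    unfolding eq by (intro set_integral_add(1) i1 fub(3))
  then show "set_integrable lborel {\<eta>..L} (\<lambda>t. (\<phi> (of_real t * a) - \<phi> (of_real t * cnj a)) / of_real t * \<kappa> t)"
    unfolding D'_def .
  have "(LINT t:{\<eta>..L}|lborel. D' t * \<kappa> t) = (LINT t:{\<eta>..L}|lborel. 1 / (\<zeta> - 1) * D' t) +
      (LINT t:{\<eta>..L}|lborel. D' t * (LINT r:{0..}|lborel. g' (of_real r * e) * e * exp (- of_real t * (of_real r * e))))"
    unfolding eq by (rule set_integral_add(2)[OF i1 fub(3)])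
  also have "(LINT t:{\<eta>..L}|lborel. 1 / (\<zeta> - 1) * D' t) = 1 / (\<zeta> - 1) * (LINT t:{\<eta>..L}|lborel. D' t)"
    by (rule set_integral_mult_right)
  also have "(LINT t:{\<eta>..L}|lborel. D' t * (LINT r:{0..}|lborel. g' (of_real r * e) * e * exp (- of_real t * (of_real r * e)))) =
      (LINT r:{0..}|lborel. g' (of_real r * e) * e * (LINT t:{\<eta>..L}|lborel. D' t * exp (- of_real t * (of_real r * e))))"
    by (rule fub(1)[symmetric])
  finally have I: "(LINT t:{\<eta>..L}|lborel. D' t * \<kappa> t) = 1 / (\<zeta> - 1) * (LINT t:{\<eta>..L}|lborel. D' t) +
      (LINT r:{0..}|lborel. g' (of_real r * e) * e * (LINT t:{\<eta>..L}|lborel. D' t * exp (- of_real t * (of_real r * e))))" .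
  have "cmod (LINT t:{\<eta>..L}|lborel. D' t * \<kappa> t) \<le> 2 * U / cmod (1 - \<zeta>) + V * (U * (2 + 1 / c))"
    unfolding I
  proof (intro norm_triangle_le add_mono)
    have "(LINT t:{\<eta>..L}|lborel. D' t) = D L - D \<eta>"
      by (rule set_integral_FTC_Icc[OF \<eta>(2) DD D'i]) auto
    also have "cmod \<dots> \<le> 2 * U"
      using norm_triangle_ineq4[of "D L" "D \<eta>"] DU[of L] DU[of \<eta>] \<eta> by simp
    finally have "cmod (LINT t:{\<eta>..L}|lborel. D' t) / cmod (\<zeta> - 1) \<le> 2 * U / cmod (\<zeta> - 1)"
      by (intro divide_right_mono) auto
    then show "cmod (1 / (\<zeta> - 1) * (LINT t:{\<eta>..L}|lborel. D' t)) \<le> 2 * U / cmod (1 - \<zeta>)"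
      by (simp add: norm_mult norm_divide norm_minus_commute[of \<zeta> 1])
    show "cmod (LINT r:{0..}|lborel. g' (of_real r * e) * e * (LINT t:{\<eta>..L}|lborel. D' t * exp (- of_real t * (of_real r * e)))) \<le> V * (U * (2 + 1 / c))"
    proof (rule g'_ray_integral_bound[OF sides(1) fub(2)])
      fix r :: real assume r: "r \<ge> 0"
      define E where "E t = exp (- of_real t * (of_real r * e))" for t :: real
      have Ec: "continuous_on {\<eta>..L} E" unfolding E_def[abs_def] by (intro continuous_intros)
      have E1: "cmod (E t) \<le> 1" if "t \<ge> 0" for t using k[OF r that] k1[OF r that] by (simp add: E_def)
      have EE: "(E has_vector_derivative - (of_real r * e) * E t) (at t within {\<eta>..L})" for t
        unfolding E_def[abs_def]
        by (rule has_vector_derivative_eq_rhs, rule has_vector_derivative_real_field) (auto intro!: derivative_eq_intros)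
      have i2: "set_integrable lborel {\<eta>..L} (\<lambda>t. D' t * E t)"
        by (intro borel_integrable_atLeastAtMost' continuous_intros D'c Ec)
      have i3: "set_integrable lborel {\<eta>..L} (\<lambda>t. of_real r * e * (D t * E t))"
        by (intro borel_integrable_atLeastAtMost' continuous_intros Dc Ec)
      have "(LINT t:{\<eta>..L}|lborel. D' t * E t - of_real r * e * (D t * E t)) = D L * E L - D \<eta> * E \<eta>"
      proof (rule set_integral_FTC_Icc[OF \<eta>(2)])
        fix t assume "\<eta> \<le> t" "t \<le> L"
        then have "(D has_vector_derivative D' t) (at t within {\<eta>..L})" by (intro DD) simp
        from has_vector_derivative_mult[OF this EE]
        show "((\<lambda>t. D t * E t) has_vector_derivative D' t * E t - of_real r * e * (D t * E t)) (at t within {\<eta>..L})"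
          by (simp add: algebra_simps)
      qed (intro set_integral_diff(1) i2 i3)
      then have "(LINT t:{\<eta>..L}|lborel. D' t * E t) = D L * E L - D \<eta> * E \<eta> + (LINT t:{\<eta>..L}|lborel. of_real r * e * (D t * E t))"
        unfolding set_integral_diff(2)[OF i2 i3] by (simp add: algebra_simps)
      also have "cmod \<dots> \<le> (U + U) + U * (1 / c)"
      proof (intro norm_triangle_le add_mono)
        have le: "cmod (D t * E t) \<le> U" if "t \<ge> \<eta>" for t
          using mult_mono[OF DU[OF that] E1[of t]] that \<eta> U by (simp add: norm_mult)
        show "cmod (D L * E L - D \<eta> * E \<eta>) \<le> U + U"
          using norm_triangle_ineq4[of "D L * E L" "D \<eta> * E \<eta>"] le[of L] le[of \<eta>] \<eta> by simp
        have "cmod (LINT t:{\<eta>..L}|lborel. of_real r * e * (D t * E t)) \<le> (LINT t:{\<eta>..L}|lborel. cmod (of_real r * e * (D t * E t)))"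
          by (rule set_integral_norm_bound[OF i3])
        also have "\<dots> \<le> (LINT t:{\<eta>..L}|lborel. U * (r * exp (- c * t * r)))"
        proof (rule set_integral_mono[OF set_integrable_norm[OF i3]])
          show "set_integrable lborel {\<eta>..L} (\<lambda>t. U * (r * exp (- c * t * r)))"
            by (intro borel_integrable_atLeastAtMost' continuous_intros)
          fix t assume t: "t \<in> {\<eta>..L}"
          have "cmod (D t) * cmod (E t) \<le> U * exp (- c * t * r)"
            using t \<eta> k[OF r, of t] U by (intro mult_mono DU) (auto simp: E_def)
          then have "r * (cmod (D t) * cmod (E t)) \<le> r * (U * exp (- c * t * r))" using r by (rule mult_left_mono)
          then show "cmod (of_real r * e * (D t * E t)) \<le> U * (r * exp (- c * t * r))"
            using r by (simp add: norm_mult norm_e ac_simps)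
        qed
        also have "\<dots> = U * (LINT t:{\<eta>..L}|lborel. r * exp (- c * t * r))" by simp
        also have "\<dots> \<le> U * (1 / c)" using U by (intro mult_left_mono exp_decay_integral_le \<eta> r)
        finally show "cmod (LINT t:{\<eta>..L}|lborel. of_real r * e * (D t * E t)) \<le> U * (1 / c)" .
      qed
      finally show "cmod (LINT t:{\<eta>..L}|lborel. D' t * exp (- of_real t * (of_real r * e))) \<le> U * (2 + 1 / c)"
        by (simp add: E_def algebra_simps)
    qed
  qed
  also have "\<dots> = U * (2 / cmod (1 - \<zeta>) + V * (2 + 1 / c))" by (simp add: algebra_simps)
  finally show "cmod (LINT t:{\<eta>..L}|lborel. (\<phi> (of_real t * a) - \<phi> (of_real t * cnj a)) / of_real t * \<kappa> t)
    \<le> 2 * M * Im a / Re a * (2 / cmod (1 - \<zeta>) + V * (2 + 1 / c))"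
    unfolding D'_def U_def .
qed

lemma truncated_pairing_bound:
  "cmod (LINT t:{\<eta>..L}|lborel. \<phi> (of_real t * a) * a * G e (of_real t * a)
      - \<phi> (of_real t * cnj a) * cnj a * G (cnj e) (of_real t * cnj a)) \<le> bound * M / cmod (1 - \<zeta>)"
proof -
  have sides: "side a e" "side (cnj a) (cnj e)" by (auto simp: side_def)
  let ?A = "\<lambda>t. (\<phi> (of_real t * a) - \<phi> (of_real t * cnj a)) / of_real t * \<kappa> t"
  let ?Y1 = "\<lambda>t. \<phi> (of_real t * a) / of_real t * Y a e t"
  let ?Y2 = "\<lambda>t. \<phi> (of_real t * cnj a) / of_real t * Y (cnj a) (cnj e) t"
  have "(LINT t:{\<eta>..L}|lborel. \<phi> (of_real t * a) * a * G e (of_real t * a)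
      - \<phi> (of_real t * cnj a) * cnj a * G (cnj e) (of_real t * cnj a)) = (LINT t:{\<eta>..L}|lborel. ?Y2 t - ?Y1 t - ?A t)"
  proof (rule set_integral_cong_on)
    fix t assume "t \<in> {\<eta>..L}"
    then have t: "t > 0" using \<eta> by auto
    show "\<phi> (of_real t * a) * a * G e (of_real t * a)
      - \<phi> (of_real t * cnj a) * cnj a * G (cnj e) (of_real t * cnj a) = ?Y2 t - ?Y1 t - ?A t"
      unfolding mult.assoc[of "\<phi> _"] G_decomposition[OF sides(1) t] G_decomposition[OF sides(2) t]
      using t by (simp add: field_simps)
  qed simp
  also have "\<dots> = (LINT t:{\<eta>..L}|lborel. ?Y2 t) - (LINT t:{\<eta>..L}|lborel. ?Y1 t) - (LINT t:{\<eta>..L}|lborel. ?A t)"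
    using Y_part(2)[OF sides(1)] Y_part(2)[OF sides(2)] \<kappa>_part(2)
    by (subst set_integral_diff(2) set_integral_diff(1); simp)+
  also have "cmod \<dots> \<le> (V * (2 * M / c) + V * (2 * M / c)) + 2 * M * Im a / Re a * (2 / cmod (1 - \<zeta>) + V * (2 + 1 / c))"
    by (intro order_trans[OF norm_triangle_ineq4] add_mono \<kappa>_part(1) Y_part(1)[OF sides(1)] Y_part(1)[OF sides(2)])
  also have "\<dots> = bound * M / cmod (1 - \<zeta>)"
  proof -
    \<comment> \<open>Here \<open>bound\<close> gets its shape: \<open>V\<close> is
      \<open>q / cmod (1 - \<zeta>)\<close>, the two \<open>Y\<close> terms add up to
      \<open>4 * q / c\<close>, and the \<open>\<kappa>\<close> term carries the factor from the
      chord estimate.\<close>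
    define q where "q = (C0 + C0\<^sup>2) / Re e"
    have "V = q / cmod (1 - \<zeta>)" by (simp add: V_def q_def)
    moreover have "bound = 2 * Im a / Re a * (2 + q * (2 + 1 / c)) + 4 * q / c" by (simp add: bound_def q_def)
    ultimately show ?thesis
      using v_pos c_pos Re_a by (simp only:) (simp add: field_simps)
  qed
  finally show ?thesis .
qed

end

end

section \<open>Holomorphic semigroups\<close>

lemma bounded_clinearD:
  assumes "bounded_clinear T"
  shows "bounded_linear T" "T (c *\<^sub>C x) = c *\<^sub>C T x" "T (x + y) = T x + T y" "T (x - y) = T x - T y"
    "T (r *\<^sub>R x) = r *\<^sub>R T x" "norm (T x) \<le> onorm T * norm x"
  using assms onorm[of T x] unfolding bounded_clinear_def
  by (auto simp: linear_simps)

lemma bounded_clinear_compose: "bounded_clinear A \<Longrightarrow> bounded_clinear B \<Longrightarrow> bounded_clinear (\<lambda>x. A (B x))"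
  unfolding bounded_clinear_def using bounded_linear_compose[of A B] by auto

lemma bounded_clinearI:
  assumes "\<And>x y. T (x + y) = T x + T y" "\<And>c x. T (c *\<^sub>C x) = c *\<^sub>C T x" "\<And>x. norm (T x) \<le> M * norm x"
  shows "bounded_clinear T"
  unfolding bounded_clinear_def
proof (intro conjI allI assms(2) bounded_linear_intro[of T M])
  show "T (r *\<^sub>R x) = r *\<^sub>R T x" for r x
    using assms(2)[of "of_real r" x] by (simp add: scaleC_of_real)
  show "norm (T x) \<le> norm x * M" for x using assms(3)[of x] by (simp add: mult.commute)
qed (rule assms(1))

lemma eq_if_functionals_eq:
  fixes x y :: "'a::complex_normed_vector"
  assumes "\<And>u. bounded_clinear u \<Longrightarrow> (u x :: complex) = u y"
  shows "x = y"
proof -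
  obtain u :: "'a \<Rightarrow> complex" where "bounded_clinear u" "u (x - y) = norm (x - y)"
    by (rule norming_functional[of "x - y"]) blast
  moreover from this(1) have "u (x - y) = 0" using assms[of u] bounded_clinearD(4)[of u x y] by simp
  ultimately show ?thesis by simp
qed

text \<open>With \<open>A = \<bar>Arg z\<bar>\<close> the difference of the two sides of the
  inequality is \<open>cmod z * sin (\<theta> - A)\<close>, and for the angles in question this sine
  is positive exactly when \<open>A < \<theta>\<close>.\<close>

lemma sector_eq:
  assumes "0 < \<theta>" "\<theta> \<le> pi / 2"
  shows "sector \<theta> = {z. \<bar>Im z\<bar> * cos \<theta> < sin \<theta> * Re z}"
proof -
  have "z \<noteq> 0 \<and> \<bar>Arg z\<bar> < \<theta> \<longleftrightarrow> \<bar>Im z\<bar> * cos \<theta> < sin \<theta> * Re z" for z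
  proof (cases "z = 0")
    case False
    define A where "A = \<bar>Arg z\<bar>"
    have A: "0 \<le> A" "A \<le> pi" using Arg_bounded[of z] by (auto simp: A_def)
    have "Im z = cmod z * sin (Arg z)" "Re z = cmod z * cos (Arg z)"
      using Arg_eq[OF False] by (metis Re_rcis Im_rcis rcis_def cis_conv_exp)+
    moreover have "\<bar>sin (Arg z)\<bar> = sin A" "cos (Arg z) = cos A"
      using A sin_ge_zero[of A] by (auto simp: A_def abs_if)
    ultimately have "\<bar>Im z\<bar> = cmod z * sin A" "Re z = cmod z * cos A"
      by (auto simp: abs_mult)
    then have "sin \<theta> * Re z - \<bar>Im z\<bar> * cos \<theta> = cmod z * sin (\<theta> - A)"
      by (simp add: sin_diff algebra_simps)
    then have "\<bar>Im z\<bar> * cos \<theta> < sin \<theta> * Re z \<longleftrightarrow> 0 < cmod z * sin (\<theta> - A)" by linarith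
    also have "\<dots> \<longleftrightarrow> 0 < sin (\<theta> - A)" using False by (simp add: zero_less_mult_iff)
    also have "\<dots> \<longleftrightarrow> A < \<theta>"
    proof
      assume "A < \<theta>"
      then show "0 < sin (\<theta> - A)" using A assms by (intro sin_gt_zero) auto
    next
      assume s: "0 < sin (\<theta> - A)"
      show "A < \<theta>"
      proof (rule ccontr)
        assume "\<not> A < \<theta>"
        then have "0 \<le> sin (A - \<theta>)" using A assms by (intro sin_ge_zero) auto
        moreover have "sin (A - \<theta>) = - sin (\<theta> - A)" using sin_minus[of "\<theta> - A"] by simp
        ultimately show False using s by simp
      qed
    qed
    finally show ?thesis using False by (simp add: A_def)
  qed auto
  then show ?thesis using assms by (auto simp: sector_def)
qed

lemma open_sector: "0 < \<theta> \<Longrightarrow> \<theta> \<le> pi / 2 \<Longrightarrow> open (sector \<theta>)"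
  by (simp add: sector_eq open_Collect_less continuous_intros)

lemma cos_sin_nonneg: "0 < \<theta> \<Longrightarrow> \<theta> \<le> pi / 2 \<Longrightarrow> 0 \<le> cos \<theta> \<and> 0 < sin \<theta>"
  by (auto intro!: cos_ge_zero sin_gt_zero)

lemma sector_add: "0 < \<theta> \<Longrightarrow> \<theta> \<le> pi / 2 \<Longrightarrow> z \<in> sector \<theta> \<Longrightarrow> w \<in> sector \<theta> \<Longrightarrow> z + w \<in> sector \<theta>"
proof -
  assume *: "0 < \<theta>" "\<theta> \<le> pi / 2" "z \<in> sector \<theta>" "w \<in> sector \<theta>"
  have "\<bar>Im z + Im w\<bar> * cos \<theta> \<le> (\<bar>Im z\<bar> + \<bar>Im w\<bar>) * cos \<theta>"
    using cos_sin_nonneg[OF *(1,2)] by (intro mult_right_mono) auto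
  with * show ?thesis by (simp add: sector_eq algebra_simps)
qed

lemma sector_scale: "0 < \<theta> \<Longrightarrow> \<theta> \<le> pi / 2 \<Longrightarrow> z \<in> sector \<theta> \<Longrightarrow> u > 0 \<Longrightarrow> of_real u * z \<in> sector \<theta>"
  using mult_strict_left_mono[of "\<bar>Im z\<bar> * cos \<theta>" "sin \<theta> * Re z" u] by (simp add: sector_eq abs_mult ac_simps)

lemma sector_of_real: "0 < \<theta> \<Longrightarrow> \<theta> \<le> pi / 2 \<Longrightarrow> t > 0 \<Longrightarrow> of_real t \<in> sector \<theta>"
  using cos_sin_nonneg[of \<theta>] by (simp add: sector_eq)

lemma convex_sector: "0 < \<theta> \<Longrightarrow> \<theta> \<le> pi / 2 \<Longrightarrow> convex (sector \<theta>)"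
  unfolding convex_alt scaleR_conv_of_real
proof (intro ballI allI impI)
  fix x y and u :: real
  assume *: "0 < \<theta>" "\<theta> \<le> pi / 2" "x \<in> sector \<theta>" "y \<in> sector \<theta>" "0 \<le> u \<and> u \<le> 1"
  then consider "u = 0" | "u = 1" | "0 < u" "0 < 1 - u" by linarith
  then show "of_real (1 - u) * x + of_real u * y \<in> sector \<theta>"
  proof cases
    case 3
    then show ?thesis
      by (intro sector_add[OF *(1,2)] sector_scale[OF *(1,2)] *(3,4))
  qed (use * in auto)
qed

lemma wedge_cis_eq: "wedge (cis \<alpha>) = {z. \<bar>Im z\<bar> * cos \<alpha> \<le> sin \<alpha> * Re z}"
  by (simp add: wedge_def)

text \<open>\<open>\<alpha> < \<theta>\<close> places the closed wedge in the closure of the sector;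
  the shift by \<open>h\<close> makes the inequality strict, in particular at the vertex, where the
  time rays begin.\<close>

lemma shifted_wedge_in_sector:
  assumes "0 < \<alpha>" "\<alpha> < \<theta>" "\<theta> \<le> pi / 2" "h > 0" "w \<in> wedge (cis \<alpha>)"
  shows "of_real h + w \<in> sector \<theta>"
proof -
  have c: "cos \<alpha> > 0" "sin \<theta> > 0" using assms by (auto intro!: cos_gt_zero sin_gt_zero)
  have s: "sin (\<theta> - \<alpha>) > 0" using assms by (intro sin_gt_zero) auto
  have c\<theta>: "cos \<theta> \<ge> 0" using assms by (intro cos_ge_zero) auto
  have w: "\<bar>Im w\<bar> * cos \<alpha> \<le> sin \<alpha> * Re w" using assms by (simp add: wedge_cis_eq)
  have "0 \<le> Re w"
    using wedge_Re_nonneg[of "cis \<alpha>" w] assms c by (simp add: sin_gt_zero)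
  then have "sin \<theta> * (Re w * cos \<alpha>) - cos \<theta> * (sin \<alpha> * Re w) \<ge> 0"
    using mult_nonneg_nonneg[of "Re w" "sin (\<theta> - \<alpha>)"] s by (simp add: sin_diff algebra_simps)
  moreover have "cos \<theta> * (\<bar>Im w\<bar> * cos \<alpha>) \<le> cos \<theta> * (sin \<alpha> * Re w)"
    using w c\<theta> by (rule mult_left_mono)
  ultimately have "(\<bar>Im w\<bar> * cos \<theta>) * cos \<alpha> \<le> (sin \<theta> * Re w) * cos \<alpha>" by (simp add: ac_simps)
  then have "\<bar>Im w\<bar> * cos \<theta> \<le> sin \<theta> * Re w" using c by simp
  moreover have "0 < sin \<theta> * h" using c assms by simp
  ultimately have "\<bar>Im w\<bar> * cos \<theta> < sin \<theta> * (h + Re w)" by (simp add: distrib_left)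
  then show ?thesis using assms by (subst sector_eq) auto
qed

locale holomorphic_semigroup =
  fixes S :: "real \<Rightarrow> 'a::complex_banach \<Rightarrow> 'a" and F :: "complex \<Rightarrow> 'a \<Rightarrow> 'a" and \<theta> :: real
  assumes \<theta>: "0 < \<theta>" "\<theta> \<le> pi / 2" and semigroup: "C0_semigroup S"
    and F_of_real: "\<And>t. t > 0 \<Longrightarrow> F (of_real t) = S t"
    and F_holomorphic: "operator_holomorphic_on F (sector \<theta>)"
begin

lemma S_clinear: "t \<ge> 0 \<Longrightarrow> bounded_clinear (S t)" and S_0: "S 0 = id"
  and S_add: "s \<ge> 0 \<Longrightarrow> t \<ge> 0 \<Longrightarrow> S (s + t) x = S s (S t x)"
  and S_tendsto: "((\<lambda>t. S t x) \<longlongrightarrow> x) (at_right 0)"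
  using semigroup unfolding C0_semigroup_def by auto

lemma F_clinear: "w \<in> sector \<theta> \<Longrightarrow> bounded_clinear (F w)"
  using F_holomorphic unfolding operator_holomorphic_on_def by blast

lemma F_difference_quotient:
  assumes "z \<in> sector \<theta>"
  obtains D where "\<And>x. ((\<lambda>w. inverse (w - z) *\<^sub>C (F w x - F z x)) \<longlongrightarrow> D x) (at z within sector \<theta>)"
proof -
  obtain D where D: "bounded_clinear D"
    "((\<lambda>w. onorm (\<lambda>x. inverse (w - z) *\<^sub>C (F w x - F z x) - D x)) \<longlongrightarrow> 0) (at z within sector \<theta>)"
    using F_holomorphic assms unfolding operator_holomorphic_on_def by blast
  show thesis
  proof (rule that[of D])
    fix x
    have bl: "bounded_linear (\<lambda>x. inverse (w - z) *\<^sub>C (F w x - F z x) - D x)" if "w \<in> sector \<theta>" for w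
      using bounded_clinearD(1)[OF F_clinear] that assms D(1)
      by (intro bounded_linear_sub bounded_linear_compose[OF bounded_bilinear.bounded_linear_right[OF bounded_bilinear_scaleC]])
        (auto simp: bounded_clinear_def)
    have "((\<lambda>w. inverse (w - z) *\<^sub>C (F w x - F z x) - D x) \<longlongrightarrow> 0) (at z within sector \<theta>)"
    proof (rule Lim_null_comparison)
      show "((\<lambda>w. onorm (\<lambda>x. inverse (w - z) *\<^sub>C (F w x - F z x) - D x) * norm x) \<longlongrightarrow> 0) (at z within sector \<theta>)"
        by (rule tendsto_mult_left_zero[OF D(2)])
      show "\<forall>\<^sub>F w in at z within sector \<theta>. norm (inverse (w - z) *\<^sub>C (F w x - F z x) - D x)
          \<le> onorm (\<lambda>x. inverse (w - z) *\<^sub>C (F w x - F z x) - D x) * norm x"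
        unfolding eventually_at_topological using onorm[OF bl] by blast
    qed
    then show "((\<lambda>w. inverse (w - z) *\<^sub>C (F w x - F z x)) \<longlongrightarrow> D x) (at z within sector \<theta>)"
      by (simp add: LIM_zero_iff)
  qed
qed

lemma functional_F_holomorphic:
  assumes u: "bounded_clinear (u :: 'a \<Rightarrow> complex)"
  shows "(\<lambda>w. u (F w x)) holomorphic_on sector \<theta>"
proof (rule holomorphic_onI)
  fix z assume z: "z \<in> sector \<theta>"
  obtain D where "((\<lambda>w. inverse (w - z) *\<^sub>C (F w x - F z x)) \<longlongrightarrow> D x) (at z within sector \<theta>)"
    by (rule F_difference_quotient[OF z]) blast
  from bounded_linear.tendsto[OF bounded_clinearD(1)[OF u] this]
  have "((\<lambda>w. (u (F w x) - u (F z x)) / (w - z)) \<longlongrightarrow> u (D x)) (at z within sector \<theta>)"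
    by (simp add: bounded_clinearD[OF u] scaleC_complex_def divide_inverse mult.commute)
  then show "(\<lambda>w. u (F w x)) field_differentiable at z within sector \<theta>"
    unfolding field_differentiable_def has_field_derivative_iff by blast
qed

lemma F_continuous: "continuous_on (sector \<theta>) (\<lambda>w. F w x)"
  unfolding continuous_on_def
proof
  fix z assume z: "z \<in> sector \<theta>"
  obtain D where D: "((\<lambda>w. inverse (w - z) *\<^sub>C (F w x - F z x)) \<longlongrightarrow> D x) (at z within sector \<theta>)"
    by (rule F_difference_quotient[OF z]) blast
  have "((\<lambda>w. (w - z) *\<^sub>C (inverse (w - z) *\<^sub>C (F w x - F z x)) + F z x) \<longlongrightarrow> (z - z) *\<^sub>C D x + F z x) (at z within sector \<theta>)"
    by (intro tendsto_intros bounded_bilinear.tendsto[OF bounded_bilinear_scaleC] D)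
  moreover have "\<forall>\<^sub>F w in at z within sector \<theta>. (w - z) *\<^sub>C (inverse (w - z) *\<^sub>C (F w x - F z x)) + F z x = F w x"
    unfolding eventually_at_filter by (auto simp: scaleC_scaleC scaleC_one)
  ultimately have "((\<lambda>w. F w x) \<longlongrightarrow> (z - z) *\<^sub>C D x + F z x) (at z within sector \<theta>)"
    by (rule Lim_transform_eventually)
  then show "((\<lambda>w. F w x) \<longlongrightarrow> F z x) (at z within sector \<theta>)"
    by (simp add: scaleC_zero_left)
qed

lemma holomorphic_eq_on_sector:
  assumes "f1 holomorphic_on sector \<theta>" "f2 holomorphic_on sector \<theta>" "\<And>t. t > 0 \<Longrightarrow> f1 (of_real t) = f2 (of_real t)"
    and w: "w \<in> sector \<theta>"
  shows "f1 w = f2 w"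
proof -
  have "f1 w - f2 w = 0"
  proof (rule analytic_continuation[where f = "\<lambda>w. f1 w - f2 w" and S = "sector \<theta>" and U = "of_real ` {0<..}" and \<xi> = 1])
    show "(\<lambda>w. f1 w - f2 w) holomorphic_on sector \<theta>" by (intro holomorphic_intros assms)
    show "open (sector \<theta>)" by (rule open_sector[OF \<theta>])
    show "connected (sector \<theta>)" by (rule convex_connected[OF convex_sector[OF \<theta>]])
    show "of_real ` {0<..} \<subseteq> sector \<theta>" using sector_of_real[OF \<theta>] by auto
    show "1 \<in> sector \<theta>" using sector_of_real[OF \<theta>, of 1] by simp
    show "1 islimpt (complex_of_real ` {0<..})"
      unfolding islimpt_sequential
    proof (intro exI conjI allI)
      let ?f = "\<lambda>n. complex_of_real (1 + 1 / real (Suc n))"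
      show "?f n \<in> of_real ` {0<..} - {1}" for n
      proof -
        have "0 < 1 / real (Suc n)" by simp
        then have p: "0 < 1 + 1 / real (Suc n)" "1 + 1 / real (Suc n) \<noteq> 1" by linarith+
        then have "?f n \<in> of_real ` {0<..}" by (intro imageI) simp
        moreover have "?f n \<noteq> 1" using p(2) by (metis of_real_eq_1_iff)
        ultimately show ?thesis by simp
      qed
      have "(\<lambda>n. 1 + 1 / real (Suc n)) \<longlonglongrightarrow> 1 + 0"
        by (intro tendsto_intros LIMSEQ_Suc[OF lim_inverse_n'])
      from tendsto_of_real[OF this] show "?f \<longlonglongrightarrow> (1 :: complex)"
        by (simp only: add_0_right of_real_1)
    qed
  qed (use assms w in auto)
  then show ?thesis by simp
qed

text \<open>On the positive half-axis this is the semigroup law. With \<open>t\<close> kept real,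
  one continuation in \<open>w\<close>, for each functional, extends it to the sector.\<close>

lemma S_F:
  assumes "t \<ge> 0" "w \<in> sector \<theta>"
  shows "S t (F w x) = F (of_real t + w) x"
proof (cases "t = 0")
  case False
  with assms have t: "t > 0" by simp
  show ?thesis
  proof (rule eq_if_functionals_eq)
    fix u :: "'a \<Rightarrow> complex" assume u: "bounded_clinear u"
    show "u (S t (F w x)) = u (F (of_real t + w) x)"
    proof (rule holomorphic_eq_on_sector[where ?f1.0 = "\<lambda>w. u (S t (F w x))" and ?f2.0 = "\<lambda>w. u (F (of_real t + w) x)"])
      show "(\<lambda>w. u (S t (F w x))) holomorphic_on sector \<theta>"
        by (rule functional_F_holomorphic[OF bounded_clinear_compose[OF u S_clinear[OF assms(1)]]])
      have "(\<lambda>w. u (F w x)) \<circ> (\<lambda>w. of_real t + w) holomorphic_on sector \<theta>"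
        by (rule holomorphic_on_compose_gen[OF _ functional_F_holomorphic[OF u]])
          (use t in \<open>auto intro!: holomorphic_intros sector_add[OF \<theta>] sector_of_real[OF \<theta>]\<close>)
      then show "(\<lambda>w. u (F (of_real t + w) x)) holomorphic_on sector \<theta>" by (simp add: o_def)
      fix r :: real assume "r > 0"
      then show "u (S t (F (of_real r) x)) = u (F (of_real t + of_real r) x)"
        using t S_add[of t r x] F_of_real[of r] F_of_real[of "t + r"] by simp
    qed (rule assms)
  qed
qed (simp add: S_0)

lemma F_S_commute:
  assumes "t \<ge> 0" "w \<in> sector \<theta>"
  shows "F w (S t x) = S t (F w x)"
proof (rule eq_if_functionals_eq)
  fix u :: "'a \<Rightarrow> complex" assume u: "bounded_clinear u"
  show "u (F w (S t x)) = u (S t (F w x))"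
  proof (rule holomorphic_eq_on_sector[where ?f1.0 = "\<lambda>w. u (F w (S t x))" and ?f2.0 = "\<lambda>w. u (S t (F w x))"])
    show "(\<lambda>w. u (S t (F w x))) holomorphic_on sector \<theta>"
      by (rule functional_F_holomorphic[OF bounded_clinear_compose[OF u S_clinear[OF assms(1)]]])
    show "(\<lambda>w. u (F w (S t x))) holomorphic_on sector \<theta>" by (rule functional_F_holomorphic[OF u])
    fix r :: real assume "r > 0"
    then show "u (F (of_real r) (S t x)) = u (S t (F (of_real r) x))"
      using assms(1) S_add[of t r x] S_add[of r t x] F_of_real[of r] by (simp add: add.commute)
  qed (rule assms)
qed

end

section \<open>Improper integrals over the time rays and removal of the truncation\<close>

lemma improper_integral_exp_decay:
  fixes h :: "real \<Rightarrow> 'a::banach"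
  assumes cont: "continuous_on {0..} h" and b: "\<And>t. t \<ge> 0 \<Longrightarrow> norm (h t) \<le> C * exp (- c * t)" and c: "c > 0"
  shows "convergent (\<lambda>n. integral {0..real n} h)"
proof -
  have C: "C \<ge> 0" using order_trans[OF norm_ge_zero b[of 0]] by simp
  have int: "h integrable_on {x..y}" if "0 \<le> x" for x y
    by (rule integrable_continuous_real[OF continuous_on_subset[OF cont]]) (use that in auto)
  have diff: "norm (integral {0..real n} h - integral {0..real m} h) \<le> C / c * exp (- c * real m)" if "m \<le> n" for m n
  proof -
    have "integral {0..real m} h + integral {real m..real n} h = integral {0..real n} h"
      using that by (intro Henstock_Kurzweil_Integration.integral_combine int) auto
    then have "norm (integral {0..real n} h - integral {0..real m} h) = norm (integral {real m..real n} h)"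
      by (metis add_diff_cancel_left')
    also have "\<dots> \<le> integral {real m..real n} (\<lambda>t. C * exp (- c * t))"
      by (intro integral_norm_bound_integral int b integrable_continuous_real continuous_intros) auto
    also have "\<dots> = - (C / c * exp (- c * real n)) - - (C / c * exp (- c * real m))"
    proof (rule integral_unique, rule fundamental_theorem_of_calculus)
      show "((\<lambda>t. - (C / c * exp (- c * t))) has_vector_derivative C * exp (- c * t)) (at t within {real m..real n})" for t
        unfolding has_real_derivative_iff_has_vector_derivative[symmetric]
        using c by (auto intro!: derivative_eq_intros)
    qed (use that in auto)
    also have "\<dots> \<le> C / c * exp (- c * real m)" using C c by simp
    finally show ?thesis .
  qed
  have "(\<lambda>n. C / c * exp (- c * real n)) \<longlonglongrightarrow> 0"
  proof -
    have "(\<lambda>n. exp (- c * real n)) \<longlonglongrightarrow> 0" using c by real_asymp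
    then show ?thesis by (rule tendsto_mult_right_zero)
  qed
  then have "Cauchy (\<lambda>n. integral {0..real n} h)"
  proof (intro CauchyI)
    fix e :: real assume lim: "(\<lambda>n. C / c * exp (- c * real n)) \<longlonglongrightarrow> 0" and e: "e > 0"
    obtain N where N: "\<And>n. n \<ge> N \<Longrightarrow> C / c * exp (- c * real n) < e"
      using order_tendstoD(2)[OF lim e] unfolding eventually_sequentially by blast
    have *: "norm (integral {0..real n} h - integral {0..real m} h) < e" if "m \<ge> N" "m \<le> n" for m n
      using diff[OF that(2)] N[OF that(1)] by linarith
    show "\<exists>N. \<forall>m\<ge>N. \<forall>n\<ge>N. norm (integral {0..real m} h - integral {0..real n} h) < e"
      using * by (metis nat_le_linear norm_minus_commute)
  qed
  then show ?thesis by (rule Cauchy_convergent)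
qed

context dirichlet_resolvent
begin

lemma G_ray_continuous:
  assumes bd: "side b d"
  shows "continuous_on {0..} (\<lambda>t. G d (of_real t * b))"
  unfolding continuous_on_sequentially
proof (intro ballI allI impI, elim conjE)
  fix t0 and T :: "nat \<Rightarrow> real"
  assume t0: "t0 \<in> {0..}" and T: "\<forall>n. T n \<in> {0..}" "T \<longlonglongrightarrow> t0"
  have gm: "set_borel_measurable lborel {0..} (\<lambda>r. g (of_real r * d) * d * exp (of_real t * b * (of_real r * d)))" for t
    by (intro set_borel_measurable_continuous continuous_intros g_ray_continuous[OF bd]) simp
  show "((\<lambda>t. G d (of_real t * b)) \<circ> T) \<longlonglongrightarrow> G d (of_real t0 * b)"
    unfolding o_def G_def set_lebesgue_integral_def
  proof (rule integral_dominated_convergence[where w = "\<lambda>r. norm (indicator {0..} r *\<^sub>R (g (of_real r * d) * d))"])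
    show "integrable lborel (\<lambda>r. norm (indicator {0..} r *\<^sub>R (g (of_real r * d) * d)))"
      using g_ray_integrable[OF bd] unfolding set_integrable_def by (rule integrable_norm)
    show "AE r in lborel. (\<lambda>n. indicator {0..} r *\<^sub>R (g (of_real r * d) * d * exp (of_real (T n) * b * (of_real r * d))))
        \<longlonglongrightarrow> indicator {0..} r *\<^sub>R (g (of_real r * d) * d * exp (of_real t0 * b * (of_real r * d)))"
      by (intro AE_I2 tendsto_intros T)
    fix n
    show "AE r in lborel. norm (indicator {0..} r *\<^sub>R (g (of_real r * d) * d * exp (of_real (T n) * b * (of_real r * d))))
       \<le> norm (indicator {0..} r *\<^sub>R (g (of_real r * d) * d))"
    proof (rule AE_I2)
      fix r :: real
      show "norm (indicator {0..} r *\<^sub>R (g (of_real r * d) * d * exp (of_real (T n) * b * (of_real r * d))))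
       \<le> norm (indicator {0..} r *\<^sub>R (g (of_real r * d) * d))"
      proof (cases "r \<ge> 0")
        case True
        have "norm (g (of_real r * d) * d * exp (of_real (T n) * b * (of_real r * d))) \<le> norm (g (of_real r * d) * d)"
          using T(1) by (intro norm_mult_exp_le ray_kernel_Re[OF bd] True) auto
        then show ?thesis using True by (simp add: indicator_def)
      qed simp
    qed
  qed (use gm in \<open>simp_all add: set_borel_measurable_def\<close>)
qed

text \<open>A crude bound by the integral of \<open>cmod g\<close>, not uniform in \<delta>. It
  serves convergence only; the norm estimates rest on the variation of \<open>g\<close>.\<close>

lemma G_ray_bounded:
  assumes bd: "side b d"
  obtains G0 where "G0 \<ge> 0" "\<And>t. t \<ge> 0 \<Longrightarrow> cmod (G d (of_real t * b)) \<le> G0"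
proof (rule that)
  show "(LINT r:{0..}|lborel. cmod (g (of_real r * d) * d)) \<ge> 0"
    unfolding set_lebesgue_integral_def by (intro integral_nonneg_AE AE_I2) auto
  fix t :: real assume t: "t \<ge> 0"
  note Re = ray_kernel_Re[OF bd t]
  have int: "set_integrable lborel {0..} (\<lambda>r. g (of_real r * d) * d * exp (of_real t * b * (of_real r * d)))"
    by (intro set_integrable_mult_exp g_ray_integrable[OF bd] continuous_intros g_ray_continuous[OF bd] Re)
  have "cmod (G d (of_real t * b)) \<le> (LINT r:{0..}|lborel. cmod (g (of_real r * d) * d * exp (of_real t * b * (of_real r * d))))"
    unfolding G_def by (rule set_integral_norm_bound[OF int])
  also have "\<dots> \<le> (LINT r:{0..}|lborel. cmod (g (of_real r * d) * d))"
    by (rule set_integral_mono[OF set_integrable_norm[OF int] set_integrable_norm[OF g_ray_integrable[OF bd]] norm_mult_exp_le[OF Re]]) simp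
  finally show "cmod (G d (of_real t * b)) \<le> (LINT r:{0..}|lborel. cmod (g (of_real r * d) * d))" .
qed

lemma ray_pairing_integrand:
  assumes \<phi>: "\<phi> holomorphic_on wedge a" and \<tau>: "\<tau> > 0"
    and \<phi>_bound: "\<And>w. w \<in> wedge a \<Longrightarrow> cmod (\<phi> w) \<le> M * exp (- \<tau> * Re w)" and bd: "side b d"
  shows "set_integrable lborel {0..} (\<lambda>t. \<phi> (of_real t * b) * b * G d (of_real t * b))"
proof -
  obtain G0 where G0: "G0 \<ge> 0" "\<And>t. t \<ge> 0 \<Longrightarrow> cmod (G d (of_real t * b)) \<le> G0" by (rule G_ray_bounded[OF bd]) blast
  have \<phi>c: "continuous_on {0..} (\<lambda>t. \<phi> (of_real t * b))"
    by (rule continuous_on_compose2[OF holomorphic_on_imp_continuous_on[OF \<phi>]])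
      (auto intro!: continuous_intros side_wedge(1)[OF bd])
  show ?thesis
  proof (rule set_integrable_exp_decay[where C = "M * G0" and c = "\<tau> * Re a"])
    show "continuous_on {0..} (\<lambda>t. \<phi> (of_real t * b) * b * G d (of_real t * b))"
      by (intro continuous_intros \<phi>c G_ray_continuous[OF bd])
    show "\<tau> * Re a > 0" using \<tau> Re_a by simp
    fix t :: real assume t: "t \<ge> 0"
    have "cmod (\<phi> (of_real t * b)) \<le> M * exp (- (\<tau> * Re a) * t)"
      using \<phi>_bound[OF side_wedge(1)[OF bd t]] side_facts(1)[OF bd] by (simp add: ac_simps)
    from mult_mono[OF this G0(2)[OF t] order_trans[OF norm_ge_zero this] norm_ge_zero]
    show "cmod (\<phi> (of_real t * b) * b * G d (of_real t * b)) \<le> M * G0 * exp (- (\<tau> * Re a) * t)"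
      using side_facts(3)[OF bd] by (simp add: norm_mult ac_simps)
  qed
qed

text \<open>The decay rate \<tau> secures integrability over the full rays and allows the passage to
  the limit from the truncated pairings; the bound itself sees only the supremum \<open>M\<close> of
  \<phi>.\<close>

lemma pairing_bound:
  assumes \<phi>: "\<phi> holomorphic_on wedge a" and \<tau>: "\<tau> > 0"
    and \<phi>_bound: "\<And>w. w \<in> wedge a \<Longrightarrow> cmod (\<phi> w) \<le> M * exp (- \<tau> * Re w)"
  shows "cmod (pairing \<phi>) \<le> bound / (2 * pi) * M / cmod (1 - \<zeta>)"
proof -
  have sides: "side a e" "side (cnj a) (cnj e)" by (auto simp: side_def)
  define P where "P t = \<phi> (of_real t * a) * a * G e (of_real t * a) - \<phi> (of_real t * cnj a) * cnj a * G (cnj e) (of_real t * cnj a)" for t :: real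
  have int: "set_integrable lborel {0..} (\<lambda>t. \<phi> (of_real t * b) * b * G d (of_real t * b))" if "side b d" for b d
    using ray_pairing_integrand[OF \<phi> \<tau> \<phi>_bound, of b d] that by blast
  have M: "M \<ge> 0" using order_trans[OF norm_ge_zero \<phi>_bound[of 0]] by (simp add: wedge_def)
  have \<phi>_le: "cmod (\<phi> w) \<le> M" if w: "w \<in> wedge a" for w
  proof -
    have "M * exp (- \<tau> * Re w) \<le> M * 1"
      using M \<tau> wedge_Re_nonneg[OF Re_a Im_a w] by (intro mult_left_mono) auto
    with \<phi>_bound[OF w] show ?thesis by simp
  qed
  have Pint: "set_integrable lborel {0..} P"
    unfolding P_def[abs_def] by (rule set_integral_diff(1)[OF int[OF sides(1)] int[OF sides(2)]])
  let ?I = "\<lambda>n. {1 / real (Suc n)..real (Suc n)}"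
  have "(\<lambda>n. LINT t:?I n|lborel. P t) \<longlonglongrightarrow> (LINT t:{0..}|lborel. P t)"
    unfolding set_lebesgue_integral_def
  proof (rule integral_dominated_convergence[where w = "\<lambda>t. norm (indicator {0..} t *\<^sub>R P t)"])
    show "integrable lborel (\<lambda>t. norm (indicator {0..} t *\<^sub>R P t))"
      using Pint unfolding set_integrable_def by (rule integrable_norm)
    have "AE t in lborel. t \<noteq> (0::real)" by (rule AE_lborel_singleton)
    then show "AE t in lborel. (\<lambda>n. indicator (?I n) t *\<^sub>R P t) \<longlonglongrightarrow> indicator {0..} t *\<^sub>R P t"
    proof eventually_elim
      case (elim t)
      show ?case
      proof (cases "t > 0")
        case True
        obtain N where N: "real N > max t (1 / t)" using reals_Archimedean2 by blast
        have "t \<in> ?I n" if "n \<ge> N" for n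
        proof -
          have "real (Suc n) > t" "real (Suc n) > 1 / t" using N that by auto
          then show ?thesis using True by (simp add: field_simps)
        qed
        then have "\<forall>\<^sub>F n in sequentially. indicator (?I n) t *\<^sub>R P t = indicator {0..} t *\<^sub>R P t"
          using True by (intro eventually_sequentiallyI[of N]) auto
        then show ?thesis by (rule tendsto_eventually)
      next
        case False
        with elim have "t < 0" by simp
        then have "t \<notin> ?I n" for n
          by (metis atLeastAtMost_iff not_le of_nat_0_le_iff order_trans zero_le_divide_1_iff)
        then show ?thesis using \<open>t < 0\<close> by simp
      qed
    qed
    fix n
    have "0 < 1 / real (Suc n)" by simp
    then have sub: "?I n \<subseteq> {0..}"
      unfolding subset_iff atLeastAtMost_iff atLeast_iff by (meson less_imp_le order_trans)
    show "AE t in lborel. norm (indicator (?I n) t *\<^sub>R P t) \<le> norm (indicator {0..} t *\<^sub>R P t)"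
    proof (rule AE_I2)
      fix t
      have "indicat_real (?I n) t \<le> indicat_real {0..} t"
        using subsetD[OF sub, of t] by (simp only: indicator_def) auto
      then show "norm (indicator (?I n) t *\<^sub>R P t) \<le> norm (indicator {0..} t *\<^sub>R P t)"
        by (simp only: norm_scaleR abs_of_nonneg indicator_pos_le) (intro mult_right_mono norm_ge_zero)
    qed
    have "set_integrable lborel (?I n) P"
      by (rule set_integrable_subset[OF Pint]) (use sub in auto)
    then show "(\<lambda>t. indicator (?I n) t *\<^sub>R P t) \<in> borel_measurable lborel"
      unfolding set_integrable_def by (rule borel_measurable_integrable)
    show "(\<lambda>t. indicator {0..} t *\<^sub>R P t) \<in> borel_measurable lborel"
      using Pint unfolding set_integrable_def by (rule borel_measurable_integrable)
  qed
  moreover have "cmod (LINT t:?I n|lborel. P t) \<le> bound * M / cmod (1 - \<zeta>)" for n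
    unfolding P_def
  proof (rule truncated_pairing_bound[OF \<phi> \<phi>_le])
    have "1 / real (Suc n) \<le> 1" by simp
    also have "1 \<le> real (Suc n)" by simp
    finally show "1 / real (Suc n) \<le> real (Suc n)" .
  qed auto
  ultimately have "cmod (LINT t:{0..}|lborel. P t) \<le> bound * M / cmod (1 - \<zeta>)"
    by (intro tendsto_upperbound[OF tendsto_norm]) auto
  then have "cmod (LINT t:{0..}|lborel. P t) / (2 * pi) \<le> bound * M / cmod (1 - \<zeta>) / (2 * pi)"
    by (intro divide_right_mono) auto
  moreover have "pairing \<phi> = (LINT t:{0..}|lborel. P t) / (2 * pi * \<i>)"
    unfolding pairing_def ray_pairing_def P_def[abs_def]
    by (subst set_integral_diff(2)[OF int[OF sides(1)] int[OF sides(2)]]) simp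
  ultimately show ?thesis
    by (simp add: norm_divide norm_mult mult_ac)
qed

end

text \<open>The shift by \<open>h\<close> lets the time rays start inside the sector, and \<open>\<epsilon>\<close> forces decay along them.\<close>

locale semigroup_resolvent = holomorphic_semigroup S F \<theta> + dirichlet_resolvent a e \<zeta> \<delta> C0 K p s
  for S :: "real \<Rightarrow> 'a::complex_banach \<Rightarrow> 'a" and F \<theta> a e \<zeta> \<delta> C0 and K :: "'k set" and p s +
  fixes \<epsilon> h M :: real
  assumes \<epsilon>: "\<epsilon> > 0" and h: "h > 0"
    and wedge_sector: "\<And>w. w \<in> wedge a \<Longrightarrow> of_real h + w \<in> sector \<theta>"
    and F_le: "\<And>w x. w \<in> wedge a \<Longrightarrow> norm (F (of_real h + w) x) \<le> M * norm x"
begin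

text \<open>The damping is evaluated at the shifted time \<open>h + w\<close>, so that translating
  \<open>w\<close> by \<open>t\<close> multiplies it by \<open>exp (- \<epsilon> * t)\<close>; the
  damped family again obeys the semigroup law.\<close>

definition E :: "complex \<Rightarrow> complex" where "E w = exp (- of_real \<epsilon> * (of_real h + w))"

definition \<Phi> :: "('a \<Rightarrow> complex) \<Rightarrow> 'a \<Rightarrow> complex \<Rightarrow> complex" where
  "\<Phi> u x w = E w * u (F (of_real h + w) x)"

definition coeff :: "complex \<Rightarrow> complex \<Rightarrow> real \<Rightarrow> complex" where
  "coeff b d t = b * G d (of_real t * b) * E (of_real t * b) / (2 * pi * \<i>)"

definition H :: "'a \<Rightarrow> real \<Rightarrow> 'a" where
  "H x t = coeff a e t *\<^sub>C F (of_real h + of_real t * a) x - coeff (cnj a) (cnj e) t *\<^sub>C F (of_real h + of_real t * cnj a) x"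

text \<open>Formally the inverse of \<zeta> - f(A + \<epsilon>) times exp (- (\<delta> + h) (A +
  \<epsilon>)). Gauge integrals over bounded intervals and a limit are used since \<open>'a\<close>
  is not assumed to be second countable.\<close>

definition R :: "'a \<Rightarrow> 'a" where "R x = lim (\<lambda>n. integral {0..real n} (H x))"

lemma sides: "side a e" "side (cnj a) (cnj e)" by (auto simp: side_def)

lemma E_le: "w \<in> wedge a \<Longrightarrow> cmod (E w) \<le> exp (- \<epsilon> * Re w)"
  using \<epsilon> h by (simp add: E_def algebra_simps)

lemma \<Phi>_holomorphic:
  assumes u: "bounded_clinear u" shows "\<Phi> u x holomorphic_on wedge a"
proof -
  have "(\<lambda>w. u (F w x)) \<circ> (\<lambda>w. of_real h + w) holomorphic_on wedge a"
    by (rule holomorphic_on_compose_gen[OF _ functional_F_holomorphic[OF u]])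
      (auto intro!: holomorphic_intros wedge_sector)
  then have "(\<lambda>w. u (F (of_real h + w) x)) holomorphic_on wedge a" by (simp add: o_def)
  then show ?thesis unfolding \<Phi>_def[abs_def] E_def by (intro holomorphic_intros)
qed

lemma \<Phi>_bound:
  assumes u: "\<And>y. cmod (u y) \<le> U * norm y" and U: "U \<ge> 0" and w: "w \<in> wedge a"
  shows "cmod (\<Phi> u x w) \<le> U * (M * norm x) * exp (- \<epsilon> * Re w)"
proof -
  have "cmod (u (F (of_real h + w) x)) \<le> U * (M * norm x)"
    by (rule order_trans[OF u mult_left_mono[OF F_le[OF w] U]])
  from mult_mono[OF E_le[OF w] this exp_ge_zero norm_ge_zero]
  show ?thesis by (simp add: \<Phi>_def norm_mult ac_simps)
qed

lemma F_ray_continuous: "side b d \<Longrightarrow> continuous_on {0..} (\<lambda>t. F (of_real h + of_real t * b) x)"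
  by (rule continuous_on_compose2[OF F_continuous]) (auto intro!: continuous_intros wedge_sector side_wedge(1))

lemma coeff_continuous: "side b d \<Longrightarrow> continuous_on {0..} (coeff b d)"
  unfolding coeff_def[abs_def] E_def by (intro continuous_intros G_ray_continuous) auto

lemma H_continuous: "continuous_on {0..} (H x)"
  unfolding H_def[abs_def]
  by (intro continuous_intros bounded_bilinear.continuous_on[OF bounded_bilinear_scaleC]
      coeff_continuous[OF sides(1)] coeff_continuous[OF sides(2)] F_ray_continuous[OF sides(1)] F_ray_continuous[OF sides(2)])

lemma H_integrable: "H x integrable_on {0..real n}"
  by (rule integrable_continuous_real[OF continuous_on_subset[OF H_continuous]]) auto

lemma coeff_F_bound:
  assumes bd: "side b d"
  obtains C where "\<And>t. t \<ge> 0 \<Longrightarrow> norm (coeff b d t *\<^sub>C F (of_real h + of_real t * b) x) \<le> C * exp (- (\<epsilon> * Re a) * t)"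
proof -
  obtain G0 where G0: "G0 \<ge> 0" "\<And>t. t \<ge> 0 \<Longrightarrow> cmod (G d (of_real t * b)) \<le> G0" by (rule G_ray_bounded[OF bd]) blast
  show thesis
  proof (rule that)
    fix t :: real assume t: "t \<ge> 0"
    have w: "of_real t * b \<in> wedge a" by (rule side_wedge(1)[OF bd t])
    have "cmod (E (of_real t * b)) \<le> exp (- (\<epsilon> * Re a) * t)"
      using E_le[OF w] side_facts(1)[OF bd] by (simp add: ac_simps)
    then have "cmod (G d (of_real t * b)) * cmod (E (of_real t * b)) \<le> G0 * exp (- (\<epsilon> * Re a) * t)"
      by (intro mult_mono G0 t) auto
    then have "cmod (coeff b d t) \<le> G0 * exp (- (\<epsilon> * Re a) * t) / (2 * pi)"
      using side_facts(3)[OF bd] by (simp add: coeff_def norm_mult norm_divide divide_right_mono)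
    then have "cmod (coeff b d t) * norm (F (of_real h + of_real t * b) x) \<le> (G0 * exp (- (\<epsilon> * Re a) * t) / (2 * pi)) * (M * norm x)"
      by (rule mult_mono[OF _ F_le[OF w]]) (use G0 in auto)
    then show "norm (coeff b d t *\<^sub>C F (of_real h + of_real t * b) x) \<le> (G0 / (2 * pi) * (M * norm x)) * exp (- (\<epsilon> * Re a) * t)"
      by (simp add: norm_scaleC mult_ac)
  qed
qed

lemma R_lim: "(\<lambda>n. integral {0..real n} (H x)) \<longlonglongrightarrow> R x"
proof -
  obtain C1 where C1: "\<And>t. t \<ge> 0 \<Longrightarrow> norm (coeff a e t *\<^sub>C F (of_real h + of_real t * a) x) \<le> C1 * exp (- (\<epsilon> * Re a) * t)"
    by (rule coeff_F_bound[OF sides(1)]) blast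
  obtain C2 where C2: "\<And>t. t \<ge> 0 \<Longrightarrow> norm (coeff (cnj a) (cnj e) t *\<^sub>C F (of_real h + of_real t * cnj a) x) \<le> C2 * exp (- (\<epsilon> * Re a) * t)"
    by (rule coeff_F_bound[OF sides(2)]) blast
  have "convergent (\<lambda>n. integral {0..real n} (H x))"
  proof (rule improper_integral_exp_decay[OF H_continuous])
    show "\<epsilon> * Re a > 0" using \<epsilon> Re_a by simp
    fix t :: real assume t: "t \<ge> 0"
    show "norm (H x t) \<le> (C1 + C2) * exp (- (\<epsilon> * Re a) * t)"
      unfolding H_def distrib_right by (rule order_trans[OF norm_triangle_ineq4 add_mono[OF C1[OF t] C2[OF t]]])
  qed
  then show ?thesis unfolding R_def by (simp add: convergent_LIMSEQ_iff)
qed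

text \<open>Homogeneity of \<open>R\<close> and its commutation with the semigroup both come from
  here, by moving an operator under the integral.\<close>

lemma R_bounded_linear_commute:
  assumes A: "bounded_linear A" and AH: "\<And>t. t \<ge> 0 \<Longrightarrow> A (H x t) = H y t"
  shows "A (R x) = R y"
proof (rule LIMSEQ_unique)
  have "integral {0..real n} (H y) = A (integral {0..real n} (H x))" for n
  proof -
    have "integral {0..real n} (A \<circ> H x) = A (integral {0..real n} (H x))"
      by (rule integral_linear[OF H_integrable A])
    moreover have "integral {0..real n} (A \<circ> H x) = integral {0..real n} (H y)"
      by (rule Henstock_Kurzweil_Integration.integral_cong) (auto simp: AH)
    ultimately show ?thesis by simp
  qed
  then show "(\<lambda>n. A (integral {0..real n} (H x))) \<longlonglongrightarrow> R y" using R_lim[of y] by simp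
  show "(\<lambda>n. A (integral {0..real n} (H x))) \<longlonglongrightarrow> A (R x)" by (rule bounded_linear.tendsto[OF A R_lim])
qed

lemma ray_in_sector: "side b d \<Longrightarrow> t \<ge> 0 \<Longrightarrow> of_real h + of_real t * b \<in> sector \<theta>"
  by (intro wedge_sector side_wedge(1))

lemma R_add: "R (x + y) = R x + R y"
proof (rule LIMSEQ_unique[OF R_lim])
  have H: "H (x + y) t = H x t + H y t" if "t \<ge> 0" for t
    using that by (simp add: H_def bounded_clinearD(3)[OF F_clinear[OF ray_in_sector[OF sides(1)]]]
        bounded_clinearD(3)[OF F_clinear[OF ray_in_sector[OF sides(2)]]] scaleC_add_right)
  have "integral {0..real n} (H (x + y)) = integral {0..real n} (\<lambda>t. H x t + H y t)" for n
    by (rule Henstock_Kurzweil_Integration.integral_cong) (auto simp: H)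
  then have "integral {0..real n} (H (x + y)) = integral {0..real n} (H x) + integral {0..real n} (H y)" for n
    by (simp add: Henstock_Kurzweil_Integration.integral_add H_integrable)
  then show "(\<lambda>n. integral {0..real n} (H (x + y))) \<longlonglongrightarrow> R x + R y"
    using tendsto_add[OF R_lim[of x] R_lim[of y]] by simp
qed

lemma R_scaleC: "R (q *\<^sub>C x) = q *\<^sub>C R x"
proof (rule R_bounded_linear_commute[symmetric])
  show "bounded_linear (\<lambda>x. q *\<^sub>C x)"
    by (rule bounded_bilinear.bounded_linear_right[OF bounded_bilinear_scaleC])
  show "q *\<^sub>C H x t = H (q *\<^sub>C x) t" if "t \<ge> 0" for t
    using that by (simp add: H_def bounded_clinearD(2)[OF F_clinear[OF ray_in_sector[OF sides(1)]]]
        bounded_clinearD(2)[OF F_clinear[OF ray_in_sector[OF sides(2)]]] scaleC_diff_right scaleC_scaleC mult.commute[of q])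
qed

lemma R_S_commute: "t \<ge> 0 \<Longrightarrow> R (S t x) = S t (R x)"
proof (rule R_bounded_linear_commute[symmetric])
  assume t: "t \<ge> 0"
  show "bounded_linear (S t)" by (rule bounded_clinearD(1)[OF S_clinear[OF t]])
  show "S t (H x r) = H (S t x) r" if "r \<ge> 0" for r
    by (simp add: H_def bounded_clinearD[OF S_clinear[OF t]] F_S_commute[OF t ray_in_sector[OF sides(1) that]]
        F_S_commute[OF t ray_in_sector[OF sides(2) that]])
qed

text \<open>The bridge to the scalar calculus: the estimate and the resolvent equation for
  \<open>R\<close> are read off pairings through it.\<close>

lemma R_functional:
  assumes u: "bounded_clinear u"
  shows "u (R x) = pairing (\<Phi> u x)"
proof (rule LIMSEQ_unique)
  define k where "k t = (\<Phi> u x (of_real t * a) * a * G e (of_real t * a)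
      - \<Phi> u x (of_real t * cnj a) * cnj a * G (cnj e) (of_real t * cnj a)) / (2 * pi * \<i>)" for t :: real
  have on: "onorm u \<ge> 0" by (rule onorm_pos_le[OF bounded_clinearD(1)[OF u]])
  have int: "set_integrable lborel {0..} (\<lambda>t. \<Phi> u x (of_real t * b) * b * G d (of_real t * b))" if "side b d" for b d
    using ray_pairing_integrand[OF \<Phi>_holomorphic[OF u] \<epsilon> \<Phi>_bound[OF bounded_clinearD(6)[OF u] on], of b d] that by blast
  have ki: "set_integrable lborel {0..} k"
    unfolding k_def[abs_def] by (intro set_integrable_divide set_integral_diff(1) int[OF sides(1)] int[OF sides(2)])
  have uH: "u (H x t) = k t" for t
    unfolding H_def bounded_clinearD(4)[OF u] bounded_clinearD(2)[OF u] scaleC_complex_def k_def coeff_def \<Phi>_def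
    by (simp add: field_simps)
  have "u (integral {0..real n} (H x)) = (LINT t:{0..real n}|lborel. k t)" for n
  proof -
    have "u (integral {0..real n} (H x)) = integral {0..real n} (u \<circ> H x)"
      by (rule integral_linear[OF H_integrable bounded_clinearD(1)[OF u], symmetric])
    also have "u \<circ> H x = k" by (auto simp: uH)
    also have "integral {0..real n} k = (LINT t:{0..real n}|lborel. k t)"
      by (rule set_borel_integral_eq_integral(2)[symmetric], rule set_integrable_subset[OF ki]) auto
    finally show ?thesis .
  qed
  moreover have "((\<lambda>b. LINT t:{0..b}|lborel. k t) \<longlongrightarrow> (LINT t:{0..}|lborel. k t)) at_top"
    using ki by (intro tendsto_set_lebesgue_integral_at_top) auto
  then have "(\<lambda>n. LINT t:{0..real n}|lborel. k t) \<longlonglongrightarrow> (LINT t:{0..}|lborel. k t)"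
    by (rule filterlim_compose[OF _ filterlim_real_sequentially])
  moreover have "(LINT t:{0..}|lborel. k t) = pairing (\<Phi> u x)"
    unfolding k_def pairing_def ray_pairing_def
    by (simp add: set_integral_diff(2)[OF int[OF sides(1)] int[OF sides(2)]])
  ultimately show "(\<lambda>n. u (integral {0..real n} (H x))) \<longlonglongrightarrow> pairing (\<Phi> u x)" by simp
  show "(\<lambda>n. u (integral {0..real n} (H x))) \<longlonglongrightarrow> u (R x)"
    by (rule bounded_linear.tendsto[OF bounded_clinearD(1)[OF u] R_lim])
qed

lemma R_bound: "norm (R x) \<le> bound / (2 * pi) * M / cmod (1 - \<zeta>) * norm x"
proof -
  obtain u :: "'a \<Rightarrow> complex" where u: "bounded_clinear u" "\<And>y. cmod (u y) \<le> norm y" "u (R x) = norm (R x)"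
    by (rule norming_functional[of "R x"]) blast
  have "norm (R x) = cmod (pairing (\<Phi> u x))" using u(3) R_functional[OF u(1), of x] by (metis abs_norm_cancel norm_of_real)
  also have "\<dots> \<le> bound / (2 * pi) * (1 * (M * norm x)) / cmod (1 - \<zeta>)"
    by (rule pairing_bound[OF \<Phi>_holomorphic[OF u(1)] \<epsilon> \<Phi>_bound]) (use u(2) in auto)
  finally show ?thesis by simp
qed

lemma R_clinear: "bounded_clinear R"
  by (rule bounded_clinearI[OF R_add R_scaleC R_bound])

text \<open>\<open>S t\<close> shifts the argument of \<open>F\<close> by \<open>t\<close>, while
  the damping contributes the compensating factor \<open>exp (- \<epsilon> * t)\<close>.\<close>

lemma \<Phi>_shift:
  assumes u: "bounded_clinear u" and t: "t \<ge> 0"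
  shows "of_real (exp (- \<epsilon> * t)) * u (S t (R x)) = pairing (\<lambda>w. \<Phi> u x (of_real t + w))"
proof -
  have "u (S t (R x)) = pairing (\<Phi> (\<lambda>y. u (S t y)) x)"
    by (rule R_functional[OF bounded_clinear_compose[OF u S_clinear[OF t]]])
  moreover have "of_real (exp (- \<epsilon> * t)) * \<Phi> (\<lambda>y. u (S t y)) x w = \<Phi> u x (of_real t + w)" if "w \<in> wedge a" for w
    using S_F[OF t wedge_sector[OF that]]
    by (simp add: \<Phi>_def E_def add.left_commute exp_of_real[symmetric] mult.assoc[symmetric] exp_add[symmetric] algebra_simps)
  then have "of_real (exp (- \<epsilon> * t)) * ray_pairing b d (\<Phi> (\<lambda>y. u (S t y)) x) = ray_pairing b d (\<lambda>w. \<Phi> u x (of_real t + w))"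
    if bd: "side b d" for b d
    unfolding ray_pairing_def set_integral_mult_right[symmetric] mult.assoc[symmetric]
    by (intro set_lebesgue_integral_cong) (auto simp: side_wedge(1)[OF bd])
  from this[OF sides(1)] this[OF sides(2)]
  have "of_real (exp (- \<epsilon> * t)) * pairing (\<Phi> (\<lambda>y. u (S t y)) x) = pairing (\<lambda>w. \<Phi> u x (of_real t + w))"
    unfolding pairing_def by (simp add: right_diff_distrib)
  ultimately show ?thesis by simp
qed

text \<open>The scalar equation tested against all functionals. The value at \<delta> is a damped
  \<open>S (\<delta> + h) x\<close> instead of \<open>x\<close>: this is the price of the
  regularizations, and it tends to \<open>x\<close> as they are removed.\<close>

lemma R_resolvent:
  "\<zeta> *\<^sub>C R x - (\<Sum>k\<in>K. (p k * exp (- \<epsilon> * s k)) *\<^sub>R S (s k) (R x)) = exp (- \<epsilon> * (\<delta> + h)) *\<^sub>R S (\<delta> + h) x"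
proof (rule eq_if_functionals_eq)
  fix u :: "'a \<Rightarrow> complex" assume u: "bounded_clinear u"
  have on: "onorm u \<ge> 0" by (rule onorm_pos_le[OF bounded_clinearD(1)[OF u]])
  interpret u: bounded_linear u by (rule bounded_clinearD(1)[OF u])
  have "u (\<zeta> *\<^sub>C R x - (\<Sum>k\<in>K. (p k * exp (- \<epsilon> * s k)) *\<^sub>R S (s k) (R x))) =
    \<zeta> * pairing (\<Phi> u x) - (\<Sum>k\<in>K. of_real (p k) * pairing (\<lambda>w. \<Phi> u x (of_real (s k) + w)))"
    using s by (simp add: u.diff u.sum u.scaleR bounded_clinearD(2)[OF u] scaleC_complex_def R_functional[OF u]
        \<Phi>_shift[OF u, symmetric] scaleR_conv_of_real mult.assoc)
  also have "\<dots> = \<Phi> u x (of_real \<delta>)"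
    by (rule pairing_resolvent[OF \<Phi>_holomorphic[OF u] \<epsilon> \<Phi>_bound[OF bounded_clinearD(6)[OF u] on]])
  also have "\<dots> = u (exp (- \<epsilon> * (\<delta> + h)) *\<^sub>R S (\<delta> + h) x)"
    using F_of_real[of "h + \<delta>"] h \<delta>
    by (simp add: \<Phi>_def E_def u.scaleR scaleR_conv_of_real exp_of_real[symmetric] add.commute)
  finally show "u (\<zeta> *\<^sub>C R x - (\<Sum>k\<in>K. (p k * exp (- \<epsilon> * s k)) *\<^sub>R S (s k) (R x)))
      = u (exp (- \<epsilon> * (\<delta> + h)) *\<^sub>R S (\<delta> + h) x)" .
qed

end

section \<open>The lower bound and the Ritt region\<close>

text \<open>With \<open>z = x + \<i> y\<close> the claim is
  \<open>\<tau> cos y + \<bar>sin y\<bar> \<le> \<tau> exp x\<close>, which follows from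
  \<open>\<bar>sin y\<bar> \<le> \<bar>y\<bar> \<le> \<tau> x\<close> and
  \<open>1 + x \<le> exp x\<close>. So 1 - exp (- z) stays in the cone of \<open>z\<close>.\<close>

lemma cone_one_minus_exp:
  assumes "\<bar>Im z\<bar> \<le> \<tau> * Re z" "\<tau> \<ge> 0"
  shows "\<bar>Im (exp (- z))\<bar> \<le> \<tau> * (1 - Re (exp (- z)))"
proof -
  have "\<tau> * cos (Im z) + \<bar>sin (Im z)\<bar> \<le> \<tau> * 1 + \<bar>Im z\<bar>"
    using assms abs_sin_x_le_abs_x[of "Im z"] by (intro add_mono mult_left_mono) auto
  also have "\<dots> \<le> \<tau> * (1 + Re z)" using assms by (simp add: distrib_left)
  also have "\<dots> \<le> \<tau> * exp (Re z)" using assms exp_ge_add_one_self[of "Re z"] by (intro mult_left_mono) auto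
  finally have "exp (- Re z) * (\<tau> * cos (Im z) + \<bar>sin (Im z)\<bar>) \<le> exp (- Re z) * (\<tau> * exp (Re z))"
    by (intro mult_left_mono) auto
  then have "exp (- Re z) * \<bar>sin (Im z)\<bar> \<le> \<tau> - \<tau> * (exp (- Re z) * cos (Im z))"
    by (simp add: algebra_simps exp_minus field_simps)
  then show ?thesis
    by (simp add: Re_exp Im_exp abs_mult right_diff_distrib)
qed

text \<open>For \<open>Re z \<le> 1\<close> both sides are compared with \<open>Re z\<close>; beyond
  that the left side is at most 2 and \<open>1 - exp (- Re z)\<close> at least 1/2.\<close>

lemma one_minus_exp_cone_bound:
  assumes z: "\<bar>Im z\<bar> \<le> \<tau> * Re z" and \<tau>: "\<tau> \<ge> 0" and x: "Re z \<ge> 0"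
  shows "cmod (1 - exp (- z)) \<le> 4 * (1 + \<tau>) * (1 - exp (- Re z))"
proof -
  have e: "exp (- Re z) \<le> 1 / (1 + Re z)"
    using exp_ge_add_one_self[of "Re z"] x by (simp add: exp_minus field_simps)
  have d: "1 - exp (- Re z) \<ge> Re z / (1 + Re z)"
    using e x by (simp add: field_simps)
  show ?thesis
  proof (cases "Re z \<le> 1")
    case True
    have "cmod (1 - exp (- z)) \<le> exp 0 * cmod (0 - - z)"
      using norm_exp_diff_le[of 0 0 "- z"] x by simp
    also have "\<dots> \<le> \<bar>Re z\<bar> + \<bar>Im z\<bar>" using cmod_le[of z] by simp
    also have "\<dots> \<le> (1 + \<tau>) * Re z" using z x by (simp add: algebra_simps)
    also have "Re z \<le> 2 * (Re z / (1 + Re z))" using True x by (simp add: field_simps mult_left_le)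
    then have "(1 + \<tau>) * Re z \<le> (1 + \<tau>) * (2 * (1 - exp (- Re z)))"
      using d \<tau> by (intro mult_left_mono) auto
    also have "\<dots> \<le> 4 * (1 + \<tau>) * (1 - exp (- Re z))"
    proof -
      have "0 \<le> (1 + \<tau>) * (1 - exp (- Re z))" using \<tau> x by (intro mult_nonneg_nonneg) auto
      then show ?thesis by (simp only: mult.left_commute[of "1 + \<tau>" 2] mult.assoc)
    qed
    finally show ?thesis .
  next
    case False
    have "1 / (1 + Re z) \<le> 1 / 2" using False by (intro divide_left_mono) auto
    with e have half: "1 - exp (- Re z) \<ge> 1 / 2" by simp
    have "cmod (1 - exp (- z)) \<le> 4 * 1 * (1 / 2)"
      using norm_triangle_ineq4[of 1 "exp (- z)"] x by (simp add: order_trans)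
    also have "\<dots> \<le> 4 * (1 + \<tau>) * (1 - exp (- Re z))"
      using \<tau> half by (intro mult_mono) auto
    finally show ?thesis .
  qed
qed

text \<open>A real linear form \<open>l\<close> separates the points: its slope
  \<open>\<tau> + \<eta>\<close> is halfway between the two cones and its sign \<sigma> selects the
  side of \<open>v\<close>. It is at least a multiple of \<open>Re W\<close> at \<open>W\<close>, at
  most a negative multiple of \<open>cmod v\<close> at \<open>v\<close>, and Lipschitz with constant
  at most \<open>1 + \<tau>'\<close>.\<close>

lemma cone_separation:
  fixes W v :: complex
  assumes W: "\<bar>Im W\<bar> \<le> \<tau> * Re W" "Re W \<ge> 0" and v: "\<bar>Im v\<bar> > \<tau>' * Re v" and \<tau>: "0 \<le> \<tau>" "\<tau> < \<tau>'"
  shows "cmod v + Re W \<le> 2 * (1 + \<tau>')\<^sup>2 / (\<tau>' - \<tau>) * cmod (W - v)"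
proof -
  define \<eta> where "\<eta> = (\<tau>' - \<tau>) / 2"
  have \<eta>: "\<eta> > 0" "\<eta> \<le> \<tau>'" "\<tau>' > 0" using \<tau> by (auto simp: \<eta>_def)
  define \<sigma> where "\<sigma> = (if Im v \<ge> 0 then 1 else - 1 :: real)"
  have \<sigma>: "\<sigma> * Im v = \<bar>Im v\<bar>" "\<bar>\<sigma>\<bar> = 1" by (auto simp: \<sigma>_def)
  define l where "l u = (\<tau> + \<eta>) * Re u - \<sigma> * Im u" for u
  have "\<sigma> * Im W \<le> \<bar>Im W\<bar>" using \<sigma>(2) by (metis abs_ge_self abs_mult mult_1)
  with W(1) have lW: "l W \<ge> \<eta> * Re W" by (simp add: l_def algebra_simps)
  have lv: "\<eta> * cmod v \<le> (1 + \<tau>') * (- l v)"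
  proof (cases "Re v \<ge> 0")
    case True
    have "\<eta> * cmod v \<le> \<eta> * (Re v + \<bar>Im v\<bar>)" using cmod_le[of v] True \<eta> by (intro mult_left_mono) auto
    also have "\<dots> \<le> (1 + \<tau>') * (\<bar>Im v\<bar> - (\<tau> + \<eta>) * Re v)"
    proof -
      have te: "\<tau> + \<eta> = \<tau>' - \<eta>" by (simp add: \<eta>_def field_simps)
      have "(1 + \<tau>' - \<eta>) * (\<tau>' * Re v) \<le> (1 + \<tau>' - \<eta>) * \<bar>Im v\<bar>"
        using v \<eta> by (intro mult_left_mono) auto
      then show ?thesis unfolding te by (simp add: algebra_simps)
    qed
    finally show ?thesis using \<sigma> by (simp add: l_def)
  next
    case False
    have "\<eta> * cmod v \<le> \<eta> * (\<bar>Im v\<bar> + - Re v)" using cmod_le[of v] False \<eta> by (intro mult_left_mono) auto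
    also have "\<dots> = \<eta> * \<bar>Im v\<bar> + \<eta> * (- Re v)" by (simp add: algebra_simps)
    also have "\<dots> \<le> (1 + \<tau>') * \<bar>Im v\<bar> + (1 + \<tau>') * (\<tau> + \<eta>) * (- Re v)"
    proof (intro add_mono mult_right_mono)
      have "1 * (\<tau> + \<eta>) \<le> (1 + \<tau>') * (\<tau> + \<eta>)" using \<eta> \<tau> by (intro mult_right_mono) auto
      then show "\<eta> \<le> (1 + \<tau>') * (\<tau> + \<eta>)" using \<tau> by simp
    qed (use \<eta> False in auto)
    also have "\<dots> = (1 + \<tau>') * (- l v)" using \<sigma> by (simp add: l_def algebra_simps)
    finally show ?thesis .
  qed
  have "l W - l v = (\<tau> + \<eta>) * Re (W - v) - \<sigma> * Im (W - v)" by (simp add: l_def algebra_simps)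
  also have "\<dots> \<le> (\<tau> + \<eta>) * cmod (W - v) + cmod (W - v)"
  proof -
    have "(\<tau> + \<eta>) * Re (W - v) \<le> (\<tau> + \<eta>) * cmod (W - v)"
      using \<tau> \<eta> by (intro mult_left_mono complex_Re_le_cmod) auto
    moreover have "- (\<sigma> * Im (W - v)) \<le> cmod (W - v)"
      using abs_Im_le_cmod[of "W - v"] \<sigma>(2) abs_ge_minus_self[of "\<sigma> * Im (W - v)"]
      unfolding abs_mult by simp
    ultimately show ?thesis by linarith
  qed
  also have "\<dots> \<le> (1 + \<tau>') * cmod (W - v)"
  proof -
    have "(\<tau> + \<eta> + 1) * cmod (W - v) \<le> (1 + \<tau>') * cmod (W - v)"
      using \<tau> by (intro mult_right_mono) (auto simp: \<eta>_def field_simps)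
    then show ?thesis by (simp add: algebra_simps)
  qed
  finally have L: "l W - l v \<le> (1 + \<tau>') * cmod (W - v)" .
  have "\<eta> * Re W \<le> (1 + \<tau>') * l W"
    using mult_mono[of 1 "1 + \<tau>'" "\<eta> * Re W" "l W"] lW W(2) \<eta> by simp
  then have "\<eta> * (cmod v + Re W) \<le> (1 + \<tau>') * (l W - l v)" using lv by (simp add: algebra_simps)
  also have "\<dots> \<le> (1 + \<tau>') * ((1 + \<tau>') * cmod (W - v))" using L \<eta> by (intro mult_left_mono) auto
  finally have "cmod v + Re W \<le> (1 + \<tau>') * ((1 + \<tau>') * cmod (W - v)) / \<eta>"
    using \<eta> by (simp add: field_simps)
  also have "\<dots> = 2 * (1 + \<tau>')\<^sup>2 / (\<tau>' - \<tau>) * cmod (W - v)"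
    by (simp add: \<eta>_def power2_eq_square)
  finally show ?thesis .
qed

text \<open>If \<open>cmod \<zeta> > 1\<close>, then \<open>cmod f \<le> 1 - B\<close> gives
  \<open>cmod (\<zeta> - f) \<ge> B\<close>, and \<open>1 - f\<close> is at most
  \<open>4 * (1 + \<tau>) * B\<close>; adding \<open>1\<close>, \<open>4 * (1 + \<tau>)\<close> and
  \<open>1\<close> explains \<open>6 + 4 * \<tau>\<close>. Otherwise \<open>cone_separation\<close>
  applies to \<open>W = 1 - f\<close> and \<open>v = 1 - \<zeta>\<close>, whose difference is
  \<open>\<zeta> - f\<close>.\<close>

lemma dirichlet_lower_bound:
  fixes \<zeta> z :: complex and p s :: "'k \<Rightarrow> real"
  assumes p: "\<And>k. k \<in> K \<Longrightarrow> p k \<ge> 0" "sum p K = 1" and s: "\<And>k. k \<in> K \<Longrightarrow> s k \<ge> 0"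
    and z: "\<bar>Im z\<bar> \<le> \<tau> * Re z" "Re z \<ge> 0" and \<tau>: "0 \<le> \<tau>" "\<tau> < \<tau>'"
    and \<zeta>: "cmod \<zeta> > 1 \<or> \<bar>Im (1 - \<zeta>)\<bar> > \<tau>' * Re (1 - \<zeta>)"
  shows "cmod (1 - \<zeta>) + (\<Sum>k\<in>K. p k * (1 - exp (- s k * Re z))) \<le>
    max (6 + 4 * \<tau>) (2 * (1 + \<tau>')\<^sup>2 / (\<tau>' - \<tau>)) * cmod (\<zeta> - (\<Sum>k\<in>K. of_real (p k) * exp (- of_real (s k) * z)))"
proof -
  define f where "f = (\<Sum>k\<in>K. of_real (p k) * exp (- of_real (s k) * z))"
  define B where "B = (\<Sum>k\<in>K. p k * (1 - exp (- s k * Re z)))"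
  have cone: "\<bar>Im (of_real (s k) * z)\<bar> \<le> \<tau> * Re (of_real (s k) * z)" if "k \<in> K" for k
    using mult_left_mono[OF z(1) s[OF that]] s[OF that] by (simp add: abs_mult ac_simps)
  have one: "1 - f = (\<Sum>k\<in>K. of_real (p k) * (1 - exp (- of_real (s k) * z)))"
    using p(2) by (simp add: f_def right_diff_distrib sum_subtractf flip: of_real_sum)
  have oneB: "1 - B = (\<Sum>k\<in>K. p k * exp (- s k * Re z))"
    using p(2) by (simp add: B_def right_diff_distrib sum_subtractf)
  have fle: "cmod f \<le> 1 - B"
    unfolding oneB f_def using p(1) by (intro sum_norm_le) (auto simp: norm_mult)
  have f1: "cmod (1 - f) \<le> 4 * (1 + \<tau>) * B"
    unfolding one B_def sum_distrib_left
  proof (rule sum_norm_le)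
    fix k assume k: "k \<in> K"
    have "cmod (1 - exp (- (of_real (s k) * z))) \<le> 4 * (1 + \<tau>) * (1 - exp (- Re (of_real (s k) * z)))"
      by (rule one_minus_exp_cone_bound[OF cone[OF k] \<tau>(1)]) (use s[OF k] z in auto)
    from mult_left_mono[OF this p(1)[OF k]]
    show "norm (of_real (p k) * (1 - exp (- of_real (s k) * z))) \<le> 4 * (1 + \<tau>) * (p k * (1 - exp (- s k * Re z)))"
      using p(1)[OF k] by (simp add: norm_mult ac_simps)
  qed
  have B0: "B \<ge> 0" unfolding B_def using p s z by (intro sum_nonneg mult_nonneg_nonneg) auto
  have ReB: "B \<le> Re (1 - f)"
  proof -
    have "Re f \<le> 1 - B" using complex_Re_le_cmod[of f] fle by linarith
    then show ?thesis by simp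
  qed
  have Imf: "\<bar>Im (1 - f)\<bar> \<le> \<tau> * Re (1 - f)"
  proof -
    have "\<bar>Im (1 - f)\<bar> \<le> (\<Sum>k\<in>K. \<bar>p k * Im (1 - exp (- of_real (s k) * z))\<bar>)"
    proof -
      have "Im (1 - f) = (\<Sum>k\<in>K. p k * Im (1 - exp (- of_real (s k) * z)))"
        unfolding one Im_sum by (intro sum.cong) auto
      then show ?thesis by (simp only: sum_abs)
    qed
    also have "\<dots> \<le> (\<Sum>k\<in>K. \<tau> * (p k * Re (1 - exp (- of_real (s k) * z))))"
    proof (rule sum_mono)
      fix k assume k: "k \<in> K"
      from mult_left_mono[OF cone_one_minus_exp[OF cone[OF k] \<tau>(1)] p(1)[OF k]]
      show "\<bar>p k * Im (1 - exp (- of_real (s k) * z))\<bar> \<le> \<tau> * (p k * Re (1 - exp (- of_real (s k) * z)))"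
        using p(1)[OF k] by (simp add: abs_mult ac_simps)
    qed
    also have "\<dots> = \<tau> * Re (1 - f)" unfolding one by (simp add: sum_distrib_left)
    finally show ?thesis .
  qed
  have "cmod (1 - \<zeta>) + B \<le> (6 + 4 * \<tau>) * cmod (\<zeta> - f) \<or>
    cmod (1 - \<zeta>) + B \<le> (2 * (1 + \<tau>')\<^sup>2 / (\<tau>' - \<tau>)) * cmod (\<zeta> - f)"
    using \<zeta>
  proof
    assume "cmod \<zeta> > 1"
    then have d: "B \<le> cmod (\<zeta> - f)" using norm_triangle_ineq2[of \<zeta> f] fle by linarith
    have "cmod (1 - \<zeta>) \<le> cmod (\<zeta> - f) + cmod (1 - f)"
      using norm_triangle_ineq4[of "1 - f" "\<zeta> - f"] by simp
    also have "\<dots> \<le> cmod (\<zeta> - f) + 4 * (1 + \<tau>) * cmod (\<zeta> - f)"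
      by (intro add_left_mono order_trans[OF f1 mult_left_mono[OF d]]) (use \<tau> in auto)
    finally show ?thesis using d by (simp add: algebra_simps)
  next
    assume "\<bar>Im (1 - \<zeta>)\<bar> > \<tau>' * Re (1 - \<zeta>)"
    from cone_separation[OF Imf _ this \<tau>] ReB B0 show ?thesis by simp
  qed
  then show ?thesis
    unfolding f_def[symmetric] B_def[symmetric]
    by (elim disjE order_trans) (intro mult_right_mono; simp)+
qed

section \<open>Closed sectors and the Ritt region\<close>

lemma closed_wedge_subset_closure_sector:
  assumes "0 < \<phi>" "\<phi> < pi / 2" "\<bar>Im v\<bar> * cos \<phi> \<le> sin \<phi> * Re v"
  shows "v \<in> closure (sector \<phi>)"
  unfolding closure_sequential
proof (intro exI conjI allI)
  let ?w = "\<lambda>n. v + of_real (1 / real (Suc n))"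
  have s: "sin \<phi> > 0" using assms by (intro sin_gt_zero) auto
  show "?w n \<in> sector \<phi>" for n
  proof -
    have "sin \<phi> * (1 / real (Suc n)) > 0" using s by simp
    with assms(3) have "\<bar>Im v\<bar> * cos \<phi> < sin \<phi> * (Re v + 1 / real (Suc n))" by (simp only: distrib_left)
    then show ?thesis using assms by (subst sector_eq) simp_all
  qed
  have "?w \<longlonglongrightarrow> v + of_real 0"
    by (intro tendsto_intros LIMSEQ_Suc[OF lim_inverse_n'])
  then show "?w \<longlonglongrightarrow> v" by simp
qed

lemma closure_sector_subset:
  assumes "0 < \<phi>" "\<phi> < pi / 2" "v \<in> closure (sector \<phi>)"
  shows "\<bar>Im v\<bar> * cos \<phi> \<le> sin \<phi> * Re v"
proof -
  have "closed {v. \<bar>Im v\<bar> * cos \<phi> \<le> sin \<phi> * Re v}" by (intro closed_Collect_le continuous_intros)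
  moreover have "sector \<phi> \<subseteq> {v. \<bar>Im v\<bar> * cos \<phi> \<le> sin \<phi> * Re v}" using assms by (subst sector_eq) auto
  ultimately have "closure (sector \<phi>) \<subseteq> {v. \<bar>Im v\<bar> * cos \<phi> \<le> sin \<phi> * Re v}" by (rule closure_minimal[rotated])
  with assms show ?thesis by auto
qed

lemma ritt_region_iff: "z \<in> ritt_region \<phi> \<longleftrightarrow> 1 - z \<in> closure (sector \<phi>) \<and> cmod z \<le> 1"
  unfolding ritt_region_def by (auto intro!: image_eqI[of _ _ "1 - z"])

lemma not_in_ritt_region:
  assumes \<phi>: "0 < \<phi>" "\<phi> < pi / 2" and z: "z \<notin> ritt_region \<phi>"
  shows "cmod z > 1 \<or> \<bar>Im (1 - z)\<bar> > tan \<phi> * Re (1 - z)" "z \<noteq> 1"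
proof -
  have c: "cos \<phi> > 0" using \<phi> by (intro cos_gt_zero) auto
  show "cmod z > 1 \<or> \<bar>Im (1 - z)\<bar> > tan \<phi> * Re (1 - z)"
  proof (rule ccontr)
    assume *: "\<not> (cmod z > 1 \<or> \<bar>Im (1 - z)\<bar> > tan \<phi> * Re (1 - z))"
    then have "\<bar>Im (1 - z)\<bar> \<le> tan \<phi> * Re (1 - z)" by simp
    from mult_right_mono[OF this, of "cos \<phi>"] have "\<bar>Im (1 - z)\<bar> * cos \<phi> \<le> sin \<phi> * Re (1 - z)"
      using c by (simp add: tan_def)
    from closed_wedge_subset_closure_sector[OF \<phi> this] * z show False by (simp add: ritt_region_iff)
  qed
  show "z \<noteq> 1"
    using closed_wedge_subset_closure_sector[OF \<phi>, of 0] z by (auto simp: ritt_region_iff)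
qed

text \<open>Resolvent estimates are available only for angles strictly larger than \<phi>, while the
  spectral inclusion concerns \<phi> itself. Lying outside the region is stable under a small
  increase of the angle.\<close>

lemma ritt_region_enlarge:
  assumes \<phi>: "0 \<le> \<phi>" "\<phi> < pi / 2" and z: "z \<notin> ritt_region \<phi>"
  obtains \<phi>' where "\<phi> < \<phi>'" "\<phi>' < pi / 2" "z \<notin> ritt_region \<phi>'"
proof (cases "cmod z > 1")
  case True
  then show thesis using \<phi> by (intro that[of "(\<phi> + pi / 2) / 2"]) (auto simp: ritt_region_iff)
next
  case False
  define v where "v = 1 - z"
  have v: "v \<notin> closure (sector \<phi>)" using z False by (simp add: ritt_region_iff v_def)
  define k where "k x = \<bar>Im v\<bar> * cos x - sin x * Re v" for x
  have out: "z \<notin> ritt_region x" if "\<phi> < x" "x < pi / 2" "k x > 0" for x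
    using closure_sector_subset[of x v] that \<phi> by (auto simp: ritt_region_iff k_def v_def)
  show thesis
  proof (cases "k \<phi> > 0")
    case True
    have "(k \<longlongrightarrow> k \<phi>) (at_right \<phi>)" unfolding k_def[abs_def] by (intro tendsto_intros)
    from order_tendstoD(1)[OF this True] eventually_at_right_real[OF \<phi>(2)]
    have "\<forall>\<^sub>F x in at_right \<phi>. k x > 0 \<and> x \<in> {\<phi><..<pi / 2}" by (rule eventually_conj)
    from eventually_happens[OF this] obtain x where "k x > 0" "x \<in> {\<phi><..<pi / 2}"
      using trivial_limit_at_right_real[of \<phi>] by blast
    then show thesis using out by (intro that[of x]) auto
  next
    case False
    \<comment> \<open>For positive \<phi> the sign of \<open>k\<close> decides membership. For the
      degenerate sector \<open>k 0 = \<bar>Im v\<bar>\<close> misses the negative half-axis; such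
      \<open>v\<close> stays outside even for the angle \<open>pi / 4\<close>.\<close>
    have "\<phi> = 0"
    proof (rule ccontr)
      assume "\<phi> \<noteq> 0"
      with \<phi> closed_wedge_subset_closure_sector[of \<phi> v] False v show False by (auto simp: k_def)
    qed
    with False have Im: "Im v = 0" by (simp add: k_def)
    have "Re v < 0"
    proof (rule ccontr)
      assume "\<not> Re v < 0"
      have "v \<in> closure (complex_of_real ` {0<..})"
        unfolding closure_sequential
      proof (intro exI conjI allI)
        let ?w = "\<lambda>n. of_real (Re v + 1 / real (Suc n)) :: complex"
        show "?w n \<in> complex_of_real ` {0<..}" for n
        proof -
          have "1 / real (Suc n) > 0" by simp
          with \<open>\<not> Re v < 0\<close> have "Re v + 1 / real (Suc n) > 0" by linarith
          then show ?thesis by (intro imageI) simp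
        qed
        have "?w \<longlonglongrightarrow> of_real (Re v + 0)"
          by (intro tendsto_intros LIMSEQ_Suc[OF lim_inverse_n'])
        moreover have "of_real (Re v + 0) = v" using Im by (simp add: complex_eq_iff)
        ultimately show "?w \<longlonglongrightarrow> v" by simp
      qed
      with v \<open>\<phi> = 0\<close> show False by (simp add: sector_def)
    qed
    moreover have "sin (pi / 4) > 0" by (intro sin_gt_zero) auto
    ultimately have "k (pi / 4) > 0" using Im by (simp add: k_def mult_pos_neg)
    then show thesis using \<open>\<phi> = 0\<close> out[of "pi / 4"] by (intro that[of "pi / 4"]) auto
  qed
qed

section \<open>Discretization of the integral\<close>

text \<open>In a nonseparable space a difference of measurable functions may fail to be measurable.
  Here \<open>s\<close> takes finitely many values, and on each level set a constant is
  subtracted.\<close>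

lemma borel_measurable_norm_diff_simple:
  fixes f :: "'m \<Rightarrow> 'b::real_normed_vector"
  assumes f: "f \<in> borel_measurable M" and s: "simple_function M s"
  shows "(\<lambda>x. norm (f x - s x)) \<in> borel_measurable M"
  unfolding borel_measurable_iff_greater
proof
  fix c :: real
  have "{x \<in> space M. c < norm (f x - s x)} =
     (\<Union>y\<in>s ` space M. (s -` {y} \<inter> space M) \<inter> {x \<in> space M. c < norm (f x - y)})"
    by auto
  also have "\<dots> \<in> sets M"
  proof (rule sets.finite_UN[OF simple_functionD(1)[OF s]], rule sets.Int[OF simple_functionD(2)[OF s]])
    fix y :: 'b
    have "(\<lambda>z. norm (z - y)) \<in> borel_measurable borel"
      by (intro borel_measurable_continuous_onI continuous_intros)
    from measurable_compose[OF f this] show "{x \<in> space M. c < norm (f x - y)} \<in> sets M"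
      unfolding borel_measurable_iff_greater by blast
  qed
  finally show "{x \<in> space M. c < norm (f x - s x)} \<in> sets M" .
qed

lemma simple_bochner_integral_dist_le:
  fixes f :: "'m \<Rightarrow> 'b::real_normed_vector"
  assumes f: "f \<in> borel_measurable M"
    and s: "Bochner_Integration.simple_bochner_integrable M s" and t: "Bochner_Integration.simple_bochner_integrable M t"
  shows "ennreal (norm (Bochner_Integration.simple_bochner_integral M s - Bochner_Integration.simple_bochner_integral M t)) \<le>
    (\<integral>\<^sup>+x. norm (f x - s x) \<partial>M) + (\<integral>\<^sup>+x. norm (f x - t x) \<partial>M)"
proof -
  have sf: "simple_function M s" "simple_function M t"
    using s t by (auto elim: Bochner_Integration.simple_bochner_integrable.cases)
  note [measurable] = borel_measurable_norm_diff_simple[OF f sf(1)] borel_measurable_norm_diff_simple[OF f sf(2)]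
  have d: "Bochner_Integration.simple_bochner_integrable M (\<lambda>x. s x - t x)"
    using s t by (rule Bochner_Integration.simple_bochner_integrable_compose2[rotated]) simp
  have n: "Bochner_Integration.simple_bochner_integrable M (\<lambda>x. norm (s x - t x))"
    using s t by (rule Bochner_Integration.simple_bochner_integrable_compose2[rotated]) simp
  have "ennreal (norm (Bochner_Integration.simple_bochner_integral M s - Bochner_Integration.simple_bochner_integral M t))
     = norm (Bochner_Integration.simple_bochner_integral M (\<lambda>x. s x - t x))"
    by (simp add: Bochner_Integration.simple_bochner_integral_diff[OF s t])
  also have "\<dots> \<le> Bochner_Integration.simple_bochner_integral M (\<lambda>x. norm (s x - t x))"
    by (intro ennreal_leI Bochner_Integration.simple_bochner_integral_norm_bound d)
  also have "\<dots> = (\<integral>\<^sup>+x. norm (s x - t x) \<partial>M)"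
    by (rule Bochner_Integration.simple_bochner_integral_eq_nn_integral[OF n]) simp
  also have "\<dots> \<le> (\<integral>\<^sup>+x. ennreal (norm (f x - s x)) + ennreal (norm (f x - t x)) \<partial>M)"
  proof (rule nn_integral_mono)
    fix x
    have "norm (s x - t x) \<le> norm (f x - s x) + norm (f x - t x)"
      using norm_triangle_ineq4[of "f x - t x" "f x - s x"] by simp
    then show "ennreal (norm (s x - t x)) \<le> ennreal (norm (f x - s x)) + ennreal (norm (f x - t x))"
      by (simp flip: ennreal_plus)
  qed
  also have "\<dots> = (\<integral>\<^sup>+x. norm (f x - s x) \<partial>M) + (\<integral>\<^sup>+x. norm (f x - t x) \<partial>M)"
    by (rule nn_integral_add) measurable
  finally show ?thesis .
qed

text \<open>Completeness yields a limit, and comparing two approximating sequences shows it to be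
  unique. Hence the \<open>THE\<close> in the definition picks this limit.\<close>

lemma tendsto_banach_integral:
  fixes f :: "'m \<Rightarrow> 'b::banach"
  assumes f: "f \<in> borel_measurable M"
    and s: "\<And>i. Bochner_Integration.simple_bochner_integrable M (s i)"
    and lim: "(\<lambda>i. \<integral>\<^sup>+x. norm (f x - s i x) \<partial>M) \<longlonglongrightarrow> 0"
  shows "(\<lambda>i. Bochner_Integration.simple_bochner_integral M (s i)) \<longlonglongrightarrow> banach_integral M f"
proof -
  let ?I = "\<lambda>i. Bochner_Integration.simple_bochner_integral M (s i)"
  have "Cauchy ?I"
  proof (rule metric_CauchyI)
    fix e :: real assume e: "e > 0"
    then have "ennreal (e / 2) > 0" by simp
    from order_tendstoD(2)[OF lim this] obtain N
      where N: "\<And>i. i \<ge> N \<Longrightarrow> (\<integral>\<^sup>+x. norm (f x - s i x) \<partial>M) < ennreal (e / 2)"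
      unfolding eventually_sequentially by blast
    show "\<exists>N. \<forall>m\<ge>N. \<forall>n\<ge>N. dist (?I m) (?I n) < e"
    proof (intro exI allI impI)
      fix m n assume mn: "m \<ge> N" "n \<ge> N"
      have "ennreal (norm (?I m - ?I n)) < ennreal (e / 2) + ennreal (e / 2)"
        by (rule le_less_trans[OF simple_bochner_integral_dist_le[OF f s s] add_strict_mono[OF N[OF mn(1)] N[OF mn(2)]]])
      also have "\<dots> = ennreal e" using e by (simp flip: ennreal_plus)
      finally show "dist (?I m) (?I n) < e" using e by (simp add: dist_norm ennreal_less_iff)
    qed
  qed
  then obtain y where y: "?I \<longlonglongrightarrow> y" using Cauchy_convergent convergent_def by blast
  have hy: "has_banach_integral M f y"
    unfolding has_banach_integral_def using f s lim y by blast
  have "y' = y" if y': "has_banach_integral M f y'" for y'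
  proof -
    obtain t where t: "\<And>i. Bochner_Integration.simple_bochner_integrable M (t i)"
      "(\<lambda>i. \<integral>\<^sup>+x. norm (f x - t i x) \<partial>M) \<longlonglongrightarrow> 0"
      "(\<lambda>i. Bochner_Integration.simple_bochner_integral M (t i)) \<longlonglongrightarrow> y'"
      using y' unfolding has_banach_integral_def by blast
    have "(\<lambda>i. ennreal (norm (Bochner_Integration.simple_bochner_integral M (t i) - ?I i))) \<longlonglongrightarrow> 0"
    proof (rule tendsto_sandwich[OF _ _ tendsto_const])
      show "(\<lambda>i. (\<integral>\<^sup>+x. norm (f x - t i x) \<partial>M) + (\<integral>\<^sup>+x. norm (f x - s i x) \<partial>M)) \<longlonglongrightarrow> 0"
        using tendsto_add[OF t(2) lim] by simp
      show "\<forall>\<^sub>F i in sequentially. ennreal (norm (Bochner_Integration.simple_bochner_integral M (t i) - ?I i))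
          \<le> (\<integral>\<^sup>+x. norm (f x - t i x) \<partial>M) + (\<integral>\<^sup>+x. norm (f x - s i x) \<partial>M)"
        by (intro always_eventually allI simple_bochner_integral_dist_le[OF f t(1) s])
    qed auto
    moreover have "(\<lambda>i. ennreal (norm (Bochner_Integration.simple_bochner_integral M (t i) - ?I i))) \<longlonglongrightarrow> ennreal (norm (y' - y))"
      by (intro tendsto_ennrealI tendsto_norm tendsto_diff t(3) y)
    ultimately have "0 = ennreal (norm (y' - y))" by (rule LIMSEQ_unique)
    from this[symmetric] show ?thesis by (simp add: ennreal_eq_0_iff)
  qed
  then have "(THE y. has_banach_integral M f y) = y" using hy by (rule the_equality[rotated])
  then have "banach_integral M f = y" unfolding banach_integral_def using hy by auto
  with y show ?thesis by simp
qed

context holomorphic_semigroup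
begin

text \<open>At positive times continuity is inherited from the holomorphic extension; at 0 it is the
  strong continuity of the semigroup.\<close>

lemma S_continuous: "continuous_on {0..} (\<lambda>t. S t x)"
  unfolding continuous_on_eq_continuous_within
proof
  fix t :: real assume "t \<in> {0..}"
  then consider "t = 0" | "t > 0" by fastforce
  then show "continuous (at t within {0..}) (\<lambda>t. S t x)"
  proof cases
    case 1
    then show ?thesis
      using S_tendsto[of x] by (simp add: continuous_within S_0 at_within_Ici_at_right)
  next
    case 2
    have "continuous_on {0<..} (\<lambda>t. F (of_real t) x)"
      by (rule continuous_on_compose2[OF F_continuous]) (auto intro!: continuous_intros sector_of_real[OF \<theta>])
    then have "continuous_on {0<..} (\<lambda>t. S t x)"
      by (rule continuous_on_eq) (simp add: F_of_real)
    then have "continuous (at t) (\<lambda>t. S t x)" using 2 by (simp add: continuous_on_eq_continuous_at)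
    then show ?thesis by (rule continuous_at_imp_continuous_at_within)
  qed
qed

end

text \<open>Rounds down to the mesh 1 / (n + 1). The cap at index \<open>(Suc n)\<^sup>2\<close>,
  that is at time n + 1, leaves finitely many nodes; mass beyond it is moved to the last node, so
  the weights still sum to 1.\<close>

definition grid_index :: "nat \<Rightarrow> real \<Rightarrow> nat" where
  "grid_index n t = min (nat \<lfloor>real (Suc n) * t\<rfloor>) ((Suc n)\<^sup>2)"

lemma grid_index_tendsto:
  assumes "t \<ge> 0"
  shows "(\<lambda>n. real (grid_index n t) / real (Suc n)) \<longlonglongrightarrow> t"
proof (rule LIM_zero_cancel)
  show "(\<lambda>n. real (grid_index n t) / real (Suc n) - t) \<longlonglongrightarrow> 0"
  proof (rule Lim_null_comparison)
    show "(\<lambda>n. 1 / real (Suc n)) \<longlonglongrightarrow> 0" by (rule LIMSEQ_Suc[OF lim_inverse_n'])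
    obtain N where N: "t \<le> real N" using real_arch_simple by blast
    show "\<forall>\<^sub>F n in sequentially. norm (real (grid_index n t) / real (Suc n) - t) \<le> 1 / real (Suc n)"
    proof (rule eventually_sequentiallyI)
      fix n assume "N \<le> n"
      define m where "m = real (Suc n)"
      have m: "m > 0" "t \<le> m" using \<open>N \<le> n\<close> N by (auto simp: m_def)
      have mt: "m * t \<ge> 0" using m assms by simp
      have "nat \<lfloor>m * t\<rfloor> \<le> (Suc n)\<^sup>2"
      proof -
        have "real (nat \<lfloor>m * t\<rfloor>) \<le> m * t" using mt by (simp add: of_nat_nat)
        also have "\<dots> \<le> m * m" using m by (intro mult_left_mono) auto
        also have "\<dots> = real ((Suc n)\<^sup>2)" by (simp only: m_def power2_eq_square of_nat_mult)
        finally show ?thesis by linarith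
      qed
      then have "real (grid_index n t) = real_of_int \<lfloor>m * t\<rfloor>"
        unfolding grid_index_def m_def[symmetric] using mt by (subst min_absorb1) auto
      moreover have "\<bar>real_of_int \<lfloor>m * t\<rfloor> - m * t\<bar> \<le> 1" by linarith
      ultimately have "\<bar>real (grid_index n t) - m * t\<bar> / m \<le> 1 / m" using m by (intro divide_right_mono) auto
      moreover have "\<bar>real (grid_index n t) - m * t\<bar> / m = \<bar>real (grid_index n t) / m - t\<bar>"
      proof -
        have "real (grid_index n t) / m - t = (real (grid_index n t) - m * t) / m" using m by (simp add: field_simps)
        then show ?thesis using m by (simp only: abs_divide abs_of_pos)
      qed
      ultimately show "norm (real (grid_index n t) / real (Suc n) - t) \<le> 1 / real (Suc n)" by (simp add: m_def)
    qed
  qed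
qed

definition grid_weight :: "real measure \<Rightarrow> nat \<Rightarrow> nat \<Rightarrow> real" where
  "grid_weight \<mu> n k = measure \<mu> {t \<in> space \<mu>. grid_index n t = k}"

locale subordination = holomorphic_semigroup S F \<theta> for S :: "real \<Rightarrow> 'a::complex_banach \<Rightarrow> 'a" and F \<theta> +
  fixes \<mu> :: "real measure" and M0 :: real
  assumes prob: "prob_space \<mu>" and sets_\<mu>: "sets \<mu> = sets (restrict_space borel {0..})"
    and S_bound: "\<And>t x. t \<ge> 0 \<Longrightarrow> norm (S t x) \<le> M0 * norm x"
begin

lemma space_\<mu>: "space \<mu> = {0..}"
  using sets_eq_imp_space_eq[OF sets_\<mu>] by (simp add: space_restrict_space)

lemma grid_index_measurable: "grid_index n \<in> measurable \<mu> (count_space UNIV)"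
proof -
  have "grid_index n \<in> measurable borel (count_space UNIV)"
    unfolding grid_index_def[abs_def] by measurable
  then have "grid_index n \<in> measurable (restrict_space borel {0..}) (count_space UNIV)"
    by (rule measurable_restrict_space1)
  then show ?thesis by (simp add: measurable_cong_sets[OF sets_\<mu> refl])
qed

lemma grid_index_simple: "simple_function \<mu> (grid_index n)"
proof -
  have "grid_index n ` space \<mu> \<subseteq> {..(Suc n)\<^sup>2}" by (auto simp: grid_index_def)
  then have "finite (grid_index n ` space \<mu>)" by (rule finite_subset) simp
  then show ?thesis
    unfolding simple_function_def using measurable_sets[OF grid_index_measurable] by auto
qed

lemma grid_weight_nonneg: "grid_weight \<mu> n k \<ge> 0"
  by (simp add: grid_weight_def)

lemma sum_grid_weight: "sum (grid_weight \<mu> n) {..(Suc n)\<^sup>2} = 1"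
proof -
  interpret prob_space \<mu> by (rule prob)
  have "sum (grid_weight \<mu> n) {..(Suc n)\<^sup>2} = measure \<mu> (\<Union>k\<in>{..(Suc n)\<^sup>2}. {t \<in> space \<mu>. grid_index n t = k})"
    unfolding grid_weight_def
    by (rule finite_measure_finite_Union[symmetric])
      (use measurable_sets[OF grid_index_measurable, of "{_}"] in \<open>auto simp: disjoint_family_on_def vimage_def Int_def conj_commute\<close>)
  also have "(\<Union>k\<in>{..(Suc n)\<^sup>2}. {t \<in> space \<mu>. grid_index n t = k}) = space \<mu>"
    by (auto simp: grid_index_def)
  finally show ?thesis by (simp add: prob_space)
qed

definition average :: "'a \<Rightarrow> 'a" where "average x = banach_integral \<mu> (\<lambda>t. S t x)"

text \<open>The sum is the integral of the step function \<open>S\<close> at the rounded time.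
  Strong continuity gives pointwise convergence, the uniform bound on \<open>S\<close> a constant
  majorant, and \<mu> is finite, so dominated convergence applies to the norms.\<close>

lemma grid_approximation:
  "(\<lambda>n. \<Sum>k\<le>(Suc n)\<^sup>2. grid_weight \<mu> n k *\<^sub>R S (real k / real (Suc n)) x) \<longlonglongrightarrow> average x"
proof -
  interpret prob_space \<mu> by (rule prob)
  define v where "v n k = S (real k / real (Suc n)) x" for n k
  define s where "s n t = v n (grid_index n t)" for n t
  have f: "(\<lambda>t. S t x) \<in> borel_measurable \<mu>"
    using borel_measurable_continuous_on_restrict[OF S_continuous] by (simp add: measurable_cong_sets[OF sets_\<mu> refl])
  have ss: "simple_function \<mu> (s n)" for n
    unfolding s_def[abs_def] by (rule simple_function_compose1[OF grid_index_simple])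
  have si: "Bochner_Integration.simple_bochner_integrable \<mu> (s n)" for n
    by (rule Bochner_Integration.simple_bochner_integrable.intros[OF ss]) simp
  have int: "Bochner_Integration.simple_bochner_integral \<mu> (s n) = (\<Sum>k\<le>(Suc n)\<^sup>2. grid_weight \<mu> n k *\<^sub>R S (real k / real (Suc n)) x)" for n
  proof -
    have "Bochner_Integration.simple_bochner_integral \<mu> (s n) = (\<Sum>k\<in>grid_index n ` space \<mu>. measure \<mu> {t \<in> space \<mu>. grid_index n t = k} *\<^sub>R v n k)"
      by (rule Bochner_Integration.simple_bochner_integral_partition[OF si grid_index_simple]) (auto simp: s_def)
    also have "\<dots> = (\<Sum>k\<le>(Suc n)\<^sup>2. measure \<mu> {t \<in> space \<mu>. grid_index n t = k} *\<^sub>R v n k)"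
    proof (rule sum.mono_neutral_left)
      show "\<forall>k\<in>{..(Suc n)\<^sup>2} - grid_index n ` space \<mu>. measure \<mu> {t \<in> space \<mu>. grid_index n t = k} *\<^sub>R v n k = 0"
      proof
        fix k assume "k \<in> {..(Suc n)\<^sup>2} - grid_index n ` space \<mu>"
        then have "{t \<in> space \<mu>. grid_index n t = k} = {}" by auto
        then show "measure \<mu> {t \<in> space \<mu>. grid_index n t = k} *\<^sub>R v n k = 0" by (simp only: measure_empty) simp
      qed
    qed (auto simp: grid_index_def)
    finally show ?thesis by (simp add: grid_weight_def v_def)
  qed
  have "(\<lambda>n. \<integral>\<^sup>+t. ennreal (norm (S t x - s n t)) \<partial>\<mu>) \<longlonglongrightarrow> (\<integral>\<^sup>+t. 0 \<partial>\<mu>)"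
  proof (rule nn_integral_dominated_convergence[where w = "\<lambda>t. ennreal (M0 * norm x + M0 * norm x)"])
    show "(\<lambda>t. ennreal (norm (S t x - s n t))) \<in> borel_measurable \<mu>" for n
      using borel_measurable_norm_diff_simple[OF f ss] by measurable
    show "AE t in \<mu>. ennreal (norm (S t x - s n t)) \<le> ennreal (M0 * norm x + M0 * norm x)" for n
    proof (rule AE_I2, rule ennreal_leI)
      fix t assume "t \<in> space \<mu>"
      then have "norm (S t x) \<le> M0 * norm x" by (intro S_bound) (simp add: space_\<mu>)
      moreover have "norm (s n t) \<le> M0 * norm x" unfolding s_def v_def by (intro S_bound) simp
      ultimately show "norm (S t x - s n t) \<le> M0 * norm x + M0 * norm x"
        using norm_triangle_ineq4[of "S t x" "s n t"] by linarith
    qed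
    show "(\<integral>\<^sup>+t. ennreal (M0 * norm x + M0 * norm x) \<partial>\<mu>) < \<infinity>"
      by (simp add: emeasure_space_1 del: ennreal_plus)
    show "AE t in \<mu>. (\<lambda>n. ennreal (norm (S t x - s n t))) \<longlonglongrightarrow> 0"
    proof (rule AE_I2)
      fix t assume "t \<in> space \<mu>"
      then have t: "t \<ge> 0" by (simp add: space_\<mu>)
      have "(\<lambda>n. s n t) \<longlonglongrightarrow> S t x"
        unfolding s_def v_def
        using S_continuous[of x] t grid_index_tendsto[OF t]
        by (auto simp: continuous_on_sequentially o_def)
      from tendsto_norm[OF tendsto_diff[OF tendsto_const[of "S t x"] this]]
      have "(\<lambda>n. norm (S t x - s n t)) \<longlonglongrightarrow> 0" by simp
      from tendsto_ennrealI[OF this] show "(\<lambda>n. ennreal (norm (S t x - s n t))) \<longlonglongrightarrow> 0" by simp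
    qed
  qed auto
  then have "(\<lambda>n. Bochner_Integration.simple_bochner_integral \<mu> (s n)) \<longlonglongrightarrow> banach_integral \<mu> (\<lambda>t. S t x)"
    by (intro tendsto_banach_integral[OF f si]) simp
  then show ?thesis by (simp only: int average_def)
qed

end

section \<open>Passage to the limit\<close>

text \<open>A perturbed resolvent identity drives the convergence:
  \<open>R n (D m x) - R m (D n x) = R n (R m (Tn n x - Tn m x))\<close>. Together with
  \<open>D n x\<close> tending to \<open>x\<close> and the uniform bound it makes
  \<open>R n x\<close> Cauchy. The limit is a left and right inverse because commutation passes to
  the limit.\<close>

lemma approximate_resolvents_limit:
  fixes T :: "'a::complex_banach \<Rightarrow> 'a" and Tn D R :: "nat \<Rightarrow> 'a \<Rightarrow> 'a" and z :: complex
  assumes R: "\<And>n. bounded_clinear (R n)" "\<And>n x. norm (R n x) \<le> C * norm x"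
    and T: "bounded_clinear T" and Tn: "\<And>n. bounded_linear (Tn n)"
    and Tn_lim: "\<And>x. (\<lambda>n. Tn n x) \<longlonglongrightarrow> T x" and D_lim: "\<And>x. (\<lambda>n. D n x) \<longlonglongrightarrow> x"
    and res: "\<And>n x. z *\<^sub>C R n x - Tn n (R n x) = D n x"
    and comm: "\<And>n m x. R n (Tn m x) = Tn m (R n x)" and commD: "\<And>n m x. R n (D m x) = D m (R n x)"
  obtains Q where "bounded_clinear Q" "\<And>x. norm (Q x) \<le> C * norm x"
    "\<And>x. z *\<^sub>C Q x - T (Q x) = x" "\<And>x. Q (z *\<^sub>C x - T x) = x"
proof -
  have C: "C * norm x \<ge> 0" for x :: 'a using order_trans[OF norm_ge_zero R(2)[of 0 x]] .
  note lin = bounded_clinearD[OF R(1)]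
  have diff: "norm (R n x - R m x) \<le> C * norm (x - D m x) + C * (C * norm (Tn n x - Tn m x)) + C * norm (x - D n x)" for n m x
  proof -
    have "R n (z *\<^sub>C R m x - Tn m (R m x)) - R n (z *\<^sub>C R m x - Tn n (R m x)) = R n (R m (Tn n x - Tn m x))"
      by (simp add: lin(4) comm)
    moreover have "R n (z *\<^sub>C R m x - Tn n (R m x)) = D n (R m x)"
      using res[of n "R m x"] by (simp add: lin(4,2) comm)
    ultimately have eq: "R n (D m x) - R m (D n x) = R n (R m (Tn n x - Tn m x))"
      by (simp add: res commD)
    have "R n x - R m x = R n (x - D m x) + (R n (D m x) - R m (D n x)) - R m (x - D n x)"
      by (simp add: lin(4))
    also have "norm \<dots> \<le> norm (R n (x - D m x)) + norm (R n (R m (Tn n x - Tn m x))) + norm (R m (x - D n x))"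
      unfolding eq using norm_triangle_ineq4[of "R n (x - D m x) + R n (R m (Tn n x - Tn m x))" "R m (x - D n x)"]
        norm_triangle_ineq[of "R n (x - D m x)" "R n (R m (Tn n x - Tn m x))"] by linarith
    also have "\<dots> \<le> C * norm (x - D m x) + C * (C * norm (Tn n x - Tn m x)) + C * norm (x - D n x)"
    proof (intro add_mono R(2))
      show "norm (R n (R m (Tn n x - Tn m x))) \<le> C * (C * norm (Tn n x - Tn m x))"
      \<comment> \<open>The sign of \<open>C\<close> is not assumed; a nonzero vector forces
        \<open>C \<ge> 0\<close>, which monotonicity requires.\<close>
      proof (cases "Tn n x - Tn m x = 0")
        case True
        have "R k 0 = 0" for k using lin(4)[of k 0 0] by simp
        with True show ?thesis by simp
      next
        case False
        then have "C \<ge> 0" using C[of "Tn n x - Tn m x"] by (simp add: zero_le_mult_iff)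
        then show ?thesis by (intro order_trans[OF R(2) mult_left_mono[OF R(2)]])
      qed
    qed
    finally show ?thesis .
  qed
  have "Cauchy (\<lambda>n. R n x)" for x
  proof (rule metric_CauchyI)
    fix e :: real assume e: "e > 0"
    have l1: "(\<lambda>n. C * norm (x - D n x)) \<longlonglongrightarrow> C * norm (x - x)"
      by (intro tendsto_intros D_lim)
    have l2: "(\<lambda>n. C * (C * norm (Tn n x - T x))) \<longlonglongrightarrow> C * (C * norm (T x - T x))"
      by (intro tendsto_intros Tn_lim)
    have e4: "e / 4 > 0" using e by simp
    from order_tendstoD(2)[OF l1, of "e / 4"] order_tendstoD(2)[OF l2, of "e / 4"] e4
    have "\<forall>\<^sub>F n in sequentially. C * norm (x - D n x) < e / 4 \<and> C * (C * norm (Tn n x - T x)) < e / 4"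
      by (simp add: eventually_conj_iff)
    then obtain N where N: "\<And>n. n \<ge> N \<Longrightarrow> C * norm (x - D n x) < e / 4" "\<And>n. n \<ge> N \<Longrightarrow> C * (C * norm (Tn n x - T x)) < e / 4"
      unfolding eventually_sequentially by blast
    show "\<exists>N. \<forall>m\<ge>N. \<forall>n\<ge>N. dist (R m x) (R n x) < e"
    proof (intro exI allI impI)
      fix m n assume mn: "m \<ge> N" "n \<ge> N"
      have "norm (Tn m x - Tn n x) \<le> norm (Tn m x - T x) + norm (Tn n x - T x)"
        using norm_triangle_ineq4[of "Tn m x - T x" "Tn n x - T x"] by simp
      then have "C * C * norm (Tn m x - Tn n x) \<le> C * C * (norm (Tn m x - T x) + norm (Tn n x - T x))"
        by (intro mult_left_mono) auto
      with N[OF mn(1)] N[OF mn(2)] diff[of m x n] show "dist (R m x) (R n x) < e"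
        by (simp add: dist_norm algebra_simps)
    qed
  qed
  then have conv: "convergent (\<lambda>n. R n x)" for x by (rule Cauchy_convergent)
  define Q where "Q x = lim (\<lambda>n. R n x)" for x
  have Q: "(\<lambda>n. R n x) \<longlonglongrightarrow> Q x" for x using conv by (simp add: Q_def convergent_LIMSEQ_iff)
  have Qb: "norm (Q x) \<le> C * norm x" for x
    by (rule tendsto_upperbound[OF tendsto_norm[OF Q]]) (auto simp: R(2))
  have Qadd: "Q (x + y) = Q x + Q y" for x y
    using LIMSEQ_unique[OF Q[of "x + y"]] tendsto_add[OF Q[of x] Q[of y]] by (simp add: lin(3))
  have Qscale: "Q (c *\<^sub>C x) = c *\<^sub>C Q x" for c x
  proof (rule LIMSEQ_unique[OF Q])
    show "(\<lambda>n. R n (c *\<^sub>C x)) \<longlonglongrightarrow> c *\<^sub>C Q x"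
      unfolding lin(2) by (rule bounded_linear.tendsto[OF bounded_bilinear.bounded_linear_right[OF bounded_bilinear_scaleC] Q])
  qed
  have Qcl: "bounded_clinear Q" by (rule bounded_clinearI[OF Qadd Qscale Qb])
  have Qlim: "(\<lambda>n. R n (y n)) \<longlonglongrightarrow> Q w" if y: "y \<longlonglongrightarrow> w" for y w
  proof -
    have "(\<lambda>n. R n (y n - w)) \<longlonglongrightarrow> 0"
    proof (rule Lim_null_comparison)
      show "(\<lambda>n. C * norm (y n - w)) \<longlonglongrightarrow> 0"
        using tendsto_mult_left[OF tendsto_norm[OF tendsto_diff[OF y tendsto_const[of w]]], of C] by simp
    qed (simp add: R(2))
    from tendsto_add[OF this Q[of w]] show ?thesis by (simp add: lin(4))
  qed
  have comm1: "Tn m (Q x) = Q (Tn m x)" for m x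
  proof (rule LIMSEQ_unique)
    show "(\<lambda>n. R n (Tn m x)) \<longlonglongrightarrow> Q (Tn m x)" by (rule Q)
    show "(\<lambda>n. R n (Tn m x)) \<longlonglongrightarrow> Tn m (Q x)" unfolding comm by (rule bounded_linear.tendsto[OF Tn Q])
  qed
  have comm2: "T (Q x) = Q (T x)" for x
  proof (rule LIMSEQ_unique)
    show "(\<lambda>m. Tn m (Q x)) \<longlonglongrightarrow> T (Q x)" by (rule Tn_lim)
    show "(\<lambda>m. Tn m (Q x)) \<longlonglongrightarrow> Q (T x)"
      unfolding comm1 by (rule bounded_linear.tendsto[OF bounded_clinearD(1)[OF Qcl] Tn_lim])
  qed
  have main: "z *\<^sub>C Q x - Q (T x) = x" for x
  proof (rule LIMSEQ_unique[OF _ D_lim])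
    have "(\<lambda>n. z *\<^sub>C R n x - R n (Tn n x)) \<longlonglongrightarrow> z *\<^sub>C Q x - Q (T x)"
      by (intro tendsto_diff Qlim Tn_lim
          bounded_linear.tendsto[OF bounded_bilinear.bounded_linear_right[OF bounded_bilinear_scaleC] Q])
    then show "(\<lambda>n. D n x) \<longlonglongrightarrow> z *\<^sub>C Q x - Q (T x)" by (simp add: comm res)
  qed
  show thesis
    by (rule that[OF Qcl Qb]) (simp_all add: comm2 main bounded_clinearD(4)[OF Qcl] Qscale)
qed

lemma bounded_clinear_inverse_imp_resolvent:
  assumes Q: "bounded_clinear Q" "\<And>x. z *\<^sub>C Q x - T (Q x) = x" "\<And>x. Q (z *\<^sub>C x - T x) = x"
  shows "z \<notin> spectrum T" "resolvent T z = Q"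
proof -
  let ?A = "\<lambda>x. z *\<^sub>C x - T x"
  have bij: "bij ?A" by (rule o_bij[of Q]) (auto simp: o_def Q)
  show r: "resolvent T z = Q"
    unfolding resolvent_def by (rule inv_equality) (simp_all add: Q)
  show "z \<notin> spectrum T" unfolding spectrum_def using bij Q(1) r by simp
qed

context subordination
begin

text \<open>The operator occurring in \<open>R_resolvent\<close> for the grid measure with
  \<epsilon> = 1 / (n + 1)^2. The nodes reach up to time n + 1, so each damping factor differs from
  1 by at most 1 / (n + 1).\<close>

definition damped_average :: "nat \<Rightarrow> 'a \<Rightarrow> 'a" where
  "damped_average n x = (\<Sum>k\<le>(Suc n)\<^sup>2. (grid_weight \<mu> n k * exp (- (1 / (real (Suc n))\<^sup>2) * (real k / real (Suc n)))) *\<^sub>R S (real k / real (Suc n)) x)"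

lemma damped_average_tendsto: "(\<lambda>n. damped_average n x) \<longlonglongrightarrow> average x"
proof -
  have M0: "M0 * norm x \<ge> 0" using order_trans[OF norm_ge_zero S_bound[of 0 x]] by simp
  let ?A = "\<lambda>n. \<Sum>k\<le>(Suc n)\<^sup>2. grid_weight \<mu> n k *\<^sub>R S (real k / real (Suc n)) x"
  have "(\<lambda>n. damped_average n x - ?A n) \<longlonglongrightarrow> 0"
  proof (rule Lim_null_comparison)
    show "(\<lambda>n. M0 * norm x * (1 / real (Suc n))) \<longlonglongrightarrow> 0"
      by (rule tendsto_mult_right_zero[OF LIMSEQ_Suc[OF lim_inverse_n']])
    show "\<forall>\<^sub>F n in sequentially. norm (damped_average n x - ?A n) \<le> M0 * norm x * (1 / real (Suc n))"
    proof (intro always_eventually allI)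
      fix n
      define m where "m = real (Suc n)"
      have m: "m > 0" by (simp add: m_def)
      have "damped_average n x - ?A n = (\<Sum>k\<le>(Suc n)\<^sup>2. (grid_weight \<mu> n k * (exp (- (1 / m\<^sup>2) * (real k / m)) - 1)) *\<^sub>R S (real k / m) x)"
        by (simp only: damped_average_def m_def sum_subtractf[symmetric] scaleR_diff_left[symmetric] right_diff_distrib mult_1_right)
      also have "norm \<dots> \<le> (\<Sum>k\<le>(Suc n)\<^sup>2. grid_weight \<mu> n k * (M0 * norm x * (1 / m)))"
      proof (rule sum_norm_le)
        fix k assume "k \<in> {..(Suc n)\<^sup>2}"
        then have "real k \<le> real ((Suc n)\<^sup>2)" by (simp only: of_nat_le_iff atMost_iff)
        also have "\<dots> = m\<^sup>2" by (simp only: m_def of_nat_power)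
        finally have k: "real k \<le> m\<^sup>2" .
        define y where "y = (1 / m\<^sup>2) * (real k / m)"
        have y: "0 \<le> y" "y \<le> 1 / m" using k m by (auto simp: y_def field_simps)
        have "\<bar>exp (- y) - 1\<bar> \<le> 1 / m"
          using exp_ge_add_one_self[of "- y"] y by simp
        moreover have "norm (S (real k / m) x) \<le> M0 * norm x" using m by (intro S_bound) simp
        ultimately have "\<bar>exp (- y) - 1\<bar> * norm (S (real k / m) x) \<le> (1 / m) * (M0 * norm x)"
          using m by (intro mult_mono) auto
        then have "grid_weight \<mu> n k * (\<bar>exp (- y) - 1\<bar> * norm (S (real k / m) x)) \<le> grid_weight \<mu> n k * ((1 / m) * (M0 * norm x))"
          by (intro mult_left_mono grid_weight_nonneg)
        then show "norm ((grid_weight \<mu> n k * (exp (- (1 / m\<^sup>2) * (real k / m)) - 1)) *\<^sub>R S (real k / m) x) \<le> grid_weight \<mu> n k * (M0 * norm x * (1 / m))"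
          using grid_weight_nonneg[of n k] by (simp add: y_def abs_mult ac_simps)
      qed
      also have "\<dots> = M0 * norm x * (1 / m)"
        unfolding sum_distrib_right[symmetric] sum_grid_weight by simp
      finally show "norm (damped_average n x - ?A n) \<le> M0 * norm x * (1 / real (Suc n))" by (simp only: m_def)
    qed
  qed
  from tendsto_add[OF this grid_approximation[of x]] show ?thesis by simp
qed

lemma damped_average_bounded_linear: "bounded_linear (damped_average n)"
  unfolding damped_average_def[abs_def]
  by (intro bounded_linear_sum bounded_linear_const_scaleR bounded_clinearD(1)[OF S_clinear]) simp

lemma average_clinear: "bounded_clinear average"
proof (rule bounded_clinearI)
  note lim = grid_approximation
  note cl = bounded_clinearD[OF S_clinear]
  show "average (x + y) = average x + average y" for x y
    by (rule LIMSEQ_unique[OF lim])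
      (use tendsto_add[OF lim[of x] lim[of y]] in \<open>simp add: cl(3) scaleR_add_right sum.distrib\<close>)
  show "average (c *\<^sub>C x) = c *\<^sub>C average x" for c x
  proof (rule LIMSEQ_unique[OF lim])
    have bl: "bounded_linear (\<lambda>y::'a. c *\<^sub>C y)" by (rule bounded_bilinear.bounded_linear_right[OF bounded_bilinear_scaleC])
    interpret bl: bounded_linear "\<lambda>y::'a. c *\<^sub>C y" by (rule bl)
    show "(\<lambda>n. \<Sum>k\<le>(Suc n)\<^sup>2. grid_weight \<mu> n k *\<^sub>R S (real k / real (Suc n)) (c *\<^sub>C x)) \<longlonglongrightarrow> c *\<^sub>C average x"
      using bl.tendsto[OF lim[of x]] by (simp add: bl.sum bl.scaleR cl(2))
  qed
  show "norm (average x) \<le> M0 * norm x" for x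
  proof (rule tendsto_upperbound[OF tendsto_norm[OF lim]])
    show "\<forall>\<^sub>F n in sequentially. norm (\<Sum>k\<le>(Suc n)\<^sup>2. grid_weight \<mu> n k *\<^sub>R S (real k / real (Suc n)) x) \<le> M0 * norm x"
    proof (intro always_eventually allI)
      fix n
      have "norm (\<Sum>k\<le>(Suc n)\<^sup>2. grid_weight \<mu> n k *\<^sub>R S (real k / real (Suc n)) x) \<le> (\<Sum>k\<le>(Suc n)\<^sup>2. grid_weight \<mu> n k * (M0 * norm x))"
      proof (rule sum_norm_le)
        fix k
        show "norm (grid_weight \<mu> n k *\<^sub>R S (real k / real (Suc n)) x) \<le> grid_weight \<mu> n k * (M0 * norm x)"
          using grid_weight_nonneg[of n k] by (simp add: mult_left_mono S_bound)
      qed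
      then show "norm (\<Sum>k\<le>(Suc n)\<^sup>2. grid_weight \<mu> n k *\<^sub>R S (real k / real (Suc n)) x) \<le> M0 * norm x"
        unfolding sum_distrib_right[symmetric] sum_grid_weight by simp
    qed
  qed simp
qed

lemma resolvent_estimate:
  assumes bounded: "\<And>\<theta>'. 0 < \<theta>' \<Longrightarrow> \<theta>' < \<theta> \<Longrightarrow> \<exists>M. \<forall>z\<in>sector \<theta>'. onorm (F z) \<le> M"
    and \<phi>: "pi / 2 - \<theta> < \<phi>" "\<phi> < pi / 2"
  shows "\<exists>C. \<forall>z. z \<notin> ritt_region \<phi> \<longrightarrow> z \<notin> spectrum average \<and> onorm (resolvent average z) \<le> C / cmod (z - 1)"
proof -
  \<comment> \<open>Successive midpoints: \<psi> lies between \<open>pi / 2 - \<theta>\<close> and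
    \<phi>, so that the cone of \<open>1 - f\<close> is strictly narrower than the one excluded for
    \<open>1 - z\<close>; \<alpha> lies between \<open>pi / 2 - \<psi>\<close> and \<theta>, which
    gives \<open>\<alpha> + \<psi> > pi / 2\<close>; and \<theta>' between \<alpha> and \<theta>
    leaves a sector where \<open>F\<close> is uniformly bounded.\<close>
  define \<psi> where "\<psi> = (pi / 2 - \<theta> + \<phi>) / 2"
  define \<alpha> where "\<alpha> = (pi / 2 - \<psi> + \<theta>) / 2"
  define \<theta>' where "\<theta>' = (\<alpha> + \<theta>) / 2"
  have \<psi>: "0 < \<psi>" "\<psi> < \<phi>" "\<psi> < pi / 2" "pi / 2 - \<psi> < \<theta>" using \<phi> \<theta> by (auto simp: \<psi>_def field_simps)
  have \<alpha>: "0 < \<alpha>" "\<alpha> < \<theta>" "\<alpha> < pi / 2" "pi / 2 < \<alpha> + \<psi>" "\<alpha> + \<psi> < pi"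
  proof -
    have "2 * \<alpha> = pi / 2 - \<psi> + \<theta>" by (simp add: \<alpha>_def)
    then show "0 < \<alpha>" "\<alpha> < \<theta>" "\<alpha> < pi / 2" "pi / 2 < \<alpha> + \<psi>" "\<alpha> + \<psi> < pi"
      using \<psi> \<theta> by linarith+
  qed
  have \<theta>': "\<alpha> < \<theta>'" "\<theta>' < \<theta>" "0 < \<theta>'" "\<theta>' \<le> pi / 2" using \<alpha> \<theta> by (auto simp: \<theta>'_def)
  define a e where "a = cis \<alpha>" and "e = cis \<psi>"
  define \<tau> \<tau>' where "\<tau> = tan \<psi>" and "\<tau>' = tan \<phi>"
  have \<tau>: "0 \<le> \<tau>" "\<tau> < \<tau>'"
    using \<psi> \<phi> tan_gt_zero[of \<psi>] tan_monotone[of \<psi> \<phi>] by (auto simp: \<tau>_def \<tau>'_def)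
  define c0 where "c0 = max (6 + 4 * \<tau>) (2 * (1 + \<tau>')\<^sup>2 / (\<tau>' - \<tau>))"
  have c0: "c0 > 0" using \<tau> by (auto simp: c0_def)
  obtain M where M: "\<And>w. w \<in> sector \<theta>' \<Longrightarrow> onorm (F w) \<le> M" using bounded[OF \<theta>'(3,2)] by blast
  \<comment> \<open>The constant depends on the angles only, neither on the point \<open>z\<close>
    nor on the index of the approximation. The absolute value in \<open>C\<close> avoids tracking
    signs.\<close>
  define b where "b = dirichlet_resolvent.bound a e c0"
  define C where "C = \<bar>b / (2 * pi) * M\<bar>"
  have F_le: "norm (F w x) \<le> M * norm x" if "w \<in> sector \<theta>'" "w \<in> sector \<theta>" for w x
    using bounded_clinearD(6)[OF F_clinear[OF that(2)], of x] mult_right_mono[OF M[OF that(1)] norm_ge_zero[of x]] by linarith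
  have trig: "Re a > 0" "Im a > 0" "Re e > 0" "Im e > 0" "Re (a * e) < 0" "cmod a = 1" "cmod e = 1"
  proof -
    show "Re a > 0" "Im a > 0" using \<alpha> by (auto simp: a_def intro!: cos_gt_zero sin_gt_zero)
    show "Re e > 0" "Im e > 0" using \<psi> by (auto simp: e_def intro!: cos_gt_zero sin_gt_zero)
    have "0 < sin (\<alpha> + \<psi> - pi / 2)" using \<alpha> by (intro sin_gt_zero) auto
    then show "Re (a * e) < 0" by (simp add: a_def e_def cis_mult sin_diff)
  qed (simp_all add: a_def e_def)
  have w_shift: "of_real h + w \<in> sector \<theta>'" "of_real h + w \<in> sector \<theta>" if "w \<in> wedge a" "h > 0" for w h
    using that \<alpha> \<theta> \<theta>' unfolding a_def by (auto intro: shifted_wedge_in_sector)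
  have main: "z \<notin> spectrum average \<and> onorm (resolvent average z) \<le> C / cmod (z - 1)" if z: "z \<notin> ritt_region \<phi>" for z
  proof -
    have \<phi>0: "0 < \<phi>" using \<phi> \<theta> by simp
    note nz = not_in_ritt_region[OF \<phi>0 \<phi>(2) z]
    \<comment> \<open>One index drives all regularizations: mesh, \<delta> and \<open>h\<close> are
      1 / (n + 1), \<epsilon> is its square. The square makes the damping vanish in the limit
      although the grid extends to time n + 1.\<close>
    define R where "R n = semigroup_resolvent.R F a e z (1 / real (Suc n)) {..(Suc n)\<^sup>2} (grid_weight \<mu> n)
        (\<lambda>k. real k / real (Suc n)) (1 / (real (Suc n))\<^sup>2) (1 / real (Suc n))" for n
    have loc: "semigroup_resolvent S F \<theta> a e z (1 / real (Suc n)) c0 {..(Suc n)\<^sup>2} (grid_weight \<mu> n)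
        (\<lambda>k. real k / real (Suc n)) (1 / (real (Suc n))\<^sup>2) (1 / real (Suc n)) M" for n
    proof (intro semigroup_resolvent.intro semigroup_resolvent_axioms.intro dirichlet_resolvent.intro holomorphic_semigroup_axioms)
      show "sum (grid_weight \<mu> n) {..(Suc n)\<^sup>2} = 1" by (rule sum_grid_weight)
      fix w assume w: "w \<in> wedge e"
      have Rew: "Re w \<ge> 0" by (rule wedge_Re_nonneg[OF trig(3,4) w])
      have "\<bar>Im w\<bar> * cos \<psi> \<le> (\<tau> * Re w) * cos \<psi>"
        using w trig(3) by (simp add: wedge_def e_def \<tau>_def tan_def)
      then have cone: "\<bar>Im w\<bar> \<le> \<tau> * Re w" using trig(3) by (simp add: e_def)
      show "cmod (1 - z) + (\<Sum>k\<in>{..(Suc n)\<^sup>2}. grid_weight \<mu> n k * (1 - exp (- (real k / real (Suc n)) * Re w))) \<le>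
         c0 * cmod (z - (\<Sum>k\<in>{..(Suc n)\<^sup>2}. of_real (grid_weight \<mu> n k) * exp (- of_real (real k / real (Suc n)) * w)))"
        unfolding c0_def
        by (rule dirichlet_lower_bound[OF grid_weight_nonneg sum_grid_weight _ cone Rew \<tau>]) (use nz in \<open>auto simp: \<tau>'_def\<close>)
    next
      fix w x assume w: "w \<in> wedge a"
      have h: "1 / real (Suc n) > 0" by simp
      show "of_real (1 / real (Suc n)) + w \<in> sector \<theta>" by (rule w_shift(2)[OF w h])
      show "norm (F (of_real (1 / real (Suc n)) + w) x) \<le> M * norm x" by (intro F_le w_shift w h)
    qed (use trig c0 nz(2) grid_weight_nonneg in auto)
    note sr = semigroup_resolvent.R_clinear[OF loc, folded R_def] semigroup_resolvent.R_bound[OF loc, folded R_def]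
      semigroup_resolvent.R_S_commute[OF loc, folded R_def] semigroup_resolvent.R_resolvent[OF loc, folded R_def]
    define D where "D n x = exp (- (1 / (real (Suc n))\<^sup>2) * (1 / real (Suc n) + 1 / real (Suc n))) *\<^sub>R S (1 / real (Suc n) + 1 / real (Suc n)) x" for n x
    have inv: "(\<lambda>n. 1 / real (Suc n)) \<longlonglongrightarrow> 0" by (rule LIMSEQ_Suc[OF lim_inverse_n'])
    have D_lim: "(\<lambda>n. D n x) \<longlonglongrightarrow> x" for x
    proof -
      have inv2: "(\<lambda>n. 1 / real (Suc n) + 1 / real (Suc n)) \<longlonglongrightarrow> 0" using tendsto_add[OF inv inv] by simp
      then have "(\<lambda>n. S (1 / real (Suc n) + 1 / real (Suc n)) x) \<longlonglongrightarrow> S 0 x"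
        using S_continuous[of x] unfolding continuous_on_sequentially o_def
        by (elim ballE[of _ _ 0] allE[of _ "\<lambda>n. 1 / real (Suc n) + 1 / real (Suc n)"]) auto
      moreover have "(\<lambda>n. exp (- (1 / real (Suc n))\<^sup>2 * (1 / real (Suc n) + 1 / real (Suc n)))) \<longlonglongrightarrow> exp (- 0\<^sup>2 * 0)"
        by (intro tendsto_intros inv inv2)
      ultimately have "(\<lambda>n. exp (- (1 / real (Suc n))\<^sup>2 * (1 / real (Suc n) + 1 / real (Suc n))) *\<^sub>R S (1 / real (Suc n) + 1 / real (Suc n)) x) \<longlonglongrightarrow> exp (- 0\<^sup>2 * 0) *\<^sub>R S 0 x"
        by (intro tendsto_scaleR)
      then show ?thesis by (simp add: D_def power_divide S_0)
    qed
    have Rbound: "norm (R n x) \<le> C / cmod (z - 1) * norm x" for n x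
    proof -
      have "norm (R n x) \<le> b / (2 * pi) * M / cmod (1 - z) * norm x" using sr(2)[of n x] by (simp only: b_def)
      also have "\<dots> \<le> C / cmod (1 - z) * norm x" unfolding C_def by (intro mult_right_mono divide_right_mono abs_ge_self norm_ge_zero)
      finally show ?thesis by (simp add: norm_minus_commute)
    qed
    have comm: "R n (damped_average m x) = damped_average m (R n x)" for n m x
    proof -
      interpret bounded_linear "R n" by (rule bounded_clinearD(1)[OF sr(1)])
      show ?thesis by (simp add: damped_average_def sum scaleR sr(3))
    qed
    have commD: "R n (D m x) = D m (R n x)" for n m x
    proof -
      interpret bounded_linear "R n" by (rule bounded_clinearD(1)[OF sr(1)])
      show ?thesis by (simp add: D_def scaleR sr(3))
    qed
    have res: "z *\<^sub>C R n x - damped_average n (R n x) = D n x" for n x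
      unfolding damped_average_def D_def by (rule sr(4))
    show ?thesis
    proof (rule approximate_resolvents_limit[where R = R and C = "C / cmod (z - 1)" and z = z and D = D
          and Tn = damped_average and T = average])
      fix Q assume Q: "bounded_clinear Q" "\<And>x. norm (Q x) \<le> C / cmod (z - 1) * norm x"
        "\<And>x. z *\<^sub>C Q x - average (Q x) = x" "\<And>x. Q (z *\<^sub>C x - average x) = x"
      note r = bounded_clinear_inverse_imp_resolvent[OF Q(1,3,4)]
      show ?thesis using r onorm_bound[OF _ Q(2)] by (simp add: C_def)
    qed (fact sr(1) Rbound average_clinear damped_average_bounded_linear
          damped_average_tendsto D_lim res comm commD)+
  qed
  then show ?thesis by blast
qed

end

theorem theorem4p17:
  fixes S :: "real \<Rightarrow> 'a::complex_banach \<Rightarrow> 'a"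
    and \<theta> :: real
    and \<mu> :: "real measure"
    and T :: "'a \<Rightarrow> 'a"
  assumes "0 < \<theta>" and "\<theta> \<le> pi / 2"
    and "sectorially_bounded_holomorphic_semigroup \<theta> S"
    and "prob_space \<mu>"
    and "sets \<mu> = sets (restrict_space borel {0..})"
    and "\<And>x. T x = banach_integral \<mu> (\<lambda>t. S t x)"
  shows "ritt_operator (pi / 2 - \<theta>) T"
proof -
  obtain F where C0: "C0_semigroup S" and F: "\<And>t. t > 0 \<Longrightarrow> F (of_real t) = S t"
    "operator_holomorphic_on F (sector \<theta>)"
    and bounded: "\<And>\<theta>'. 0 < \<theta>' \<Longrightarrow> \<theta>' < \<theta> \<Longrightarrow> \<exists>M. \<forall>z\<in>sector \<theta>'. onorm (F z) \<le> M"
    using assms(3) unfolding sectorially_bounded_holomorphic_semigroup_def by blast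
  interpret H: holomorphic_semigroup S F \<theta>
    by (rule holomorphic_semigroup.intro[OF assms(1,2) C0 F])
  obtain M where M: "\<And>z. z \<in> sector (\<theta> / 2) \<Longrightarrow> onorm (F z) \<le> M"
    using bounded[of "\<theta> / 2"] assms(1) by auto
  \<comment> \<open>The positive half-axis lies in the sector of angle \<open>\<theta> / 2\<close>;
    the 1 in the maximum covers \<open>t = 0\<close>, where \<open>S\<close> is the identity and
    \<open>F\<close> gives no information.\<close>
  have S_bound: "norm (S t x) \<le> max 1 M * norm x" if "t \<ge> 0" for t x
  proof (cases "t = 0")
    case True
    then show ?thesis using mult_right_mono[of 1 "max 1 M" "norm x"] by (simp add: H.S_0)
  next
    case False
    with that have t: "t > 0" by simp
    have "norm (S t x) \<le> onorm (S t) * norm x" by (rule bounded_clinearD(6)[OF H.S_clinear[OF that]])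
    also have "\<dots> \<le> max 1 M * norm x"
      using M[OF sector_of_real[of "\<theta> / 2" t]] assms(1,2) t F(1)[OF t] by (intro mult_right_mono) auto
    finally show ?thesis .
  qed
  interpret subordination S F \<theta> \<mu> "max 1 M"
    by (intro subordination.intro subordination_axioms.intro H.holomorphic_semigroup_axioms assms(4,5) S_bound)
  have T: "T = average" using assms(6) by (auto simp: average_def)
  have est: "\<exists>C. \<forall>z. z \<notin> ritt_region \<phi> \<longrightarrow> z \<notin> spectrum T \<and> onorm (resolvent T z) \<le> C / cmod (z - 1)"
    if \<phi>: "pi / 2 - \<theta> < \<phi>" "\<phi> < pi / 2" for \<phi>
    unfolding T using resolvent_estimate[OF bounded \<phi>] by blast
  \<comment> \<open>A point outside the region of the critical angle is also outside one of a larger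
    angle, where the estimate already excludes it from the spectrum.\<close>
  have "spectrum T \<subseteq> ritt_region (pi / 2 - \<theta>)"
  proof
    fix z assume z: "z \<in> spectrum T"
    show "z \<in> ritt_region (pi / 2 - \<theta>)"
    proof (rule ccontr)
      assume "z \<notin> ritt_region (pi / 2 - \<theta>)"
      then obtain \<phi> where "pi / 2 - \<theta> < \<phi>" "\<phi> < pi / 2" "z \<notin> ritt_region \<phi>"
        using ritt_region_enlarge[of "pi / 2 - \<theta>" z] assms(1,2) by auto
      with est z show False by blast
    qed
  qed
  moreover have "bounded_clinear T" unfolding T by (rule average_clinear)
  moreover have "\<exists>C. \<forall>z. z \<notin> ritt_region \<phi> \<longrightarrow> onorm (resolvent T z) \<le> C / cmod (z - 1)"
    if "pi / 2 - \<theta> < \<phi>" "\<phi> < pi / 2" for \<phi>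
    using est[OF that] by blast
  ultimately show ?thesis
    unfolding ritt_operator_def using assms(1,2) by auto
qed

end
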